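(* Let $F$ be a perfect tract, $\Gamma$ an ordered abelian group, and $\mathbf M=(M_1,\dots,M_k)$ a tuple of $F[\Gamma]$-matroids on a finite totally ordered set $E$. Then $\mathbf M$ is a flag $F[\Gamma]$-matroid if and only if $\mathbf M^{\mathbf u}=(M_1^{\mathbf u},\dots,M_k^{\mathbf u})$ is a flag $F$-matroid for all $\mathbf u\in(\Gamma\cup\{\infty\})^E$.
   Context: Tracts. A tract $F=(F^\times,N_F)$ is a multiplicative abelian group $F^\times$ (identity $1$) together with a subset $N_F$ (the null set) of the group semiring $\mathbb N[F^\times]$ of finite formal sums such that: $0\in N_F$; $1\notin N_F$; there is a unique element $-1\in F^\times$ with $1+(-1)\in N_F$; and if $\sum a_i\in N_F$ then $\sum c a_i\in N_F$ for all $c\in F^\times$. We also write $F=F^\times\cup\{0\}$ with $0\cdot g=0$; zero terms of formal sums are dropped. A homomorphism of tracts is a group homomorphism $F_1^\times\to F_2^\times$ whose induced map on formal sums sends $N_{F_1}$ into $N_{F_2}$. Every tract carries a fixed involution $a\mapsto\overline a$ (a tract homomorphism $F\to F$ squaring to the identity); on $F[\Gamma]$ (below) it is $\overline{(a,\gamma)}=(\overline a,\gamma)$. Tropical extension. $\Gamma$ is a (totally) ordered abelian group, written additively; $\infty$ is larger than every element of $\Gamma$ and absorbing. $F[\Gamma]$ is the tract with group $F^\times\times\Gamma$, zero element $\infty$, and null set consisting of the zero sum and all finite sums $\sum_{i\in I}(a_i,\gamma_i)$ with $\sum_{i\in I_{\min}}a_i\in N_F$, where $I_{\min}=\{i\in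 I:\gamma_i\le\gamma_j\ \forall j\in I\}$. Put $\theta(a,\gamma)=a$, $\theta(\infty)=0$, $|(a,\gamma)|=\gamma$, $|\infty|=\infty$. Matroids. For $0\le r\le|E|$, a (strong) Plücker vector of rank $r$ on $E$ is a nonzero function $P\colon\binom Er\to F$ with $\sum_{j\in J\setminus I}\operatorname{sign}(j;I,J)P(I+j)P(J-j)\in N_F$ for all $I\in\binom{E}{r-1}$, $J\in\binom{E}{r+1}$, where $\operatorname{sign}(j;I,J)=(-1)^\ell$, $\ell=\#\{j'\in J:j<j'\}+\#\{i\in I:j<i\}$ (no condition if no such $I$ or no such $J$ exists). An $F$-matroid is an equivalence class of Plücker vectors under scaling by $F^\times$ (over a perfect tract weak and strong matroids coincide). For $\tau=\{i_0<\dots<i_r\}$ let $(C_\tau)_{i_s}=(-1)^sP(\tau-i_s)$, $0$ elsewhere; the circuits $\mathcal C(M)\subseteq F^E$ are the $F^\times$-multiples of the nonzero $C_\tau$. An $F$-matroid is determined by its set of circuits. $X\perp Y$ means $\sum_{i\in E} X_i\overline{Y_i}\in N_F$; $\mathcal X^\perp$ is the set of tuples orthogonal to all of $\mathcal X$. The dual $M^*$ has Plücker vector $P^*(I)=\operatorname{sign}(I,I^c)\overline{P(I^c)}$, with $\operatorname{sign}(I,I^c)$ the sign of the permutation listing $I$ then $I^c=E\setminus I$, each increasingly. $\mathcal V^*(M)=\mathcal C(M)^\perp$, $\mathcal V(M)=\mathcal C(M^* )^\perp$. $F$ is perfect if $\mathcal V(M)^\perp=\mathcal V^*(M)$ for every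 $F$-matroid $M$. Contraction and coloops. For $X\in F^E$, $A\subseteq E$, $X\setminus A\in F^{E\setminus A}$ is the restriction. $\operatorname{MinSupp}(\mathcal X)$ is the set of nonzero elements of $\mathcal X$ whose support is inclusion-minimal among the nonzero elements. $M/A$ is the $F$-matroid on $E\setminus A$ with circuits $\operatorname{MinSupp}\{C\setminus A: C\in\mathcal C(M)\}$. For $A$ disjoint from the ground set of $M$, $M+_{co\ell}A$ is the $F$-matroid on $E\sqcup A$ with circuits $\mathcal C(M)\times\{(0,\dots,0)\in F^A\}$ (every element of $A$ is a coloop). Initial matroids. For $\mathbf u\in\Gamma^E$ and $M$ an $F[\Gamma]$-matroid with Plücker vector $P$ of rank $r$, $M^{\mathbf u}$ is the $F$-matroid with Plücker vector $P^{\mathbf u}(I)=\theta(P(I))$ if $|P(I)|-\sum_{i\in I}u_i\le|P(J)|-\sum_{j\in J}u_j$ for all $J\in\binom Er$, and $0$ otherwise. For $\mathbf u\in(\Gamma\cup\{\infty\})^E$ put $Z_{\mathbf u}=\{i:u_i=\infty\}$, $\mathbf u^\circ=\mathbf u\setminus Z_{\mathbf u}\in\Gamma^{E\setminus Z_{\mathbf u}}$, and $M^{\mathbf u}=(M/Z_{\mathbf u})^{\mathbf u^\circ}+_{co\ell}Z_{\mathbf u}$ (an $F$-matroid on $E$). Flag matroids. Let $M,N$ be strong $F$-matroids on $E$ of ranks $r,s$ with Plücker vectors $P,Q$. $M$ is a quotient of $N$ ($N\twoheadrightarrow M$) if $r\le s$ and $\sum_{j\in J\setminus I}\operatorname{sign}(j;I,J)P(I+j)Q(J-j)\in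 N_F$ for all $I\in\binom E{r-1}$, $J\in\binom E{s+1}$. A flag $F$-matroid is a sequence $(M_1,\dots,M_k)$ of strong $F$-matroids on $E$ with $M_j\twoheadrightarrow M_i$ for all $1\le i<j\le k$. *)

theory Defs
  imports "HOL-Algebra.Group" "HOL-Library.Multiset" "HOL-Combinatorics.Permutations"
begin

section \<open>Tracts\<close>

text \<open>
  The underlying group record carries only the units. Formal sums, i.e. elements of the group
  semiring \<open>\<nat>[F\<^sup>\<times>]\<close>, are finite multisets of units. The fixed involution is part of the structure.
\<close>

record 'a tract = "'a monoid" +
  nullset :: "'a multiset set"
  invol :: "'a \<Rightarrow> 'a"

definition tract_hom :: "('a, 'm) tract_scheme \<Rightarrow> ('b, 'n) tract_scheme \<Rightarrow> ('a \<Rightarrow> 'b) set" where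
  "tract_hom F G = {h \<in> hom F G. \<forall>m \<in> nullset F. image_mset h m \<in> nullset G}"

locale tract = comm_group F for F (structure) +
  assumes nullset_carrier: "m \<in> nullset F \<Longrightarrow> set_mset m \<subseteq> carrier F"
    and null_zero: "{#} \<in> nullset F"
    and null_one: "{#\<one>#} \<notin> nullset F"
    and null_neg_one: "\<exists>!e. e \<in> carrier F \<and> {#\<one>, e#} \<in> nullset F"
    and null_scale: "m \<in> nullset F \<Longrightarrow> c \<in> carrier F \<Longrightarrow> image_mset (\<lambda>a. c \<otimes> a) m \<in> nullset F"
    and invol_hom: "invol F \<in> tract_hom F F"
    and invol_invol: "a \<in> carrier F \<Longrightarrow> invol F (invol F a) = a"

definition neg_one :: "('a, 'm) tract_scheme \<Rightarrow> 'a" where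
  "neg_one F = (THE e. e \<in> carrier F \<and> {#\<one>\<^bsub>F\<^esub>, e#} \<in> nullset F)"

text \<open>The set \<open>F\<^sup>\<times> \<union> {0}\<close> lives in the option type, with \<^const>\<open>None\<close> as zero.\<close>

definition zcarrier :: "('a, 'm) tract_scheme \<Rightarrow> 'a option set" where
  "zcarrier F = insert None (Some ` carrier F)"

fun zmult :: "('a, 'm) tract_scheme \<Rightarrow> 'a option \<Rightarrow> 'a option \<Rightarrow> 'a option" where
  "zmult F (Some a) (Some b) = Some (a \<otimes>\<^bsub>F\<^esub> b)"
| "zmult F _ _ = None"

definition zsign :: "('a, 'm) tract_scheme \<Rightarrow> nat \<Rightarrow> 'a option" where
  "zsign F l = Some (neg_one F [^]\<^bsub>F\<^esub> l)"

definition formal_sum :: "('i \<Rightarrow> 'a option) \<Rightarrow> 'i set \<Rightarrow> 'a multiset" where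
  "formal_sum f S = image_mset (\<lambda>i. the (f i)) (mset_set {i \<in> S. f i \<noteq> None})"


section \<open>Tropical extensions\<close>

text \<open>
  The zero \<open>\<infinity>\<close> of the extension is again \<^const>\<open>None\<close>, and elements of \<open>\<Gamma> \<union> {\<infinity>}\<close> are
  represented in the option type over \<open>\<Gamma>\<close>, with \<^const>\<open>None\<close> as \<open>\<infinity>\<close>.
\<close>

definition trop_ext :: "('a, 'm) tract_scheme \<Rightarrow> ('a \<times> 'g::linordered_ab_group_add) tract" where
  "trop_ext F =
    \<lparr> carrier = carrier F \<times> UNIV,
      monoid.mult = (\<lambda>(a, x) (b, y). (a \<otimes>\<^bsub>F\<^esub> b, x + y)),
      one = (\<one>\<^bsub>F\<^esub>, 0),
      nullset = {m. set_mset m \<subseteq> carrier F \<times> UNIV \<and>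
        (m = {#} \<or> image_mset fst {#p \<in># m. \<forall>q \<in># m. snd p \<le> snd q#} \<in> nullset F)},
      invol = (\<lambda>(a, x). (invol F a, x)) \<rparr>"

definition theta :: "('a \<times> 'g) option \<Rightarrow> 'a option" where
  "theta = map_option fst"

definition val :: "('a \<times> 'g) option \<Rightarrow> 'g option" where
  "val = map_option snd"

fun inf_le :: "'g::linorder option \<Rightarrow> 'g option \<Rightarrow> bool" where
  "inf_le _ None = True"
| "inf_le None (Some _) = False"
| "inf_le (Some x) (Some y) = (x \<le> y)"

definition inf_minus :: "'g::ab_group_add option \<Rightarrow> 'g \<Rightarrow> 'g option" where
  "inf_minus x g = map_option (\<lambda>a. a - g) x"


section \<open>Matroids over tracts\<close>

definition exch_sign :: "('a, 'm) tract_scheme \<Rightarrow> 'e::linorder \<Rightarrow> 'e set \<Rightarrow> 'e set \<Rightarrow> 'a option" where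
  "exch_sign F j I J = zsign F (card {j' \<in> J. j < j'} + card {i \<in> I. j < i})"

definition exch_sum :: "('a, 'm) tract_scheme \<Rightarrow> ('e::linorder set \<Rightarrow> 'a option) \<Rightarrow>
    ('e set \<Rightarrow> 'a option) \<Rightarrow> 'e set \<Rightarrow> 'e set \<Rightarrow> 'a multiset" where
  "exch_sum F P Q I J =
    formal_sum (\<lambda>j. zmult F (exch_sign F j I J) (zmult F (P (insert j I)) (Q (J - {j})))) (J - I)"

text \<open>
  Functions on the \<open>r\<close>-subsets of \<open>E\<close> are extended by zero to all sets, so that equality of
  functions is equality of Pluecker vectors.
\<close>

definition plucker_vector ::
  "('a, 'm) tract_scheme \<Rightarrow> 'e::linorder set \<Rightarrow> nat \<Rightarrow> ('e set \<Rightarrow> 'a option) \<Rightarrow> bool" where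
  "plucker_vector F E r P \<longleftrightarrow>
    (\<forall>I. P I \<in> zcarrier F) \<and>
    (\<forall>I. P I \<noteq> None \<longrightarrow> I \<subseteq> E \<and> card I = r) \<and>
    (\<exists>I. P I \<noteq> None) \<and>
    (\<forall>I J. I \<subseteq> E \<and> card I + 1 = r \<and> J \<subseteq> E \<and> card J = r + 1 \<longrightarrow> exch_sum F P P I J \<in> nullset F)"

definition zscale :: "('a, 'm) tract_scheme \<Rightarrow> 'a \<Rightarrow> ('i \<Rightarrow> 'a option) \<Rightarrow> 'i \<Rightarrow> 'a option" where
  "zscale F c X = (\<lambda>i. zmult F (Some c) (X i))"

text \<open>
  The component \<open>plvecs\<close> is a full class of Pluecker vectors modulo scaling by units, so that
  equality of records is equality of matroids.
\<close>

record ('e, 'a) fmatroid =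
  ground :: "'e set"
  mrank :: nat
  plvecs :: "('e set \<Rightarrow> 'a option) set"

definition matroid :: "('a, 'm) tract_scheme \<Rightarrow> ('e::linorder, 'a) fmatroid \<Rightarrow> bool" where
  "matroid F M \<longleftrightarrow> finite (ground M) \<and>
    (\<exists>P. plucker_vector F (ground M) (mrank M) P \<and> plvecs M = {zscale F c P | c. c \<in> carrier F})"

text \<open>
  Tuples in \<open>F\<^sup>E\<close> are likewise extended by zero outside \<open>E\<close>. Hence the restriction \<open>X \<setminus> A\<close>
  sets the entries in \<open>A\<close> to zero, and appending zero entries to a tuple does not change the function.
\<close>

definition tuples :: "('a, 'm) tract_scheme \<Rightarrow> 'e set \<Rightarrow> ('e \<Rightarrow> 'a option) set" where
  "tuples F E = {X. (\<forall>i. X i \<in> zcarrier F) \<and> (\<forall>i. i \<notin> E \<longrightarrow> X i = None)}"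

definition restr :: "('e \<Rightarrow> 'a option) \<Rightarrow> 'e set \<Rightarrow> 'e \<Rightarrow> 'a option" where
  "restr X A = (\<lambda>i. if i \<in> A then None else X i)"

definition supp :: "('e \<Rightarrow> 'a option) \<Rightarrow> 'e set" where
  "supp X = {i. X i \<noteq> None}"

definition min_supp :: "('e \<Rightarrow> 'a option) set \<Rightarrow> ('e \<Rightarrow> 'a option) set" where
  "min_supp \<X> = {X \<in> \<X>. supp X \<noteq> {} \<and> (\<forall>Y \<in> \<X>. supp Y \<noteq> {} \<longrightarrow> \<not> supp Y \<subset> supp X)}"

definition circuit_vec ::
  "('a, 'm) tract_scheme \<Rightarrow> ('e::linorder set \<Rightarrow> 'a option) \<Rightarrow> 'e set \<Rightarrow> 'e \<Rightarrow> 'a option" where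
  "circuit_vec F P \<tau> =
    (\<lambda>i. if i \<in> \<tau> then zmult F (zsign F (card {j \<in> \<tau>. j < i})) (P (\<tau> - {i})) else None)"

definition circuits ::
  "('a, 'm) tract_scheme \<Rightarrow> ('e::linorder, 'a) fmatroid \<Rightarrow> ('e \<Rightarrow> 'a option) set" where
  "circuits F M = {zscale F c (circuit_vec F P \<tau>) | c P \<tau>.
    c \<in> carrier F \<and> P \<in> plvecs M \<and> \<tau> \<subseteq> ground M \<and> card \<tau> = mrank M + 1 \<and>
    supp (circuit_vec F P \<tau>) \<noteq> {}}"


section \<open>Orthogonality, duality, perfect tracts\<close>

definition orthogonal ::
  "('a, 'm) tract_scheme \<Rightarrow> 'e set \<Rightarrow> ('e \<Rightarrow> 'a option) \<Rightarrow> ('e \<Rightarrow> 'a option) \<Rightarrow> bool" where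
  "orthogonal F E X Y \<longleftrightarrow>
    formal_sum (\<lambda>i. zmult F (X i) (map_option (invol F) (Y i))) E \<in> nullset F"

definition perp ::
  "('a, 'm) tract_scheme \<Rightarrow> 'e set \<Rightarrow> ('e \<Rightarrow> 'a option) set \<Rightarrow> ('e \<Rightarrow> 'a option) set" where
  "perp F E \<X> = {Y \<in> tuples F E. \<forall>X \<in> \<X>. orthogonal F E X Y}"

text \<open>
  The permutation of \<open>E\<close> sending the \<open>k\<close>-th element of \<open>E\<close> to the \<open>k\<close>-th entry of the list
  consisting of \<open>I\<close> followed by \<open>E \<setminus> I\<close>, each in increasing order.
\<close>

definition listing_perm :: "'e::linorder set \<Rightarrow> 'e set \<Rightarrow> 'e \<Rightarrow> 'e" where
  "listing_perm E I = (\<lambda>x. if x \<in> E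
    then (sorted_list_of_set I @ sorted_list_of_set (E - I)) ! card {y \<in> E. y < x} else x)"

definition dual_plucker :: "('a, 'm) tract_scheme \<Rightarrow> 'e::linorder set \<Rightarrow>
    ('e set \<Rightarrow> 'a option) \<Rightarrow> 'e set \<Rightarrow> 'a option" where
  "dual_plucker F E P = (\<lambda>I. if I \<subseteq> E
    then zmult F (Some (if sign (listing_perm E I) = 1 then \<one>\<^bsub>F\<^esub> else neg_one F))
      (map_option (invol F) (P (E - I)))
    else None)"

text \<open>
  The image of a scaling class under \<^const>\<open>dual_plucker\<close> is again a full scaling class, since the
  involution permutes the units.
\<close>

definition dual ::
  "('a, 'm) tract_scheme \<Rightarrow> ('e::linorder, 'a) fmatroid \<Rightarrow> ('e, 'a) fmatroid" where
  "dual F M = \<lparr> ground = ground M, mrank = card (ground M) - mrank M,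
    plvecs = dual_plucker F (ground M) ` plvecs M \<rparr>"

definition covectors ::
  "('a, 'm) tract_scheme \<Rightarrow> ('e::linorder, 'a) fmatroid \<Rightarrow> ('e \<Rightarrow> 'a option) set" where
  "covectors F M = perp F (ground M) (circuits F M)"

definition vectors ::
  "('a, 'm) tract_scheme \<Rightarrow> ('e::linorder, 'a) fmatroid \<Rightarrow> ('e \<Rightarrow> 'a option) set" where
  "vectors F M = perp F (ground M) (circuits F (dual F M))"

text \<open>
  Every finite totally ordered set is order-isomorphic to a finite set of natural numbers, so it
  suffices to let the ground sets range over the latter.
\<close>

definition perfect :: "('a, 'm) tract_scheme \<Rightarrow> bool" where
  "perfect F \<longleftrightarrow>
    (\<forall>M :: (nat, 'a) fmatroid. matroid F M \<longrightarrow> perp F (ground M) (vectors F M) = covectors F M)"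


section \<open>Contractions, coloops and initial matroids\<close>

definition contract ::
  "('a, 'm) tract_scheme \<Rightarrow> ('e::linorder, 'a) fmatroid \<Rightarrow> 'e set \<Rightarrow> ('e, 'a) fmatroid" where
  "contract F M A = (THE M'. matroid F M' \<and> ground M' = ground M - A \<and>
    circuits F M' = min_supp {restr C A | C. C \<in> circuits F M})"

definition add_coloops ::
  "('a, 'm) tract_scheme \<Rightarrow> ('e::linorder, 'a) fmatroid \<Rightarrow> 'e set \<Rightarrow> ('e, 'a) fmatroid" where
  "add_coloops F M A = (THE M'. matroid F M' \<and> ground M' = ground M \<union> A \<and>
    circuits F M' = circuits F M)"

definition initial_plucker :: "'e set \<Rightarrow> nat \<Rightarrow> ('e \<Rightarrow> 'g::linordered_ab_group_add) \<Rightarrow>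
    ('e set \<Rightarrow> ('a \<times> 'g) option) \<Rightarrow> 'e set \<Rightarrow> 'a option" where
  "initial_plucker E r u P = (\<lambda>I.
    if I \<subseteq> E \<and> card I = r \<and>
      (\<forall>J. J \<subseteq> E \<and> card J = r \<longrightarrow> inf_le (inf_minus (val (P I)) (sum u I)) (inf_minus (val (P J)) (sum u J)))
    then theta (P I) else None)"

text \<open>
  Scaling \<open>P\<close> by \<open>(a, \<gamma>)\<close> scales the initial Pluecker vector by \<open>a\<close>, so the image of a scaling class
  is again a full scaling class.
\<close>

definition initial_finite :: "('e \<Rightarrow> 'g::linordered_ab_group_add) \<Rightarrow>
    ('e, 'a \<times> 'g) fmatroid \<Rightarrow> ('e, 'a) fmatroid" where
  "initial_finite u M = \<lparr> ground = ground M, mrank = mrank M,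
    plvecs = initial_plucker (ground M) (mrank M) u ` plvecs M \<rparr>"

definition infinite_coords :: "'e set \<Rightarrow> ('e \<Rightarrow> 'g option) \<Rightarrow> 'e set" where
  "infinite_coords E u = {i \<in> E. u i = None}"

text \<open>Only the values of \<open>u\<close> on the ground set matter.\<close>

definition initial_matroid :: "('a, 'm) tract_scheme \<Rightarrow> ('e \<Rightarrow> 'g::linordered_ab_group_add option) \<Rightarrow>
    ('e::linorder, 'a \<times> 'g) fmatroid \<Rightarrow> ('e, 'a) fmatroid" where
  "initial_matroid F u M = (let Z = infinite_coords (ground M) u in
    add_coloops F (initial_finite (\<lambda>i. the (u i)) (contract (trop_ext F) M Z)) Z)"


section \<open>Flag matroids\<close>

text \<open>\<open>is_quotient F N M\<close> means that \<open>M\<close> is a quotient of \<open>N\<close>.\<close>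

definition is_quotient :: "('a, 'm) tract_scheme \<Rightarrow> ('e::linorder, 'a) fmatroid \<Rightarrow>
    ('e, 'a) fmatroid \<Rightarrow> bool" where
  "is_quotient F N M \<longleftrightarrow> ground M = ground N \<and> mrank M \<le> mrank N \<and>
    (\<exists>P \<in> plvecs M. \<exists>Q \<in> plvecs N. \<forall>I J.
      I \<subseteq> ground M \<and> card I + 1 = mrank M \<and> J \<subseteq> ground M \<and> card J = mrank N + 1 \<longrightarrow>
      exch_sum F P Q I J \<in> nullset F)"

definition flag_matroid :: "('a, 'm) tract_scheme \<Rightarrow> 'e::linorder set \<Rightarrow>
    ('e, 'a) fmatroid list \<Rightarrow> bool" where
  "flag_matroid F E Ms \<longleftrightarrow>
    (\<forall>M \<in> set Ms. matroid F M \<and> ground M = E) \<and>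
    (\<forall>i j. i < j \<and> j < length Ms \<longrightarrow> is_quotient F (Ms ! j) (Ms ! i))"

end

theory Submission
  imports Defs
begin

text \<open>
  All conditions are exchange relations between functions on sets: the exchange sum of \<open>P\<close> and \<open>Q\<close> at
  \<open>I, J\<close> is, up to a sign, the pairing of the cocircuit of \<open>P\<close> at \<open>I\<close> with the circuit of \<open>Q\<close> at \<open>J\<close>.
  Exchange relations pass to contractions, to initial forms and to coloop_fun extensions, which gives one
  direction. The other direction rests on the fact that over a perfect tract exchange relations
  compose: if \<open>R\<close> and \<open>P\<close>, and \<open>P\<close> and \<open>Q\<close> satisfy them and \<open>P\<close> is a Pluecker vector, then so do \<open>R\<close> and
  \<open>Q\<close>. Given a cocircuit \<open>Y\<close> of \<open>P\<close> and a circuit \<open>X\<close> of \<open>Q\<close> over the tropical extension, choose \<open>u\<close> to be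
  the valuation of \<open>Y\<close>, and compose the initial forms of \<open>Y, P, Q, X\<close> on the coordinates where \<open>u\<close> is finite.

  The definite descriptions behind contractions and coloop_fun extensions are resolved by explicit
  Pluecker vectors, because a matroid is determined by its circuits.
\<close>

text \<open>Two obstacles shape the converse. An initial form taken at a threshold below every term
  is empty, hence null for free, so a null initial sum says something about the tropical sum only
  when a term of minimal valuation survives. Taking \<open>u\<close> to be the valuation of
  \<open>Y\<close> keeps every nonzero entry of \<open>Y\<close>; the zero entries of
  \<open>Y\<close> are the reason why infinite coordinates must be allowed in \<open>u\<close>.
  Secondly, the initial forms of \<open>Y\<close> and \<open>X\<close> are in general not a
  cocircuit of the initial matroid of \<open>P\<close> and a circuit of that of \<open>Q\<close>:
  \<open>Y\<close> becomes only a covector and \<open>X\<close> only a vector. The exchange relation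
  between the initial matroids pairs cocircuits with circuits, and the passage from these to
  covectors and vectors is what perfection provides. It is applied twice, once through each initial
  matroid.\<close>

declare not_None_eq [iff del]

section \<open>Multiplication with zero, signs and formal sums\<close>

lemma zmult_None_right [simp]: "zmult F x None = None"
  by (cases x) auto

lemma zmult_eq_None_iff [simp]: "zmult F x y = None \<longleftrightarrow> x = None \<or> y = None"
  by (cases x; cases y) auto

lemma None_in_zcarrier [simp]: "None \<in> zcarrier F"
  by (simp add: zcarrier_def)

lemma Some_in_zcarrier [simp]: "Some a \<in> zcarrier F \<longleftrightarrow> a \<in> carrier F"
  by (auto simp: zcarrier_def)

lemma zcarrier_unitE:
  assumes "x \<in> zcarrier F" "x \<noteq> None"
  obtains a where "x = Some a" "a \<in> carrier F"
  using assms by (auto simp: zcarrier_def)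

text \<open>The sign is kept as an exponent rather than as a unit, so that each sign identity below
  reduces to comparing parities of cardinalities.\<close>

definition signed :: "('a, 'm) tract_scheme \<Rightarrow> nat \<Rightarrow> 'a option \<Rightarrow> 'a option" where
  "signed F n x = zmult F (zsign F n) x"

definition null_sum :: "('a, 'm) tract_scheme \<Rightarrow> ('i \<Rightarrow> 'a option) \<Rightarrow> 'i set \<Rightarrow> bool" where
  "null_sum F f S \<longleftrightarrow> formal_sum f S \<in> nullset F"

text \<open>Unlike in \<open>orthogonal\<close>, no involution is applied; it enters only when this
  pairing is compared with duals and covectors.\<close>

definition pairs_null :: "('a, 'm) tract_scheme \<Rightarrow> 'e set \<Rightarrow> ('e \<Rightarrow> 'a option) \<Rightarrow> ('e \<Rightarrow> 'a option) \<Rightarrow> bool" where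
  "pairs_null F E X Y \<longleftrightarrow> null_sum F (\<lambda>i. zmult F (X i) (Y i)) E"

definition zfun :: "('a, 'm) tract_scheme \<Rightarrow> ('i \<Rightarrow> 'a option) \<Rightarrow> bool" where
  "zfun F X \<longleftrightarrow> (\<forall>i. X i \<in> zcarrier F)"

lemma zfunD [simp]: "zfun F X \<Longrightarrow> X i \<in> zcarrier F"
  by (simp add: zfun_def)

lemma sg_None [simp]: "signed F n None = None"
  by (simp add: signed_def)

lemma sg_eq_None_iff [simp]: "signed F n x = None \<longleftrightarrow> x = None"
  by (simp add: signed_def zsign_def)

lemma image_mset_set_cong:
  assumes "\<And>i. i \<in> A \<Longrightarrow> f i = g i"
  shows "image_mset f (mset_set A) = image_mset g (mset_set A)"
  by (intro image_mset_cong) (metis assms elem_mset_set count_mset_set(2) not_in_iff)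

text \<open>Zero terms of a formal sum are dropped, so it is enough to compare the families extended
  by zero; the index set may then change together with the family.\<close>

lemma formal_sum_cong:
  assumes "\<And>i. (if i \<in> S then f i else None) = (if i \<in> T then g i else None)"
  shows "formal_sum f S = formal_sum g T"
proof -
  have *: "{i \<in> S. f i \<noteq> None} = {i \<in> T. g i \<noteq> None}"
    using assms by (auto split: if_splits) (metis option.distinct(1))+
  have "f i = g i" if "i \<in> {i \<in> T. g i \<noteq> None}" for i
    using assms[of i] that by (auto split: if_splits)
  then show ?thesis
    unfolding formal_sum_def * by (intro image_mset_set_cong) metis
qed

lemma nulls_cong:
  assumes "\<And>i. (if i \<in> S then f i else None) = (if i \<in> T then g i else None)"
  shows "null_sum F f S \<longleftrightarrow> null_sum F g T"
  unfolding null_sum_def using formal_sum_cong[OF assms] by simp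

lemma pair_cong:
  assumes "\<And>i. i \<in> E \<Longrightarrow> X i = X' i" "\<And>i. i \<in> E \<Longrightarrow> Y i = Y' i"
  shows "pairs_null F E X Y \<longleftrightarrow> pairs_null F E X' Y'"
  unfolding pairs_null_def by (rule nulls_cong) (simp add: assms)

lemma pair_mono_eq:
  assumes "D \<subseteq> E" "\<And>i. i \<in> E - D \<Longrightarrow> X i = None \<or> Y i = None"
  shows "pairs_null F E X Y \<longleftrightarrow> pairs_null F D X Y"
  unfolding pairs_null_def by (rule nulls_cong) (use assms in auto)

lemma formal_sum_scale:
  "formal_sum (\<lambda>i. zmult F (Some c) (f i)) S = image_mset (\<lambda>a. c \<otimes>\<^bsub>F\<^esub> a) (formal_sum f S)"
proof -
  have "image_mset (\<lambda>i. the (zmult F (Some c) (f i))) (mset_set {i \<in> S. f i \<noteq> None}) =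
      image_mset (\<lambda>i. c \<otimes>\<^bsub>F\<^esub> the (f i)) (mset_set {i \<in> S. f i \<noteq> None})"
    by (rule image_mset_set_cong) (auto simp: not_None_eq)
  then show ?thesis
    by (simp add: formal_sum_def multiset.map_comp comp_def)
qed

lemma set_formal_sum:
  "set_mset (formal_sum f S) \<subseteq> {a. \<exists>i \<in> S. f i = Some a}"
proof
  fix a assume "a \<in># formal_sum f S"
  then obtain i where i: "i \<in># mset_set {i \<in> S. f i \<noteq> None}" "a = the (f i)"
    by (auto simp: formal_sum_def)
  then have "i \<in> {i \<in> S. f i \<noteq> None}"
    by (metis count_eq_zero_iff count_mset_set(2,3))
  then show "a \<in> {a. \<exists>i \<in> S. f i = Some a}" using i by auto
qed

section \<open>Units, signs and null sums in a tract\<close>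

context tract
begin

lemma zmult_closed [simp, intro]: "x \<in> zcarrier F \<Longrightarrow> y \<in> zcarrier F \<Longrightarrow> zmult F x y \<in> zcarrier F"
  by (cases x; cases y) auto

lemma zmult_assoc: "x \<in> zcarrier F \<Longrightarrow> y \<in> zcarrier F \<Longrightarrow> z \<in> zcarrier F \<Longrightarrow>
    zmult F (zmult F x y) z = zmult F x (zmult F y z)"
  by (cases x; cases y; cases z) (auto simp: m_assoc)

lemma zmult_commute: "x \<in> zcarrier F \<Longrightarrow> y \<in> zcarrier F \<Longrightarrow> zmult F x y = zmult F y x"
  by (cases x; cases y) (auto simp: m_comm)

lemma zmult_left_commute: "x \<in> zcarrier F \<Longrightarrow> y \<in> zcarrier F \<Longrightarrow> z \<in> zcarrier F \<Longrightarrow>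
    zmult F x (zmult F y z) = zmult F y (zmult F x z)"
  by (metis zmult_assoc zmult_commute)

lemma zmult_one [simp]: "x \<in> zcarrier F \<Longrightarrow> zmult F (Some \<one>) x = x"
  by (cases x) auto

lemma zmult_cancel: "x \<in> zcarrier F \<Longrightarrow> y \<in> zcarrier F \<Longrightarrow> k \<in> zcarrier F \<Longrightarrow> k \<noteq> None \<Longrightarrow>
    zmult F k x = zmult F k y \<longleftrightarrow> x = y"
  by (cases x; cases y; cases k) auto

lemma zmult_divide:
  assumes "x \<in> zcarrier F" "y \<in> zcarrier F" "y \<noteq> None"
  obtains c where "c \<in> zcarrier F" "x = zmult F c y"
proof -
  obtain b where b: "y = Some b" "b \<in> carrier F" using assms zcarrier_unitE by metis
  have "x = zmult F (zmult F x (Some (inv b))) y"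
    using assms b by (cases x) (auto simp: m_assoc)
  then show ?thesis using that[of "zmult F x (Some (inv b))"] assms b by auto
qed

lemma neg_one_unique: "e \<in> carrier F \<Longrightarrow> {#\<one>, e#} \<in> nullset F \<Longrightarrow> e = neg_one F"
  unfolding neg_one_def using null_neg_one by (metis (no_types, lifting) the_equality)

lemma neg_one_closed [simp, intro]: "neg_one F \<in> carrier F"
  and neg_one_null: "{#\<one>, neg_one F#} \<in> nullset F"
  using neg_one_unique null_neg_one by auto

lemma null_scale_iff:
  assumes "set_mset m \<subseteq> carrier F" "c \<in> carrier F"
  shows "image_mset (\<lambda>a. c \<otimes> a) m \<in> nullset F \<longleftrightarrow> m \<in> nullset F"
proof
  assume "image_mset (\<lambda>a. c \<otimes> a) m \<in> nullset F"
  then have "image_mset (\<lambda>a. inv c \<otimes> a) (image_mset (\<lambda>a. c \<otimes> a) m) \<in> nullset F"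
    using assms by (rule_tac null_scale) auto
  moreover have "image_mset (\<lambda>a. inv c \<otimes> a) (image_mset (\<lambda>a. c \<otimes> a) m) = image_mset (\<lambda>a. a) m"
    unfolding multiset.map_comp using assms
    by (intro image_mset_cong) (auto simp: m_assoc[symmetric] subset_iff)
  ultimately show "m \<in> nullset F" by (simp only: multiset.map_ident)
qed (use assms null_scale in auto)

lemma single_not_null: "a \<in> carrier F \<Longrightarrow> {#a#} \<notin> nullset F"
  using null_scale_iff[of "{#\<one>#}" a] null_one by simp

text \<open>Multiplication by \<open>inv a\<close> reduces this to the uniqueness of -1.\<close>

lemma two_null_iff:
  assumes "a \<in> carrier F" "b \<in> carrier F"
  shows "{#a, b#} \<in> nullset F \<longleftrightarrow> b = neg_one F \<otimes> a"
proof -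
  have "{#a, b#} \<in> nullset F \<longleftrightarrow> {#\<one>, b \<otimes> inv a#} \<in> nullset F"
    using null_scale_iff[of "{#\<one>, b \<otimes> inv a#}" a] assms
    by (simp add: m_comm[of a] m_assoc)
  also have "\<dots> \<longleftrightarrow> b \<otimes> inv a = neg_one F"
    using assms neg_one_unique neg_one_null by auto
  also have "\<dots> \<longleftrightarrow> b = neg_one F \<otimes> a"
    using assms inv_solve_right'[of "neg_one F" b a] by auto
  finally show ?thesis .
qed

lemma neg_one_sq: "neg_one F \<otimes> neg_one F = \<one>"
  using two_null_iff[of "neg_one F" \<one>] neg_one_null by (simp add: add_mset_commute)

lemma zsign_closed [simp, intro]: "zsign F n \<in> zcarrier F"
  by (simp add: zsign_def)

lemma zsign_parity: "even m = even n \<Longrightarrow> zsign F m = zsign F n"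
proof -
  have *: "neg_one F [^] k = (if even k then \<one> else neg_one F)" for k :: nat
    by (induction k) (auto simp: neg_one_sq)
  show "even m = even n \<Longrightarrow> zsign F m = zsign F n"
    by (simp add: zsign_def *)
qed

lemma sg_closed [simp, intro]: "x \<in> zcarrier F \<Longrightarrow> signed F n x \<in> zcarrier F"
  by (simp add: signed_def)

lemma zsign_mult: "zmult F (zsign F m) (zsign F n) = zsign F (m + n)"
  by (simp add: zsign_def nat_pow_mult)

lemma sg_sg [simp]: "x \<in> zcarrier F \<Longrightarrow> signed F m (signed F n x) = signed F (m + n) x"
  by (simp add: signed_def zmult_assoc[symmetric] zsign_mult)

lemma sg_mult_left [simp]: "x \<in> zcarrier F \<Longrightarrow> y \<in> zcarrier F \<Longrightarrow> zmult F (signed F m x) y = signed F m (zmult F x y)"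
  by (simp add: signed_def zmult_assoc)

lemma sg_mult_right [simp]: "x \<in> zcarrier F \<Longrightarrow> y \<in> zcarrier F \<Longrightarrow> zmult F x (signed F m y) = signed F m (zmult F x y)"
  by (simp add: signed_def zmult_left_commute)

lemma sg_cong: "even m = even n \<Longrightarrow> x = y \<Longrightarrow> signed F m x = signed F n y"
  unfolding signed_def using zsign_parity by metis

lemma sg_even: "x \<in> zcarrier F \<Longrightarrow> even m \<Longrightarrow> signed F m x = x"
  using sg_cong[of m 0 x x] by (simp add: signed_def zsign_def)

lemma nulls_scale_iff:
  assumes "c \<in> carrier F" "\<And>i. i \<in> S \<Longrightarrow> f i \<in> zcarrier F"
  shows "null_sum F (\<lambda>i. zmult F (Some c) (f i)) S \<longleftrightarrow> null_sum F f S"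
  unfolding null_sum_def formal_sum_scale
proof (rule null_scale_iff[OF _ assms(1)])
  show "set_mset (formal_sum f S) \<subseteq> carrier F"
    using set_formal_sum[of f S] assms(2) by fastforce
qed

lemma zfun_zscale [simp, intro]: "c \<in> carrier F \<Longrightarrow> zfun F X \<Longrightarrow> zfun F (zscale F c X)"
  by (simp add: zfun_def zscale_def)

lemma pair_zscale_left [simp]:
  assumes "c \<in> carrier F" "zfun F X" "zfun F Y"
  shows "pairs_null F E (zscale F c X) Y \<longleftrightarrow> pairs_null F E X Y"
  unfolding pairs_null_def zscale_def using nulls_scale_iff[of c E "\<lambda>i. zmult F (X i) (Y i)"] assms
  by (simp add: zmult_assoc)

lemma pair_zscale_right [simp]:
  assumes "c \<in> carrier F" "zfun F X" "zfun F Y"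
  shows "pairs_null F E X (zscale F c Y) \<longleftrightarrow> pairs_null F E X Y"
  unfolding pairs_null_def zscale_def using nulls_scale_iff[of c E "\<lambda>i. zmult F (X i) (Y i)"] assms
  by (simp add: zmult_left_commute)

text \<open>The combinatorial content of the axioms: a single unit is never null. Every basis
  exchange below comes from this.\<close>

lemma nulls_not_single:
  assumes "null_sum F f S" "finite S" "i \<in> S" "f i \<noteq> None" "f i \<in> zcarrier F"
  shows "\<exists>j \<in> S. j \<noteq> i \<and> f j \<noteq> None"
proof (rule ccontr)
  assume "\<not> ?thesis"
  then have *: "{j \<in> S. f j \<noteq> None} = {i}" using assms by auto
  then have "formal_sum f S = {#the (f i)#}"
    unfolding formal_sum_def * by simp
  then show False using assms single_not_null by (auto simp: null_sum_def elim!: zcarrier_unitE)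
qed

lemma nulls_empty: "(\<And>i. i \<in> S \<Longrightarrow> f i = None) \<Longrightarrow> null_sum F f S"
  using null_zero formal_sum_cong[of S f "{}" f] by (simp add: null_sum_def formal_sum_def)

text \<open>If one of the two terms vanishes, so does the other, as a null sum cannot have exactly
  one nonzero term; otherwise the uniqueness of -1 decides. This is the source of all
  proportionality results.\<close>

lemma nulls_two_terms:
  assumes "null_sum F f S" "finite S" "i \<in> S" "j \<in> S" "i \<noteq> j"
    and none: "\<And>k. k \<in> S \<Longrightarrow> k \<noteq> i \<Longrightarrow> k \<noteq> j \<Longrightarrow> f k = None"
    and zc: "f i \<in> zcarrier F" "f j \<in> zcarrier F"
  shows "f j = signed F 1 (f i)"
proof (cases "f i = None \<or> f j = None")
  case True
  then have "f i = None \<and> f j = None"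
    using nulls_not_single[OF assms(1,2)] none zc assms by metis
  then show ?thesis by simp
next
  case False
  then have *: "{k \<in> S. f k \<noteq> None} = {i, j}" using assms(3,4) none by auto
  then have "formal_sum f S = {#the (f i), the (f j)#}"
    unfolding formal_sum_def * using \<open>i \<noteq> j\<close> by simp
  moreover obtain a b where "f i = Some a" "f j = Some b" using False by (auto simp: not_None_eq)
  ultimately show ?thesis using assms two_null_iff[of a b]
    by (simp add: null_sum_def signed_def zsign_def)
qed

end

section \<open>Pluecker vectors, vectors and circuits\<close>

text \<open>One relation covers Pluecker vectors (\<open>P = Q\<close> and \<open>r = s\<close>) and
  quotients. It is stated for arbitrary functions on sets, so that it also applies to the functions
  \<open>cov_fun\<close> and \<open>vec_fun\<close> that encode single tuples.\<close>

definition exch :: "('a, 'm) tract_scheme \<Rightarrow> 'e::linorder set \<Rightarrow> ('e set \<Rightarrow> 'a option) \<Rightarrow>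
    ('e set \<Rightarrow> 'a option) \<Rightarrow> nat \<Rightarrow> nat \<Rightarrow> bool" where
  "exch F E P Q r s \<longleftrightarrow> (\<forall>I J. I \<subseteq> E \<and> card I + 1 = r \<and> J \<subseteq> E \<and> card J = s + 1 \<longrightarrow>
    exch_sum F P Q I J \<in> nullset F)"

text \<open>Up to the involution and a sign independent of \<open>j\<close>, this is the circuit of
  the dual at the complement of \<open>I\<close>; see \<open>circuit_vec_dual\<close>.\<close>

definition cocircuit_vec :: "('a, 'm) tract_scheme \<Rightarrow> ('e::linorder set \<Rightarrow> 'a option) \<Rightarrow> 'e set \<Rightarrow>
    'e \<Rightarrow> 'a option" where
  "cocircuit_vec F P I j = (if j \<in> I then None else signed F (card {i \<in> I. j < i}) (P (insert j I)))"

definition rank_fun :: "('a, 'm) tract_scheme \<Rightarrow> 'e set \<Rightarrow> nat \<Rightarrow> ('e set \<Rightarrow> 'a option) \<Rightarrow> bool" where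
  "rank_fun F E r P \<longleftrightarrow> zfun F P \<and> (\<forall>I. P I \<noteq> None \<longrightarrow> I \<subseteq> E \<and> card I = r)"

text \<open>The vectors of a matroid, described through the cocircuits of a Pluecker vector instead
  of the dual matroid and the involution.\<close>

definition is_vector :: "('a, 'm) tract_scheme \<Rightarrow> 'e::linorder set \<Rightarrow> nat \<Rightarrow> ('e set \<Rightarrow> 'a option) \<Rightarrow>
    ('e \<Rightarrow> 'a option) \<Rightarrow> bool" where
  "is_vector F E r P X \<longleftrightarrow> zfun F X \<and> supp X \<subseteq> E \<and>
    (\<forall>I. I \<subseteq> E \<and> card I + 1 = r \<longrightarrow> pairs_null F E (cocircuit_vec F P I) X)"

definition mat_of :: "('a, 'm) tract_scheme \<Rightarrow> 'e set \<Rightarrow> nat \<Rightarrow> ('e set \<Rightarrow> 'a option) \<Rightarrow>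
    ('e, 'a) fmatroid" where
  "mat_of F E r P = \<lparr>ground = E, mrank = r, plvecs = {zscale F c P | c. c \<in> carrier F}\<rparr>"

lemma mat_of_simps [simp]: "ground (mat_of F E r P) = E" "mrank (mat_of F E r P) = r"
  "plvecs (mat_of F E r P) = {zscale F c P | c. c \<in> carrier F}"
  by (simp_all add: mat_of_def)

lemma rank_funD:
  assumes "rank_fun F E r P"
  shows "zfun F P" "P I \<noteq> None \<Longrightarrow> I \<subseteq> E" "P I \<noteq> None \<Longrightarrow> card I = r"
  using assms by (auto simp: rank_fun_def)

lemma rank_fun_finite:
  assumes "rank_fun F E r P" "finite E" "P B \<noteq> None"
  shows "B \<subseteq> E" "card B = r" "finite B"
  using assms finite_subset[of B E] by (auto simp: rank_fun_def)

lemma card_Diff_plus1: "finite A \<Longrightarrow> a \<in> A \<Longrightarrow> card (A - {a}) + 1 = card A"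
  using card_Suc_Diff1 by fastforce

lemma is_vectorD:
  assumes "is_vector F E r P X"
  shows "zfun F X" "supp X \<subseteq> E"
    "I \<subseteq> E \<Longrightarrow> card I + 1 = r \<Longrightarrow> pairs_null F E (cocircuit_vec F P I) X"
  using assms by (auto simp: is_vector_def)

lemma plucker_vector_alt: "plucker_vector F E r P \<longleftrightarrow>
    rank_fun F E r P \<and> (\<exists>I. P I \<noteq> None) \<and> exch F E P P r r"
  unfolding plucker_vector_def rank_fun_def exch_def zfun_def by (simp only: conj_assoc)

lemma plucker_vectorD:
  assumes "plucker_vector F E r P"
  shows "rank_fun F E r P" "\<exists>I. P I \<noteq> None" "exch F E P P r r"
  using assms by (auto simp: plucker_vector_alt)

lemma matroid_iff_mat_of: "matroid F M \<longleftrightarrow>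
    (\<exists>E r P. finite E \<and> plucker_vector F E r P \<and> M = mat_of F E r P)"
proof
  assume "matroid F M"
  then obtain P where "finite (ground M)" "plucker_vector F (ground M) (mrank M) P"
    "plvecs M = {zscale F c P | c. c \<in> carrier F}"
    by (auto simp: matroid_def)
  moreover from this have "M = mat_of F (ground M) (mrank M) P"
    by (cases M) (simp add: mat_of_def)
  ultimately show "\<exists>E r P. finite E \<and> plucker_vector F E r P \<and> M = mat_of F E r P" by blast
qed (auto simp: matroid_def)

lemma card_less_greater:
  fixes i :: "'e::linorder"
  assumes "finite A" "i \<notin> A"
  shows "card {j \<in> A. j < i} + card {j \<in> A. i < j} = card A"
proof -
  have "A = {j \<in> A. j < i} \<union> {j \<in> A. i < j}" using assms(2) by auto (metis linorder_neqE)
  moreover have "{j \<in> A. j < i} \<inter> {j \<in> A. i < j} = {}" by auto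
  ultimately show ?thesis using assms(1) by (metis (no_types, lifting) card_Un_disjoint finite_Un)
qed

lemma card_less_greater_mem:
  fixes i :: "'e::linorder"
  assumes "finite A" "i \<in> A"
  shows "card {j \<in> A. j < i} + card {j \<in> A. i < j} + 1 = card A"
proof -
  have "card {j \<in> A. j < i} = card {j \<in> A - {i}. j < i}" "card {j \<in> A. i < j} = card {j \<in> A - {i}. i < j}"
    by (metis (no_types, lifting) Diff_iff less_irrefl singletonD)+
  then show ?thesis
    using card_less_greater[of "A - {i}" i] card_Diff_plus1[OF assms] assms by simp
qed

context tract
begin

lemma zfun_circuit_vec [simp, intro]: "zfun F P \<Longrightarrow> zfun F (circuit_vec F P \<tau>)"
  by (simp add: zfun_def circuit_vec_def)

lemma zfun_cocircuit_vec [simp, intro]: "zfun F P \<Longrightarrow> zfun F (cocircuit_vec F P I)"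
  by (simp add: zfun_def cocircuit_vec_def)

lemma circuit_vec_sg: "circuit_vec F P \<tau> i =
    (if i \<in> \<tau> then signed F (card {j \<in> \<tau>. j < i}) (P (\<tau> - {i})) else None)"
  by (simp add: circuit_vec_def signed_def)

lemma supp_circuit_vec: "supp (circuit_vec F P \<tau>) = {i \<in> \<tau>. P (\<tau> - {i}) \<noteq> None}"
  by (auto simp: supp_def circuit_vec_sg)

lemma exch_sum_null_iff:
  assumes "finite E" "J \<subseteq> E" "zfun F P" "zfun F Q"
  shows "exch_sum F P Q I J \<in> nullset F \<longleftrightarrow> pairs_null F E (cocircuit_vec F P I) (circuit_vec F Q J)"
proof -
  \<comment> \<open>The exchange sign counts the elements of \<open>J\<close> above
    \<open>i\<close>, the circuit vector those below. Both counts together give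
    \<open>card J - 1\<close> for every \<open>i\<close> in \<open>J\<close>, so the discrepancy is
    a constant sign; \<open>card J + 1\<close> has the same parity without truncated
    subtraction.\<close>
  define k where "k = card J + 1"
  have fin: "finite J" using assms finite_subset by blast
  have "zmult F (cocircuit_vec F P I i) (circuit_vec F Q J i) =
      zmult F (zsign F k) (zmult F (exch_sign F i I J) (zmult F (P (insert i I)) (Q (J - {i}))))"
    if "i \<in> J - I" for i
  proof -
    have *: "card {j \<in> J. j < i} + card {j \<in> J. i < j} + 1 = card J"
      using card_less_greater_mem fin that by blast
    have "zmult F (cocircuit_vec F P I i) (circuit_vec F Q J i) =
      signed F (card {j \<in> I. i < j} + card {j \<in> J. j < i}) (zmult F (P (insert i I)) (Q (J - {i})))"
      using that assms by (simp add: cocircuit_vec_def circuit_vec_sg add.commute)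
    also have "\<dots> = signed F k (signed F (card {j \<in> J. i < j} + card {j \<in> I. i < j}) (zmult F (P (insert i I)) (Q (J - {i}))))"
      using assms * by (simp, intro sg_cong) (simp_all add: k_def, presburger)
    finally show ?thesis by (simp add: signed_def exch_sign_def)
  qed
  then have "pairs_null F E (cocircuit_vec F P I) (circuit_vec F Q J) \<longleftrightarrow> null_sum F (\<lambda>i. zmult F (Some (neg_one F [^] k))
    (zmult F (exch_sign F i I J) (zmult F (P (insert i I)) (Q (J - {i}))))) (J - I)"
    unfolding pairs_null_def
    by (intro nulls_cong) (use assms(2) in \<open>auto simp: cocircuit_vec_def circuit_vec_sg zsign_def\<close>)
  also have "\<dots> \<longleftrightarrow> exch_sum F P Q I J \<in> nullset F"
    unfolding exch_sum_def null_sum_def[symmetric] using assms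
    by (intro nulls_scale_iff) (auto simp: exch_sign_def)
  finally show ?thesis ..
qed

lemma exch_iff_pair:
  assumes "finite E" "zfun F P" "zfun F Q"
  shows "exch F E P Q r s \<longleftrightarrow> (\<forall>I J. I \<subseteq> E \<and> card I + 1 = r \<and> J \<subseteq> E \<and> card J = s + 1 \<longrightarrow>
    pairs_null F E (cocircuit_vec F P I) (circuit_vec F Q J))"
  by (simp add: exch_def exch_sum_null_iff[OF assms(1) _ assms(2,3)] cong: conj_cong)

text \<open>In the exchange sum at \<open>A - {a}\<close> and \<open>insert a B\<close> the term of
  \<open>a\<close> is the product of \<open>P A\<close> and \<open>Q B\<close> up to sign. It is
  nonzero, so the sum has a second nonzero term.\<close>

lemma exch_exchange:
  assumes "exch F E P Q r s" "rank_fun F E r P" "rank_fun F E s Q" "finite E"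
    and "P A \<noteq> None" "Q B \<noteq> None" "a \<in> A - B"
  shows "\<exists>b \<in> B - A. P (insert b (A - {a})) \<noteq> None \<and> Q (insert a B - {b}) \<noteq> None"
proof -
  have AB: "A \<subseteq> E" "card A = r" "B \<subseteq> E" "card B = s" using assms by (auto simp: rank_fun_def)
  have fin: "finite A" "finite B" using AB assms(4) finite_subset by blast+
  have "card (A - {a}) + 1 = r" "card (insert a B) = s + 1"
    using assms AB fin card_Diff_plus1[of A a] by auto
  then have "exch_sum F P Q (A - {a}) (insert a B) \<in> nullset F"
    using assms AB unfolding exch_def by (metis Diff_iff insert_subset subset_eq)
  moreover have "zfun F P" "zfun F Q" using assms by (auto simp: rank_fun_def)
  moreover have "insert a (A - {a}) = A" "insert a B - {a} = B" using assms by auto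
  ultimately have "\<exists>j \<in> insert a B - (A - {a}). j \<noteq> a \<and>
    zmult F (exch_sign F j (A - {a}) (insert a B))
      (zmult F (P (insert j (A - {a}))) (Q (insert a B - {j}))) \<noteq> None"
    unfolding exch_sum_def null_sum_def[symmetric]
    by (rule_tac nulls_not_single[where i = a])
       (use assms fin in \<open>auto simp: exch_sign_def zsign_def\<close>)
  then show ?thesis by auto
qed

lemma pair_scaled:
  assumes "c \<in> carrier F" "zfun F X" "zfun F Y" "\<And>i. i \<in> E \<Longrightarrow> X' i = zmult F (Some c) (X i)"
  shows "pairs_null F E X' Y \<longleftrightarrow> pairs_null F E X Y"
proof -
  have "pairs_null F E X' Y \<longleftrightarrow> pairs_null F E (zscale F c X) Y"
    by (rule pair_cong) (simp_all add: assms(4) zscale_def)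
  then show ?thesis using assms by simp
qed

lemma zscale_zscale: "c \<in> carrier F \<Longrightarrow> d \<in> carrier F \<Longrightarrow> zfun F X \<Longrightarrow>
    zscale F c (zscale F d X) = zscale F (c \<otimes> d) X"
  by (auto simp: zscale_def zmult_assoc[symmetric])

lemma zscale_one [simp]: "zfun F X \<Longrightarrow> zscale F \<one> X = X"
  by (auto simp: zscale_def)

lemma circuit_vec_zscale: "c \<in> carrier F \<Longrightarrow> zfun F P \<Longrightarrow>
    circuit_vec F (zscale F c P) \<tau> = zscale F c (circuit_vec F P \<tau>)"
  by (auto simp: circuit_vec_def zscale_def zmult_left_commute)

lemma supp_zscale [simp]: "supp (zscale F c X) = supp X"
  by (simp add: supp_def zscale_def)

section \<open>Vectors, bases and circuits as vectors of minimal support\<close>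

lemma is_vector_zscale:
  assumes "is_vector F E r P X" "c \<in> carrier F" "zfun F P"
  shows "is_vector F E r P (zscale F c X)"
  unfolding is_vector_def supp_zscale using is_vectorD[OF assms(1)] assms(2,3) by simp

lemma circuit_vec_is_vector:
  assumes "plucker_vector F E r P" "finite E" "\<tau> \<subseteq> E" "card \<tau> = r + 1"
  shows "is_vector F E r P (circuit_vec F P \<tau>)"
proof -
  have "zfun F P" using rank_funD(1)[OF plucker_vectorD(1)[OF assms(1)]] .
  moreover from this have "pairs_null F E (cocircuit_vec F P I) (circuit_vec F P \<tau>)"
    if "I \<subseteq> E" "card I + 1 = r" for I
    using exch_iff_pair[OF assms(2), of P P r r] plucker_vectorD(3)[OF assms(1)] assms(3,4) that by blast
  moreover have "supp (circuit_vec F P \<tau>) \<subseteq> E" using assms(3) by (auto simp: supp_circuit_vec)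
  ultimately show ?thesis by (simp add: is_vector_def)
qed

text \<open>If \<open>X b\<close> were nonzero, the cocircuit at \<open>B - {b}\<close> would meet
  the support of \<open>X\<close> in \<open>b\<close> alone and leave a null sum with a single
  term.\<close>

lemma vector_supp_basis:
  assumes "plucker_vector F E r P" "finite E" "is_vector F E r P X" "P B \<noteq> None" "supp X \<subseteq> B"
  shows "supp X = {}"
proof (rule ccontr)
  assume "supp X \<noteq> {}"
  then obtain b where b: "X b \<noteq> None" "b \<in> B" using assms by (auto simp: supp_def)
  note P = plucker_vectorD[OF assms(1)]
  have B: "B \<subseteq> E" "card B = r" "finite B" using rank_fun_finite[OF P(1) assms(2,4)] by auto
  have "card (B - {b}) + 1 = r" using B b card_Diff_plus1 by metis
  then have "pairs_null F E (cocircuit_vec F P (B - {b})) X"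
    using is_vectorD(3)[OF assms(3), of "B - {b}"] B by auto
  moreover have "insert b (B - {b}) = B" using b by auto
  ultimately have "\<exists>j\<in>E. j \<noteq> b \<and> zmult F (cocircuit_vec F P (B - {b}) j) (X j) \<noteq> None"
    unfolding pairs_null_def
    by (rule_tac nulls_not_single)
       (use assms b B P in \<open>auto simp: cocircuit_vec_def is_vector_def rank_fun_def\<close>)
  then obtain j where "j \<in> E" "j \<noteq> b" "X j \<noteq> None" "j \<notin> B - {b}"
    by (auto simp: cocircuit_vec_def split: if_splits)
  then show False using assms(5) by (auto simp: supp_def)
qed

text \<open>Take a basis \<open>B\<close> that meets \<open>S\<close> in as many elements as
  possible. If some \<open>s\<close> in \<open>S\<close> were missing from \<open>B\<close>, the
  circuit inside \<open>insert s B\<close> would contain an element outside \<open>S\<close>, and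
  exchanging it for \<open>s\<close> would enlarge the intersection.\<close>

lemma circuit_free_extends:
  assumes "plucker_vector F E r P" "finite E" "S \<subseteq> E"
    and free: "\<And>\<tau>. \<tau> \<subseteq> E \<Longrightarrow> card \<tau> = r + 1 \<Longrightarrow> supp (circuit_vec F P \<tau>) \<noteq> {} \<Longrightarrow>
      \<not> supp (circuit_vec F P \<tau>) \<subseteq> S"
  obtains B where "P B \<noteq> None" "S \<subseteq> B"
proof -
  note P = plucker_vectorD[OF assms(1)]
  have bnd: "\<forall>B. P B \<noteq> None \<longrightarrow> card (B \<inter> S) < card E + 1"
    using assms by (auto intro!: le_imp_less_Suc card_mono)
  obtain B where B: "P B \<noteq> None" "\<forall>B'. P B' \<noteq> None \<longrightarrow> card (B' \<inter> S) \<le> card (B \<inter> S)"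
    using P(2) ex_has_greatest_nat[of "\<lambda>B. P B \<noteq> None" _ "\<lambda>B. card (B \<inter> S)", OF _ bnd] by blast
  have BE: "B \<subseteq> E" "card B = r" "finite B"
    using rank_fun_finite[OF P(1) assms(2) B(1)] by auto
  have "S \<subseteq> B"
  proof (rule ccontr)
    assume "\<not> S \<subseteq> B"
    then obtain s where s: "s \<in> S" "s \<notin> B" by auto
    have "s \<in> supp (circuit_vec F P (insert s B))" using s B by (simp add: supp_circuit_vec)
    then have "\<not> supp (circuit_vec F P (insert s B)) \<subseteq> S"
      using free[of "insert s B"] s assms(3) BE by auto
    then obtain i where i: "i \<in> B" "i \<notin> S" "P (insert s B - {i}) \<noteq> None"
      using s by (auto simp: supp_circuit_vec)
    have "(insert s B - {i}) \<inter> S = insert s (B \<inter> S)" using i s by auto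
    then have "card ((insert s B - {i}) \<inter> S) = card (B \<inter> S) + 1" using s BE by simp
    then show False using B(2) i(3) by fastforce
  qed
  then show ?thesis using that B by blast
qed

lemma vector_contains_circuit:
  assumes "plucker_vector F E r P" "finite E" "is_vector F E r P X" "supp X \<noteq> {}"
  obtains \<tau> where "\<tau> \<subseteq> E" "card \<tau> = r + 1" "supp (circuit_vec F P \<tau>) \<noteq> {}"
    "supp (circuit_vec F P \<tau>) \<subseteq> supp X"
proof -
  have "\<exists>\<tau>. \<tau> \<subseteq> E \<and> card \<tau> = r + 1 \<and> supp (circuit_vec F P \<tau>) \<noteq> {} \<and>
    supp (circuit_vec F P \<tau>) \<subseteq> supp X"
  proof (rule ccontr)
    assume "\<not> ?thesis"
    then have free: "\<not> supp (circuit_vec F P \<tau>) \<subseteq> supp X"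
      if "\<tau> \<subseteq> E" "card \<tau> = r + 1" "supp (circuit_vec F P \<tau>) \<noteq> {}" for \<tau>
      using that by blast
    obtain B where B: "P B \<noteq> None" "supp X \<subseteq> B"
      by (rule circuit_free_extends[OF assms(1,2) is_vectorD(2)[OF assms(3)] free])
    show False using vector_supp_basis[OF assms(1-3) B] assms(4) by blast
  qed
  then show ?thesis using that by blast
qed

text \<open>
  A vector supported in \<open>B \<union> {s}\<close>, for a basis \<open>B\<close>, pairs with the cocircuit of \<open>B - {b}\<close> in only
  two terms, so its entry at \<open>b\<close> is a fixed multiple of its entry at \<open>s\<close>.
\<close>

lemma vector_fundamental_entry:
  assumes "plucker_vector F E r P" "finite E" "P B \<noteq> None" "s \<in> E - B" "b \<in> B"
    and X: "is_vector F E r P X" "supp X \<subseteq> insert s B"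
  shows "zmult F (cocircuit_vec F P (B - {b}) b) (X b) =
    signed F 1 (zmult F (cocircuit_vec F P (B - {b}) s) (X s))"
proof -
  note P = plucker_vectorD[OF assms(1)]
  have B: "B \<subseteq> E" "card B = r" "finite B" using rank_fun_finite[OF P(1) assms(2,3)] by auto
  have "card (B - {b}) + 1 = r" using B assms card_Diff_plus1 by metis
  then have "pairs_null F E (cocircuit_vec F P (B - {b})) X"
    using is_vectorD(3)[OF X(1), of "B - {b}"] B by auto
  then show ?thesis unfolding pairs_null_def
    by (rule nulls_two_terms)
       (use assms B P in \<open>auto simp: is_vector_def rank_fun_def cocircuit_vec_def supp_def\<close>)
qed

text \<open>Remove an element \<open>s\<close> at which the circuit is nonzero. What remains of
  \<open>\<tau>\<close> is a basis, and by \<open>vector_fundamental_entry\<close> all entries of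
  \<open>X\<close> and of the circuit are the same multiples of their entries at
  \<open>s\<close>.\<close>

lemma vector_unique:
  assumes "plucker_vector F E r P" "finite E" "is_vector F E r P X"
    and tau: "\<tau> \<subseteq> E" "card \<tau> = r + 1" "supp (circuit_vec F P \<tau>) \<noteq> {}" "supp X \<subseteq> \<tau>" "supp X \<noteq> {}"
  obtains c where "c \<in> carrier F" "X = zscale F c (circuit_vec F P \<tau>)"
proof -
  note P = plucker_vectorD[OF assms(1)]
  define C where "C = circuit_vec F P \<tau>"
  have C: "is_vector F E r P C" using circuit_vec_is_vector assms by (simp add: C_def)
  obtain s where s: "s \<in> \<tau>" "P (\<tau> - {s}) \<noteq> None" "C s \<noteq> None"
    using tau(3) by (auto simp: supp_circuit_vec C_def circuit_vec_sg)
  have suppC: "supp C \<subseteq> \<tau>" by (auto simp: C_def supp_circuit_vec)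
  have zX: "zfun F X" and zC: "zfun F C" and zP: "zfun F P"
    using assms C P by (auto simp: is_vector_def rank_fun_def)
  obtain c where c: "c \<in> zcarrier F" "X s = zmult F c (C s)"
    using zmult_divide[of "X s" "C s"] s zX zC by auto
  have eq: "X b = zmult F c (C b)" for b
  proof (cases "b \<in> \<tau> - {s}")
    case True
    let ?D = "cocircuit_vec F P (\<tau> - {s} - {b})"
    have ins: "insert s (\<tau> - {s}) = \<tau>" "insert b (\<tau> - {s} - {b}) = \<tau> - {s}" using s True by auto
    have D: "?D b \<noteq> None" "?D b \<in> zcarrier F" "?D s \<in> zcarrier F"
      using s ins zP by (auto simp: cocircuit_vec_def)
    have s': "s \<in> E - (\<tau> - {s})" using s tau by auto
    have "zmult F (?D b) (X b) = signed F 1 (zmult F (?D s) (X s))"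
      using vector_fundamental_entry[OF assms(1,2) s(2) s' True assms(3)] tau ins by simp
    also have "\<dots> = zmult F c (signed F 1 (zmult F (?D s) (C s)))"
      using c D zC by (simp add: zmult_left_commute)
    also have "\<dots> = zmult F c (zmult F (?D b) (C b))"
      using vector_fundamental_entry[OF assms(1,2) s(2) s' True C] suppC ins by simp
    also have "\<dots> = zmult F (?D b) (zmult F c (C b))"
      using c D zC by (simp add: zmult_left_commute)
    finally show ?thesis using zmult_cancel D c zC zX by (metis zfunD zmult_closed)
  next
    case False
    then have "b = s \<or> X b = None \<and> C b = None" using tau(4) suppC by (auto simp: supp_def)
    then show ?thesis using c by auto
  qed
  have "c \<noteq> None" using eq tau(5) by (auto simp: supp_def)
  then obtain c' where "c = Some c'" "c' \<in> carrier F" using c(1) zcarrier_unitE by metis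
  then show ?thesis using that[of c'] eq by (auto simp: zscale_def C_def)
qed

lemma circuits_mat_of:
  assumes "zfun F P"
  shows "circuits F (mat_of F E r P) = {zscale F c (circuit_vec F P \<tau>) | c \<tau>.
    c \<in> carrier F \<and> \<tau> \<subseteq> E \<and> card \<tau> = r + 1 \<and> supp (circuit_vec F P \<tau>) \<noteq> {}}" (is "_ = ?R")
proof (intro Set.set_eqI iffI)
  fix X assume "X \<in> circuits F (mat_of F E r P)"
  then obtain c d \<tau> where *: "X = zscale F c (circuit_vec F (zscale F d P) \<tau>)" "c \<in> carrier F"
    "d \<in> carrier F" "\<tau> \<subseteq> E" "card \<tau> = r + 1" "supp (circuit_vec F (zscale F d P) \<tau>) \<noteq> {}"
    unfolding circuits_def by auto
  then have "X = zscale F (c \<otimes> d) (circuit_vec F P \<tau>)"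
    using assms by (simp add: circuit_vec_zscale zscale_zscale)
  then show "X \<in> ?R" using * assms by (auto simp: circuit_vec_zscale intro!: exI[of _ "c \<otimes> d"])
next
  fix X assume "X \<in> ?R"
  then obtain c \<tau> where *: "X = zscale F c (circuit_vec F (zscale F \<one> P) \<tau>)" "c \<in> carrier F"
    "\<tau> \<subseteq> E" "card \<tau> = r + 1" "supp (circuit_vec F (zscale F \<one> P) \<tau>) \<noteq> {}"
    using assms by auto
  then show "X \<in> circuits F (mat_of F E r P)"
    unfolding circuits_def mat_of_simps by blast
qed

text \<open>The tool for computing contractions: a family lying between the circuits and the vectors
  has exactly the circuits as its members of minimal support, so the family itself need not be
  determined.\<close>

lemma circuits_eq_min_supp:
  assumes "plucker_vector F E r P" "finite E"
    and sub: "circuits F (mat_of F E r P) \<subseteq> \<X>" and vec: "\<And>X. X \<in> \<X> \<Longrightarrow> is_vector F E r P X"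
  shows "circuits F (mat_of F E r P) = min_supp \<X>"
proof -
  have zP: "zfun F P" using plucker_vectorD[OF assms(1)] by (simp add: rank_fun_def)
  note circ = circuits_mat_of[OF zP]
  show ?thesis
  proof (intro Set.set_eqI iffI)
    fix X assume X: "X \<in> circuits F (mat_of F E r P)"
    then obtain c \<tau> where *: "X = zscale F c (circuit_vec F P \<tau>)" "c \<in> carrier F"
      "\<tau> \<subseteq> E" "card \<tau> = r + 1" "supp (circuit_vec F P \<tau>) \<noteq> {}"
      unfolding circ by auto
    have "\<not> supp Y \<subset> supp X" if Y: "Y \<in> \<X>" "supp Y \<noteq> {}" for Y
    proof
      assume sub: "supp Y \<subset> supp X"
      then have "supp Y \<subseteq> \<tau>" using * by (auto simp: supp_circuit_vec)
      then obtain d where "Y = zscale F d (circuit_vec F P \<tau>)"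
        using vector_unique[OF assms(1,2) vec[OF Y(1)] *(3,4,5) _ Y(2)] by blast
      then show False using sub * by simp
    qed
    then show "X \<in> min_supp \<X>" using * X sub by (auto simp: min_supp_def)
  next
    fix X assume X: "X \<in> min_supp \<X>"
    then have X': "X \<in> \<X>" "supp X \<noteq> {}" "is_vector F E r P X" using vec by (auto simp: min_supp_def)
    then obtain \<tau> where tau: "\<tau> \<subseteq> E" "card \<tau> = r + 1" "supp (circuit_vec F P \<tau>) \<noteq> {}"
      "supp (circuit_vec F P \<tau>) \<subseteq> supp X"
      using vector_contains_circuit[OF assms(1,2)] by metis
    have "zscale F \<one> (circuit_vec F P \<tau>) \<in> circuits F (mat_of F E r P)"
      unfolding circ using tau by blast
    then have "circuit_vec F P \<tau> \<in> \<X>" using sub zP by auto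
    then have "supp X = supp (circuit_vec F P \<tau>)"
      using X tau by (auto simp: min_supp_def)
    then have "supp X \<subseteq> \<tau>" by (auto simp: supp_circuit_vec)
    then obtain d where "d \<in> carrier F" "X = zscale F d (circuit_vec F P \<tau>)"
      using vector_unique[OF assms(1,2) X'(3) tau(1-3) _ X'(2)] by blast
    then show "X \<in> circuits F (mat_of F E r P)" unfolding circ using tau by blast
  qed
qed

end

section \<open>Contractions\<close>

text \<open>For disjoint sets, the number of inversions of the list consisting of \<open>B\<close>
  followed by \<open>A\<close>, each in increasing order.\<close>

definition inv_count :: "'e::linorder set \<Rightarrow> 'e set \<Rightarrow> nat" where
  "inv_count A B = card {(a, b). a \<in> A \<and> b \<in> B \<and> a < b}"

lemma finite_inv_count: "finite A \<Longrightarrow> finite B \<Longrightarrow> finite {(a, b). a \<in> A \<and> b \<in> B \<and> a < b}"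
  by (rule finite_subset[of _ "A \<times> B"]) auto

lemma inv_count_insert_left:
  assumes "finite A" "finite B" "x \<notin> A"
  shows "inv_count (insert x A) B = inv_count A B + card {b \<in> B. x < b}"
proof -
  have "{(a, b). a \<in> insert x A \<and> b \<in> B \<and> a < b} =
    {(a, b). a \<in> A \<and> b \<in> B \<and> a < b} \<union> Pair x ` {b \<in> B. x < b}" by auto
  moreover have "{(a, b). a \<in> A \<and> b \<in> B \<and> a < b} \<inter> Pair x ` {b \<in> B. x < b} = {}"
    using assms by auto
  ultimately show ?thesis unfolding inv_count_def
    using assms finite_inv_count[of A B] by (simp add: card_Un_disjoint card_image inj_on_def)
qed

lemma inv_count_remove_left:
  assumes "finite A" "finite B" "x \<in> A"
  shows "inv_count A B = inv_count (A - {x}) B + card {b \<in> B. x < b}"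
  using inv_count_insert_left[of "A - {x}" B x] assms by (simp add: insert_absorb)

text \<open>
  The signs in the next two definitions are the ones for which circuit vectors, and not only the exchange
  relations, are preserved up to a factor independent of the coordinate.
\<close>

definition contract_fun :: "('a, 'm) tract_scheme \<Rightarrow> 'e::linorder set \<Rightarrow> 'e set \<Rightarrow> ('e set \<Rightarrow> 'a option) \<Rightarrow>
    'e set \<Rightarrow> 'a option" where
  "contract_fun F Z B P I = (if I \<inter> Z = {} then signed F (inv_count I B) (P (I \<union> B)) else None)"

definition coloop_fun :: "('a, 'm) tract_scheme \<Rightarrow> 'e::linorder set \<Rightarrow> ('e set \<Rightarrow> 'a option) \<Rightarrow>
    'e set \<Rightarrow> 'a option" where
  "coloop_fun F A P I = (if A \<subseteq> I then signed F (inv_count (I - A) A) (P (I - A)) else None)"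

text \<open>A basis of the restriction of the matroid to \<open>Z\<close>: the trace on
  \<open>Z\<close> of some basis, of the largest possible size. Writing that basis as
  \<open>I \<union> B\<close> matches the argument of \<open>P\<close> in
  \<open>contract_fun\<close>.\<close>

definition basis_of :: "('e set \<Rightarrow> 'a option) \<Rightarrow> 'e set \<Rightarrow> 'e set \<Rightarrow> bool" where
  "basis_of P Z B \<longleftrightarrow> B \<subseteq> Z \<and> (\<exists>I. I \<inter> Z = {} \<and> P (I \<union> B) \<noteq> None) \<and>
    (\<forall>K. P K \<noteq> None \<longrightarrow> card (K \<inter> Z) \<le> card B)"

lemma exists_basis_of:
  assumes "rank_fun F E r P" "P K \<noteq> None" "finite Z"
  shows "\<exists>B. basis_of P Z B"
proof -
  have bnd: "\<forall>B. P B \<noteq> None \<longrightarrow> card (B \<inter> Z) < card Z + 1"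
    using assms(3) by (auto intro!: le_imp_less_Suc card_mono)
  obtain B where B: "P B \<noteq> None" "\<forall>B'. P B' \<noteq> None \<longrightarrow> card (B' \<inter> Z) \<le> card (B \<inter> Z)"
    using ex_has_greatest_nat[of "\<lambda>B. P B \<noteq> None" K "\<lambda>B. card (B \<inter> Z)", OF assms(2) bnd] by blast
  have "(B - Z) \<inter> Z = {}" "(B - Z) \<union> (B \<inter> Z) = B" by auto
  then have "basis_of P Z (B \<inter> Z)"
    unfolding basis_of_def using B by (metis inf_le2)
  then show ?thesis by blast
qed

text \<open>A nonzero value would give a trace on \<open>Z\<close> larger than \<open>B\<close>.
  Consequently the cocircuit of \<open>P\<close> at \<open>I \<union> B\<close> vanishes on all of
  \<open>Z\<close>, so that pairings with it can be restricted to the complement.\<close>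

lemma basis_of_maximal:
  assumes "basis_of P Z B" "finite Z" "j \<in> Z - B"
  shows "P (insert j (I \<union> B)) = None"
proof (rule ccontr)
  assume *: "P (insert j (I \<union> B)) \<noteq> None"
  have B: "B \<subseteq> Z" "finite B" using assms finite_subset by (auto simp: basis_of_def)
  have "insert j B \<subseteq> insert j (I \<union> B) \<inter> Z" using assms B by auto
  then have "card (insert j B) \<le> card (insert j (I \<union> B) \<inter> Z)"
    using assms by (intro card_mono) auto
  also have "\<dots> \<le> card B" using assms(1) * by (auto simp: basis_of_def)
  finally show False using assms(3) B by simp
qed

lemma card_filter_Un:
  assumes "finite A" "finite B" "A \<inter> B = {}"
  shows "card {j \<in> A \<union> B. p j} = card {j \<in> A. p j} + card {j \<in> B. p j}"
proof -
  have "{j \<in> A \<union> B. p j} = {j \<in> A. p j} \<union> {j \<in> B. p j}" by auto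
  then show ?thesis using assms by (simp add: card_Un_disjoint disjoint_iff)
qed

section \<open>Reconstruction of a matroid from its circuits\<close>

context tract
begin

text \<open>Bases are the maximal subsets of \<open>E\<close> containing no support of a circuit.
  The right-hand side mentions only \<open>E\<close> and the circuits, so these determine where a
  Pluecker vector is nonzero.\<close>

lemma circuit_free_iff_basis:
  assumes "plucker_vector F E r P" "finite E"
  defines "free \<equiv> \<lambda>S. \<forall>C \<in> circuits F (mat_of F E r P). \<not> supp C \<subseteq> S"
  shows "P B \<noteq> None \<longleftrightarrow> B \<subseteq> E \<and> free B \<and> (\<forall>S. S \<subseteq> E \<and> free S \<and> B \<subseteq> S \<longrightarrow> S = B)"
proof -
  note rf = plucker_vectorD(1)[OF assms(1)]
  note circ = circuits_mat_of[OF rank_funD(1)[OF rf]]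
  have basis_free: "free B" if "P B \<noteq> None" for B
  proof -
    have "\<not> supp C \<subseteq> B" if C: "C \<in> circuits F (mat_of F E r P)" for C
    proof -
      obtain c \<tau> where *: "C = zscale F c (circuit_vec F P \<tau>)" "c \<in> carrier F" "\<tau> \<subseteq> E"
        "card \<tau> = r + 1" "supp (circuit_vec F P \<tau>) \<noteq> {}"
        using C unfolding circ by auto
      then show ?thesis
        using vector_supp_basis[OF assms(1,2) circuit_vec_is_vector[OF assms(1,2) *(3,4)] \<open>P B \<noteq> None\<close>]
        by auto
    qed
    then show ?thesis by (simp add: free_def)
  qed
  have free_basis: "\<exists>B. P B \<noteq> None \<and> S \<subseteq> B" if S: "S \<subseteq> E" "free S" for S
  proof -
    have "\<not> supp (circuit_vec F P \<tau>) \<subseteq> S"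
      if "\<tau> \<subseteq> E" "card \<tau> = r + 1" "supp (circuit_vec F P \<tau>) \<noteq> {}" for \<tau>
    proof -
      have "zscale F \<one> (circuit_vec F P \<tau>) \<in> circuits F (mat_of F E r P)"
        unfolding circ using that by blast
      then have "\<not> supp (zscale F \<one> (circuit_vec F P \<tau>)) \<subseteq> S" using S(2) unfolding free_def by blast
      then show ?thesis by simp
    qed
    then show ?thesis using circuit_free_extends[OF assms(1,2) S(1)] by metis
  qed
  show ?thesis
  proof
    assume B: "P B \<noteq> None"
    have "S = B" if S: "S \<subseteq> E" "free S" "B \<subseteq> S" for S
    proof -
      obtain B' where B': "P B' \<noteq> None" "S \<subseteq> B'" using free_basis S by blast
      have "B' = B" using rank_fun_finite[OF rf assms(2) B] rank_fun_finite[OF rf assms(2) B'(1)] S B'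
        by (metis card_subset_eq subset_trans)
      then show ?thesis using S B' by auto
    qed
    then show "B \<subseteq> E \<and> free B \<and> (\<forall>S. S \<subseteq> E \<and> free S \<and> B \<subseteq> S \<longrightarrow> S = B)"
      using basis_free[OF B] rank_fun_finite[OF rf assms(2) B] by blast
  next
    assume *: "B \<subseteq> E \<and> free B \<and> (\<forall>S. S \<subseteq> E \<and> free S \<and> B \<subseteq> S \<longrightarrow> S = B)"
    obtain B' where B': "P B' \<noteq> None" "B \<subseteq> B'" using free_basis[of B] * by meson
    then have "B' = B"
      using conjunct2[OF conjunct2[OF *], rule_format, of B'] basis_free[OF B'(1)]
        rank_fun_finite(1)[OF rf assms(2) B'(1)] by simp
    then show "P B \<noteq> None" using B' by simp
  qed
qed

lemma circuits_is_vector: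
  assumes "plucker_vector F E r P" "finite E" "C \<in> circuits F (mat_of F E r P)"
  shows "is_vector F E r P C"
proof -
  have zP: "zfun F P" using rank_funD(1)[OF plucker_vectorD(1)[OF assms(1)]] .
  obtain c \<tau> where "C = zscale F c (circuit_vec F P \<tau>)" "c \<in> carrier F" "\<tau> \<subseteq> E" "card \<tau> = r + 1"
    using assms(3) unfolding circuits_mat_of[OF zP] by auto
  then show ?thesis using is_vector_zscale circuit_vec_is_vector assms zP by metis
qed

lemma mat_of_zscale:
  assumes "c \<in> carrier F" "zfun F P"
  shows "mat_of F E r (zscale F c P) = mat_of F E r P"
proof -
  have "{zscale F d (zscale F c P) | d. d \<in> carrier F} = {zscale F d P | d. d \<in> carrier F}"
  proof (intro equalityI subsetI)
    fix Q assume "Q \<in> {zscale F d P | d. d \<in> carrier F}"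
    then obtain d where d: "Q = zscale F d P" "d \<in> carrier F" by auto
    then have "Q = zscale F (d \<otimes> inv c) (zscale F c P)"
      using assms by (simp add: zscale_zscale m_assoc)
    then show "Q \<in> {zscale F d (zscale F c P) | d. d \<in> carrier F}" using d assms by blast
  next
    fix Q assume "Q \<in> {zscale F d (zscale F c P) | d. d \<in> carrier F}"
    then obtain d where "Q = zscale F d (zscale F c P)" "d \<in> carrier F" by auto
    then have "Q = zscale F (d \<otimes> c) P" "d \<otimes> c \<in> carrier F"
      using assms by (simp_all add: zscale_zscale)
    then show "Q \<in> {zscale F d P | d. d \<in> carrier F}" by blast
  qed
  then show ?thesis by (simp add: mat_of_def)
qed

text \<open>The bases agree by \<open>circuit_free_iff_basis\<close>. It remains to see that the
  ratio of \<open>P'\<close> to \<open>P\<close> is constant on bases, which is checked along single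
  exchanges starting from one basis \<open>B0\<close>.\<close>

lemma circuits_determine_mat_of:
  assumes P: "plucker_vector F E r P" and P': "plucker_vector F E r' P'" and "finite E"
    and circ: "circuits F (mat_of F E r P) = circuits F (mat_of F E r' P')"
  shows "mat_of F E r P = mat_of F E r' P'"
proof -
  note rf = plucker_vectorD(1)[OF P] and rf' = plucker_vectorD(1)[OF P']
  note zP = rank_funD(1)[OF rf] and zP' = rank_funD(1)[OF rf']
  have bases: "P B \<noteq> None \<longleftrightarrow> P' B \<noteq> None" for B
    using circuit_free_iff_basis[OF P \<open>finite E\<close>] circuit_free_iff_basis[OF P' \<open>finite E\<close>] circ by simp
  obtain B0 where B0: "P B0 \<noteq> None" "P' B0 \<noteq> None" using plucker_vectorD(2)[OF P] bases by blast
  then have r: "r' = r" using rank_funD(3)[OF rf] rank_funD(3)[OF rf'] by metis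
  obtain c where c: "c \<in> zcarrier F" "P' B0 = zmult F c (P B0)"
    using zmult_divide[of "P' B0" "P B0"] B0 zP zP' by auto
  \<comment> \<open>One exchange. The two circuit vectors at \<open>insert s B\<close> are
    proportional, so the ratio is the same whichever element is removed from
    \<open>insert s B\<close>; removing \<open>s\<close> gives \<open>B\<close>, where it is
    \<open>c\<close>.\<close>
  have step: "P' (insert s B - {b}) = zmult F c (P (insert s B - {b}))"
    if "P B \<noteq> None" "P' B = zmult F c (P B)" "s \<in> E - B" "b \<in> insert s B" for B s b
  proof -
    let ?t = "insert s B"
    have B: "B \<subseteq> E" "card B = r" "finite B" using rank_fun_finite[OF rf \<open>finite E\<close> that(1)] by auto
    have t: "?t \<subseteq> E" "card ?t = r + 1" "s \<in> ?t" "?t - {s} = B" using B that by auto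
    have ne: "supp (circuit_vec F P ?t) \<noteq> {}" "supp (circuit_vec F P' ?t) \<noteq> {}"
      using that(1) bases t by (auto simp: supp_circuit_vec)
    have "zscale F \<one> (circuit_vec F P' ?t) \<in> circuits F (mat_of F E r' P')"
      unfolding circuits_mat_of[OF zP'] using t ne r by blast
    then have "is_vector F E r P (circuit_vec F P' ?t)"
      using circuits_is_vector[OF P \<open>finite E\<close>] circ zP' by simp
    moreover have "supp (circuit_vec F P' ?t) \<subseteq> ?t" by (auto simp: supp_circuit_vec)
    ultimately obtain d where d: "d \<in> carrier F" "circuit_vec F P' ?t = zscale F d (circuit_vec F P ?t)"
      using vector_unique[OF P \<open>finite E\<close> _ t(1,2) ne(1) _ ne(2)] by blast
    have eq: "P' (?t - {i}) = zmult F (Some d) (P (?t - {i}))" if "i \<in> ?t" for i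
    proof -
      let ?n = "card {j \<in> ?t. j < i}"
      have "signed F ?n (P' (?t - {i})) = zmult F (Some d) (signed F ?n (P (?t - {i})))"
        using fun_cong[OF d(2), of i] that by (simp add: circuit_vec_sg zscale_def)
      then have "zmult F (zsign F ?n) (P' (?t - {i})) = zmult F (zsign F ?n) (zmult F (Some d) (P (?t - {i})))"
        using d(1) zP by (simp add: signed_def zmult_left_commute)
      then show ?thesis using d(1) zP zP'
        by (subst (asm) zmult_cancel) (auto simp: zsign_def)
    qed
    have "zmult F (P B) c = zmult F (P B) (Some d)"
      using eq[OF t(3)] that(2) t(4) c(1) d(1) zP by (simp add: zmult_commute)
    then have "c = Some d" using zmult_cancel[of c "Some d" "P B"] c(1) d(1) zP that(1) by simp
    then show ?thesis using eq[OF that(4)] by simp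
  qed
  have "P' B = zmult F c (P B)" if "P B \<noteq> None" for B
    using that
  \<comment> \<open>Any two bases are connected by exchanges: each one moves \<open>B\<close> closer
    to \<open>B0\<close>, and the ratio is carried back along it.\<close>
  proof (induction "card (B0 - B)" arbitrary: B)
    case 0
    have fin: "finite B0" "card B0 = r" "finite B" "card B = r"
      using rank_fun_finite[OF rf \<open>finite E\<close>] B0 0 by auto
    then have "B0 \<subseteq> B" using 0 by auto
    then have "B = B0" using fin card_subset_eq[of B B0] by simp
    then show ?case using c by simp
  next
    case (Suc n)
    have fin: "finite B0" "B0 \<subseteq> E" "finite B" "B \<subseteq> E"
      using rank_fun_finite[OF rf \<open>finite E\<close>] B0 Suc.prems by auto
    obtain s where s: "s \<in> B0 - B" using Suc.hyps(2) by (metis card.empty ex_in_conv nat.distinct(1))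
    then obtain b where b: "b \<in> B - B0" "P (insert s B - {b}) \<noteq> None"
      using exch_exchange[OF plucker_vectorD(3)[OF P] rf rf \<open>finite E\<close> B0(1) Suc.prems] by blast
    let ?B = "insert s B - {b}"
    have "B0 - ?B = (B0 - B) - {s}" using s b by auto
    then have "card (B0 - ?B) = n" using s fin Suc.hyps(2) by simp
    then have "P' ?B = zmult F c (P ?B)" using Suc.hyps(1) b by simp
    moreover have "b \<in> E - ?B" "s \<in> insert b ?B" "insert b ?B - {s} = B" using b s fin by auto
    ultimately show ?case using step[OF b(2)] by metis
  qed
  then have "P' = (\<lambda>B. zmult F c (P B))" using bases by (intro ext) (metis zmult_eq_None_iff)
  moreover have "c \<noteq> None" using c B0 by auto
  then obtain d where "c = Some d" "d \<in> carrier F" using c(1) zcarrier_unitE by metis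
  ultimately have "P' = zscale F d P" "d \<in> carrier F" by (auto simp: zscale_def)
  then show ?thesis using mat_of_zscale[of d P E r] zP r by simp
qed

lemma circuits_determine_matroid:
  assumes "matroid F M" "matroid F M'" "ground M = ground M'" "circuits F M = circuits F M'"
  shows "M = M'"
proof -
  obtain E r P E' r' P' where *: "finite E" "plucker_vector F E r P" "M = mat_of F E r P"
    "plucker_vector F E' r' P'" "M' = mat_of F E' r' P'"
    using assms(1,2) unfolding matroid_iff_mat_of by blast
  moreover have "E' = E" using assms(3) * by simp
  ultimately show ?thesis using circuits_determine_mat_of assms(4) by metis
qed

section \<open>Contraction on the level of Pluecker vectors\<close>

lemma sg_zmult: "signed F n x = zmult F (Some (neg_one F [^] n)) x"
  by (simp add: signed_def zsign_def)

lemma pair_sg_left: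
  assumes "zfun F X" "zfun F Y" "\<And>i. i \<in> E \<Longrightarrow> X' i = signed F n (X i)"
  shows "pairs_null F E X' Y \<longleftrightarrow> pairs_null F E X Y"
  using pair_scaled[of "neg_one F [^] n" X Y E X'] assms by (simp add: sg_zmult)

lemma pair_commute: "zfun F X \<Longrightarrow> zfun F Y \<Longrightarrow> pairs_null F E X Y \<longleftrightarrow> pairs_null F E Y X"
  unfolding pairs_null_def by (intro nulls_cong) (simp add: zmult_commute)

lemma pair_sg_right:
  assumes "zfun F X" "zfun F Y" "zfun F Y'" "\<And>i. i \<in> E \<Longrightarrow> Y' i = signed F n (Y i)"
  shows "pairs_null F E X Y' \<longleftrightarrow> pairs_null F E X Y"
  using pair_sg_left[of Y X E Y' n] assms pair_commute by metis

lemma zfun_contr [simp, intro]: "zfun F P \<Longrightarrow> zfun F (contract_fun F Z B P)"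
  by (simp add: zfun_def contract_fun_def)

lemma zfun_coloop [simp, intro]: "zfun F P \<Longrightarrow> zfun F (coloop_fun F A P)"
  by (simp add: zfun_def coloop_fun_def)

lemma zfun_restr [simp, intro]: "zfun F X \<Longrightarrow> zfun F (restr X A)"
  by (simp add: zfun_def restr_def)

text \<open>Deleting \<open>i\<close> from \<open>\<sigma>\<close> loses the inversions with
  elements of \<open>B\<close> above \<open>i\<close>, and passing to
  \<open>\<sigma> \<union> B\<close> adds the elements of \<open>B\<close> below \<open>i\<close> to
  the exponent. Together these are all of \<open>B\<close>, which makes the sign independent of
  \<open>i\<close>.\<close>

lemma circuit_vec_contr:
  assumes "zfun F P" "B \<subseteq> Z" "\<sigma> \<inter> Z = {}" "finite \<sigma>" "finite B"
  shows "circuit_vec F (contract_fun F Z B P) \<sigma> i =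
    signed F (inv_count \<sigma> B + card B) (restr (circuit_vec F P (\<sigma> \<union> B)) Z i)"
proof (cases "i \<in> \<sigma>")
  case True
  have disj: "\<sigma> \<inter> B = {}" using assms by auto
  have "(\<sigma> - {i}) \<inter> Z = {}" "i \<notin> Z" "i \<notin> B" "\<sigma> - {i} \<union> B = \<sigma> \<union> B - {i}" using assms True by auto
  moreover have "card {b \<in> B. b < i} + card {b \<in> B. i < b} = card B"
    using card_less_greater \<open>i \<notin> B\<close> assms(5) by blast
  moreover have "inv_count \<sigma> B = inv_count (\<sigma> - {i}) B + card {b \<in> B. i < b}"
    using inv_count_remove_left assms True by blast
  moreover have "card {j \<in> \<sigma> \<union> B. j < i} = card {j \<in> \<sigma>. j < i} + card {j \<in> B. j < i}"
    by (rule card_filter_Un[OF assms(4,5) disj])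
  ultimately show ?thesis using True assms(1)
    by (simp add: circuit_vec_sg contract_fun_def restr_def) (intro sg_cong, presburger, rule refl)
next
  case False
  then show ?thesis using assms(2) by (auto simp: circuit_vec_sg restr_def)
qed

text \<open>On \<open>Z\<close> the left side vanishes because \<open>insert j I\<close> meets
  \<open>Z\<close>; the right side vanishes on \<open>B\<close> by definition and on
  \<open>Z - B\<close> by maximality.\<close>

lemma cocircuit_vec_contr:
  assumes "zfun F P" "B \<subseteq> Z" "I \<inter> Z = {}" "finite I" "finite B"
    and max: "\<And>j. j \<in> Z - B \<Longrightarrow> P (insert j (I \<union> B)) = None"
  shows "cocircuit_vec F (contract_fun F Z B P) I j = signed F (inv_count I B) (cocircuit_vec F P (I \<union> B) j)"
proof (cases "j \<in> I \<union> Z")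
  case False
  have disj: "I \<inter> B = {}" using assms by auto
  have "j \<notin> B" using False assms by auto
  have "inv_count (insert j I) B = inv_count I B + card {b \<in> B. j < b}"
    using inv_count_insert_left False assms by blast
  moreover have "card {i \<in> I \<union> B. j < i} = card {i \<in> I. j < i} + card {i \<in> B. j < i}"
    by (rule card_filter_Un[OF assms(4,5) disj])
  ultimately show ?thesis using False assms \<open>j \<notin> B\<close>
    by (simp add: cocircuit_vec_def contract_fun_def) (intro sg_cong, presburger, rule refl)
next
  case True
  then show ?thesis using max assms(3) by (auto simp: cocircuit_vec_def contract_fun_def)
qed

lemma pair_cocircuit_contr:
  assumes "zfun F P" "zfun F X" "B \<subseteq> Z" "I \<inter> Z = {}" "finite I" "finite B" "Z \<subseteq> E"
    and max: "\<And>j. j \<in> Z - B \<Longrightarrow> P (insert j (I \<union> B)) = None"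
  shows "pairs_null F (E - Z) (cocircuit_vec F (contract_fun F Z B P) I) (restr X Z) \<longleftrightarrow>
    pairs_null F E (cocircuit_vec F P (I \<union> B)) X"
proof -
  have "pairs_null F (E - Z) (cocircuit_vec F (contract_fun F Z B P) I) (restr X Z) \<longleftrightarrow>
    pairs_null F (E - Z) (cocircuit_vec F (contract_fun F Z B P) I) X"
    by (rule pair_cong) (auto simp: restr_def)
  also have "\<dots> \<longleftrightarrow> pairs_null F (E - Z) (cocircuit_vec F P (I \<union> B)) X"
    by (rule pair_sg_left[OF _ assms(2) cocircuit_vec_contr[OF assms(1,3-6) max]]) (use assms in auto)
  also have "\<dots> \<longleftrightarrow> pairs_null F E (cocircuit_vec F P (I \<union> B)) X"
    using max by (intro pair_mono_eq[symmetric]) (auto simp: cocircuit_vec_def)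
  finally show ?thesis .
qed

lemma pair_contr:
  assumes "finite E" "zfun F P" "zfun F Q" "Z \<subseteq> E" "B \<subseteq> Z" "B' \<subseteq> Z" "I \<subseteq> E - Z" "J \<subseteq> E - Z"
    and max: "\<And>j. j \<in> Z - B \<Longrightarrow> P (insert j (I \<union> B)) = None"
  shows "pairs_null F (E - Z) (cocircuit_vec F (contract_fun F Z B P) I) (circuit_vec F (contract_fun F Z B' Q) J) \<longleftrightarrow>
    pairs_null F E (cocircuit_vec F P (I \<union> B)) (circuit_vec F Q (J \<union> B'))"
proof -
  have f: "finite B" "finite B'" "finite I" "finite J" "I \<inter> Z = {}" "J \<inter> Z = {}"
    using assms(1,4-8) by (auto intro: finite_subset[of _ E])
  have "pairs_null F (E - Z) (cocircuit_vec F (contract_fun F Z B P) I) (circuit_vec F (contract_fun F Z B' Q) J) \<longleftrightarrow>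
    pairs_null F (E - Z) (cocircuit_vec F (contract_fun F Z B P) I) (restr (circuit_vec F Q (J \<union> B')) Z)"
    using pair_sg_right[of _ "restr (circuit_vec F Q (J \<union> B')) Z"
        "circuit_vec F (contract_fun F Z B' Q) J" "E - Z"] circuit_vec_contr[of Q B' Z J] assms f by simp
  also have "\<dots> \<longleftrightarrow> pairs_null F E (cocircuit_vec F P (I \<union> B)) (circuit_vec F Q (J \<union> B'))"
    using pair_cocircuit_contr[of P "circuit_vec F Q (J \<union> B')" B Z I E] assms f by simp
  finally show ?thesis .
qed

text \<open>The two sides play different roles. The cocircuits of \<open>P\<close> must vanish on
  \<open>Z\<close>, whence the maximality of \<open>B\<close>; the set \<open>B'\<close> only has to
  make the ranks fit. The proof of \<open>exch_of_initial_matroids\<close> uses this with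
  \<open>B = {}\<close> and with \<open>B' = Z\<close>.\<close>

lemma exch_contr:
  assumes "exch F E P Q r s" "finite E" "zfun F P" "zfun F Q" "Z \<subseteq> E" "B \<subseteq> Z" "B' \<subseteq> Z"
    and max: "\<And>I j. j \<in> Z - B \<Longrightarrow> P (insert j (I \<union> B)) = None"
    and rs: "r' + card B = r" "s' + card B' = s"
  shows "exch F (E - Z) (contract_fun F Z B P) (contract_fun F Z B' Q) r' s'"
proof -
  have fin: "finite B" "finite B'" "finite (E - Z)" using assms by (auto intro: finite_subset[of _ E])
  have "pairs_null F (E - Z) (cocircuit_vec F (contract_fun F Z B P) I) (circuit_vec F (contract_fun F Z B' Q) J)"
    if IJ: "I \<subseteq> E - Z" "card I + 1 = r'" "J \<subseteq> E - Z" "card J = s' + 1" for I J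
  proof -
    have f: "finite I" "finite J" "I \<inter> B = {}" "J \<inter> B' = {}"
      using IJ fin assms(6,7) by (auto intro: finite_subset)
    have "card (I \<union> B) + 1 = r" "card (J \<union> B') = s + 1"
      using f fin IJ rs by (simp_all add: card_Un_disjoint)
    moreover have "I \<union> B \<subseteq> E" "J \<union> B' \<subseteq> E" using IJ assms by auto
    ultimately have "pairs_null F E (cocircuit_vec F P (I \<union> B)) (circuit_vec F Q (J \<union> B'))"
      using assms exch_iff_pair by blast
    then show ?thesis using pair_contr[OF assms(2-7) IJ(1,3) max] by simp
  qed
  then show ?thesis using exch_iff_pair[OF fin(3)] assms(3,4) by simp
qed

lemma basis_of_rank:
  assumes "rank_fun F E r P" "finite E" "Z \<subseteq> E" "basis_of P Z B"
  obtains I where "I \<inter> Z = {}" "P (I \<union> B) \<noteq> None" "card I + card B = r" "I \<subseteq> E - Z"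
proof -
  obtain I where I: "I \<inter> Z = {}" "P (I \<union> B) \<noteq> None" "B \<subseteq> Z" using assms(4) by (auto simp: basis_of_def)
  note rank_fun_finite[OF assms(1,2) I(2)]
  moreover have "I \<inter> B = {}" using I by auto
  ultimately have "card I + card B = r" "I \<subseteq> E" by (auto simp: card_Un_disjoint)
  then show ?thesis using that I by blast
qed

lemma rank_fun_contr:
  assumes "rank_fun F E r P" "finite E" "B \<subseteq> Z"
  shows "rank_fun F (E - Z) (r - card B) (contract_fun F Z B P)"
proof -
  have "I \<subseteq> E - Z \<and> card I = r - card B" if "contract_fun F Z B P I \<noteq> None" for I
  proof -
    have *: "I \<inter> Z = {}" "P (I \<union> B) \<noteq> None" using that by (auto simp: contract_fun_def split: if_splits)
    note rank_fun_finite[OF assms(1,2) *(2)]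
    moreover have "I \<inter> B = {}" using * assms by auto
    ultimately show ?thesis using *(1) by (auto simp: card_Un_disjoint)
  qed
  then show ?thesis using rank_funD(1)[OF assms(1)] by (auto simp: rank_fun_def)
qed

lemma plucker_vector_contr:
  assumes P: "plucker_vector F E r P" and "finite E" "Z \<subseteq> E" "basis_of P Z B"
  shows "plucker_vector F (E - Z) (r - card B) (contract_fun F Z B P)"
proof -
  note rf = plucker_vectorD(1)[OF P]
  have B: "B \<subseteq> Z" using assms by (simp add: basis_of_def)
  have fin: "finite Z" using assms finite_subset by blast
  obtain I where I: "I \<inter> Z = {}" "P (I \<union> B) \<noteq> None" "card I + card B = r"
    using basis_of_rank[OF rf assms(2-4)] by blast
  have "contract_fun F Z B P I \<noteq> None" using I by (simp add: contract_fun_def)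
  moreover have "exch F (E - Z) (contract_fun F Z B P) (contract_fun F Z B P) (r - card B) (r - card B)"
    by (rule exch_contr[OF plucker_vectorD(3)[OF P] \<open>finite E\<close> rank_funD(1)[OF rf] rank_funD(1)[OF rf]
        \<open>Z \<subseteq> E\<close> B B basis_of_maximal[OF assms(4) fin]]) (use I in auto)
  ultimately show ?thesis
    using rank_fun_contr[OF rf \<open>finite E\<close> B] unfolding plucker_vector_alt by blast
qed

lemma matroid_mat_of: "finite E \<Longrightarrow> plucker_vector F E r P \<Longrightarrow> matroid F (mat_of F E r P)"
  unfolding matroid_iff_mat_of by blast

text \<open>Each circuit of the candidate is the restriction of a circuit, and each restricted
  circuit is a vector of the candidate by \<open>pair_cocircuit_contr\<close>. So
  \<open>circuits_eq_min_supp\<close> identifies the circuits, and these determine the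
  matroid.\<close>

lemma contract_mat_of:
  assumes P: "plucker_vector F E r P" and "finite E" "Z \<subseteq> E" "basis_of P Z B"
  shows "contract F (mat_of F E r P) Z = mat_of F (E - Z) (r - card B) (contract_fun F Z B P)"
proof -
  note rf = plucker_vectorD(1)[OF P]
  note zP = rank_funD(1)[OF rf]
  let ?R = "contract_fun F Z B P" and ?X = "{restr C Z | C. C \<in> circuits F (mat_of F E r P)}"
  have B: "B \<subseteq> Z" using assms by (simp add: basis_of_def)
  have fin: "finite Z" "finite (E - Z)" using assms finite_subset by auto
  then have finB: "finite B" using B finite_subset by blast
  have rank: "r - card B + card B = r" using basis_of_rank[OF rf assms(2-4)] by (metis add_diff_cancel_right')
  note R = plucker_vector_contr[OF assms]
  note max = basis_of_maximal[OF assms(4) fin(1)]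
  have "circuits F (mat_of F (E - Z) (r - card B) ?R) = min_supp ?X"
  proof (rule circuits_eq_min_supp[OF R fin(2)])
    show "circuits F (mat_of F (E - Z) (r - card B) ?R) \<subseteq> ?X"
    proof
      fix C assume "C \<in> circuits F (mat_of F (E - Z) (r - card B) ?R)"
      then obtain c \<sigma> where *: "C = zscale F c (circuit_vec F ?R \<sigma>)" "c \<in> carrier F" "\<sigma> \<subseteq> E - Z"
        "card \<sigma> = r - card B + 1" "supp (circuit_vec F ?R \<sigma>) \<noteq> {}"
        unfolding circuits_mat_of[OF zfun_contr[OF zP]] by auto
      let ?n = "inv_count \<sigma> B + card B"
      have s: "\<sigma> \<inter> Z = {}" "\<sigma> \<inter> B = {}" "finite \<sigma>" using * B fin by (auto intro: finite_subset)
      have eq: "circuit_vec F ?R \<sigma> = (\<lambda>i. signed F ?n (restr (circuit_vec F P (\<sigma> \<union> B)) Z i))"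
        using circuit_vec_contr[OF zP B s(1,3) finB] by (intro ext) auto
      have C: "C = restr (zscale F (c \<otimes> neg_one F [^] ?n) (circuit_vec F P (\<sigma> \<union> B))) Z"
        unfolding *(1) eq using zP *(2)
        by (auto simp: zscale_def restr_def sg_zmult zmult_assoc[symmetric] intro!: ext)
      have "supp (circuit_vec F P (\<sigma> \<union> B)) \<noteq> {}"
        using *(5) by (auto simp: eq supp_def restr_def split: if_splits)
      moreover have "\<sigma> \<union> B \<subseteq> E" "card (\<sigma> \<union> B) = r + 1"
        using * s B assms(3) fin finB rank by (auto simp: card_Un_disjoint)
      ultimately have "zscale F (c \<otimes> neg_one F [^] ?n) (circuit_vec F P (\<sigma> \<union> B)) \<in> circuits F (mat_of F E r P)"
        unfolding circuits_mat_of[OF zP] using *(2) by blast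
      then show "C \<in> ?X" using C by blast
    qed
    fix X assume "X \<in> ?X"
    then obtain C where C: "X = restr C Z" "C \<in> circuits F (mat_of F E r P)" by auto
    note vec = circuits_is_vector[OF P \<open>finite E\<close> C(2)]
    have "pairs_null F (E - Z) (cocircuit_vec F ?R I) X" if I: "I \<subseteq> E - Z" "card I + 1 = r - card B" for I
    proof -
      have s: "I \<inter> Z = {}" "I \<inter> B = {}" "finite I" using I B fin by (auto intro: finite_subset)
      then have "pairs_null F E (cocircuit_vec F P (I \<union> B)) C"
        using I B assms(3) fin finB rank by (intro is_vectorD(3)[OF vec]) (auto simp: card_Un_disjoint)
      then show ?thesis unfolding C(1)
        using pair_cocircuit_contr[OF zP is_vectorD(1)[OF vec] B s(1,3) finB assms(3) max] by simp
    qed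
    moreover have "zfun F X" "supp X \<subseteq> E - Z"
      using is_vectorD(1,2)[OF vec] by (auto simp: C(1)) (auto simp: supp_def restr_def split: if_splits)
    ultimately show "is_vector F (E - Z) (r - card B) ?R X" by (simp add: is_vector_def)
  qed
  moreover have "matroid F (mat_of F (E - Z) (r - card B) ?R)" using matroid_mat_of fin R by blast
  ultimately show ?thesis unfolding contract_def
    by (intro the_equality) (auto intro: circuits_determine_matroid)
qed

end

section \<open>Coloops and quotients\<close>

context tract
begin

lemma circuit_vec_coloop:
  assumes "rank_fun F E r P" "A \<inter> E = {}" "finite A" "finite \<tau>"
  shows "circuit_vec F (coloop_fun F A P) \<tau> i =
    (if A \<subseteq> \<tau> then signed F (inv_count (\<tau> - A) A + card A) (circuit_vec F P (\<tau> - A) i) else None)"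
proof (cases "A \<subseteq> \<tau> \<and> i \<in> \<tau> - A")
  case True
  have *: "A \<subseteq> \<tau> - {i}" "\<tau> - {i} - A = \<tau> - A - {i}" "i \<notin> A" using True by auto
  have "card {b \<in> A. b < i} + card {b \<in> A. i < b} = card A"
    using card_less_greater *(3) assms(3) by blast
  moreover have "inv_count (\<tau> - A) A = inv_count (\<tau> - A - {i}) A + card {b \<in> A. i < b}"
    using inv_count_remove_left[of "\<tau> - A" A i] assms True by blast
  moreover have "card {j \<in> \<tau>. j < i} = card {j \<in> \<tau> - A. j < i} + card {j \<in> A. j < i}"
    using card_filter_Un[of "\<tau> - A" A "\<lambda>j. j < i"] assms True
    by (simp add: Un_absorb2 Int_commute[of "\<tau> - A"])
  ultimately show ?thesis using True * rank_funD(1)[OF assms(1)]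
    by (simp add: circuit_vec_sg coloop_fun_def) (intro sg_cong, presburger, rule refl)
next
  case False
  then show ?thesis by (auto simp: circuit_vec_sg coloop_fun_def)
qed

lemma cocircuit_vec_coloop:
  assumes "rank_fun F E r P" "A \<inter> E = {}" "finite A" "finite I" "A \<subseteq> I"
  shows "cocircuit_vec F (coloop_fun F A P) I j = signed F (inv_count (I - A) A) (cocircuit_vec F P (I - A) j)"
proof (cases "j \<in> I")
  case False
  have *: "insert j I - A = insert j (I - A)" "j \<notin> A" "j \<notin> I - A" using False assms by auto
  have "card {i \<in> I. j < i} = card {i \<in> I - A. j < i} + card {i \<in> A. j < i}"
    using card_filter_Un[of "I - A" A "\<lambda>i. j < i"] assms
    by (simp add: Un_absorb2 Int_commute[of "I - A"])
  moreover have "inv_count (insert j (I - A)) A = inv_count (I - A) A + card {b \<in> A. j < b}"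
    using inv_count_insert_left[of "I - A" A j] * assms by blast
  ultimately show ?thesis using False * assms(5) rank_funD(1)[OF assms(1)]
    by (simp add: cocircuit_vec_def coloop_fun_def subset_insertI2) (intro sg_cong, presburger, rule refl)
next
  case True
  have "P (insert j (I - A)) = None" if "j \<in> A"
    using rank_funD(2)[OF assms(1)] that assms(2) by blast
  then show ?thesis using True by (auto simp: cocircuit_vec_def)
qed

text \<open>Both directions are used: adding coloops produces quotients of initial matroids, and
  removing them recovers the relation on the finite coordinates.\<close>

lemma exch_coloop:
  assumes P: "rank_fun F E r P" and Q: "rank_fun F E s Q" and A: "A \<inter> E = {}" "finite A" and "finite E"
  shows "exch F (E \<union> A) (coloop_fun F A P) (coloop_fun F A Q) (r + card A) (s + card A) \<longleftrightarrow> exch F E P Q r s"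
proof -
  note zP = rank_funD(1)[OF P] and zQ = rank_funD(1)[OF Q]
  have key: "pairs_null F (E \<union> A) (cocircuit_vec F (coloop_fun F A P) (I \<union> A)) (circuit_vec F (coloop_fun F A Q) (J \<union> A)) \<longleftrightarrow>
    pairs_null F E (cocircuit_vec F P I) (circuit_vec F Q J)" if "I \<subseteq> E" "J \<subseteq> E" for I J
  proof -
    have s: "I \<inter> A = {}" "J \<inter> A = {}" "finite (I \<union> A)" "finite (J \<union> A)" "I \<union> A - A = I" "J \<union> A - A = J"
      using that A \<open>finite E\<close> by (auto intro: finite_subset)
    have "pairs_null F (E \<union> A) (cocircuit_vec F (coloop_fun F A P) (I \<union> A)) (circuit_vec F (coloop_fun F A Q) (J \<union> A)) \<longleftrightarrow>
      pairs_null F (E \<union> A) (cocircuit_vec F (coloop_fun F A P) (I \<union> A)) (circuit_vec F Q J)"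
      by (rule pair_sg_right[where n = "inv_count J A + card A"])
         (use zP zQ circuit_vec_coloop[OF Q A s(4)] s in auto)
    also have "\<dots> \<longleftrightarrow> pairs_null F (E \<union> A) (cocircuit_vec F P I) (circuit_vec F Q J)"
      by (rule pair_sg_left[where n = "inv_count I A"])
         (use zP zQ cocircuit_vec_coloop[OF P A s(3)] s in auto)
    also have "\<dots> \<longleftrightarrow> pairs_null F E (cocircuit_vec F P I) (circuit_vec F Q J)"
      by (rule pair_mono_eq) (use that A in \<open>auto simp: circuit_vec_sg\<close>)
    finally show ?thesis .
  qed
  show ?thesis
  proof
    assume *: "exch F (E \<union> A) (coloop_fun F A P) (coloop_fun F A Q) (r + card A) (s + card A)"
    have "pairs_null F E (cocircuit_vec F P I) (circuit_vec F Q J)"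
      if IJ: "I \<subseteq> E" "card I + 1 = r" "J \<subseteq> E" "card J = s + 1" for I J
    proof -
      have s: "I \<inter> A = {}" "J \<inter> A = {}" "finite I" "finite J"
        using IJ A \<open>finite E\<close> by (auto intro: finite_subset)
      have "I \<union> A \<subseteq> E \<union> A" "J \<union> A \<subseteq> E \<union> A" "card (I \<union> A) + 1 = r + card A" "card (J \<union> A) = s + card A + 1"
        using IJ s A by (auto simp: card_Un_disjoint)
      then have "pairs_null F (E \<union> A) (cocircuit_vec F (coloop_fun F A P) (I \<union> A)) (circuit_vec F (coloop_fun F A Q) (J \<union> A))"
        using * zP zQ exch_iff_pair[of "E \<union> A" "coloop_fun F A P" "coloop_fun F A Q"] \<open>finite E\<close> A by simp
      then show ?thesis using key IJ by simp
    qed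
    then show "exch F E P Q r s" using exch_iff_pair[OF \<open>finite E\<close> zP zQ] by blast
  next
    assume *: "exch F E P Q r s"
    have "pairs_null F (E \<union> A) (cocircuit_vec F (coloop_fun F A P) I) (circuit_vec F (coloop_fun F A Q) J)"
      if IJ: "I \<subseteq> E \<union> A" "card I + 1 = r + card A" "J \<subseteq> E \<union> A" "card J = s + card A + 1" for I J
    proof -
      have fin: "finite I" "finite J" using IJ A \<open>finite E\<close> finite_subset[of _ "E \<union> A"] by auto
      consider (both) "A \<subseteq> I" "A \<subseteq> J" | (J) "\<not> A \<subseteq> J" | (I) "\<not> A \<subseteq> I" "A \<subseteq> J" by blast
      then show ?thesis
      proof cases
        case both
        have "card (I - A) + card A = card I" "card (J - A) + card A = card J"
          using both fin A(2) by (metis card_Diff_subset card_mono le_add_diff_inverse2)+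
        then have "card (I - A) + 1 = r" "card (J - A) = s + 1" using IJ by linarith+
        moreover have s: "I - A \<subseteq> E" "J - A \<subseteq> E" "I - A \<union> A = I" "J - A \<union> A = J" using IJ both by auto
        ultimately have "pairs_null F E (cocircuit_vec F P (I - A)) (circuit_vec F Q (J - A))"
          using * exch_iff_pair[OF \<open>finite E\<close> zP zQ, of r s] by blast
        then show ?thesis using key[of "I - A" "J - A"] s by simp
      next
        case J
        then show ?thesis unfolding pairs_null_def
          by (intro nulls_empty) (simp add: circuit_vec_coloop[OF Q A fin(2)])
      next
        case I
        \<comment> \<open>For \<open>i\<close> in \<open>A\<close> the set \<open>J - {i}\<close> no
          longer contains \<open>A\<close>; for \<open>i\<close> outside \<open>A\<close> the set
          \<open>insert i I\<close> still does not. So one factor of every product is zero.\<close>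
        have "cocircuit_vec F (coloop_fun F A P) I i = None \<or> circuit_vec F (coloop_fun F A Q) J i = None" for i
          using I by (cases "i \<in> A")
            (auto simp: circuit_vec_sg coloop_fun_def cocircuit_vec_def)
        then show ?thesis unfolding pairs_null_def by (intro nulls_empty) simp
      qed
    qed
    then show "exch F (E \<union> A) (coloop_fun F A P) (coloop_fun F A Q) (r + card A) (s + card A)"
      using exch_iff_pair[of "E \<union> A" "coloop_fun F A P" "coloop_fun F A Q"] \<open>finite E\<close> A(2) zP zQ by simp
  qed
qed

lemma rank_fun_coloop:
  assumes "rank_fun F E r P" "A \<inter> E = {}" "finite A" "finite E"
  shows "rank_fun F (E \<union> A) (r + card A) (coloop_fun F A P)"
proof -
  have "I \<subseteq> E \<union> A \<and> card I = r + card A" if "coloop_fun F A P I \<noteq> None" for I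
  proof -
    have *: "A \<subseteq> I" "P (I - A) \<noteq> None" using that by (auto simp: coloop_fun_def split: if_splits)
    note rf = rank_fun_finite[OF assms(1,4) *(2)]
    have "I = (I - A) \<union> A" using * by auto
    then have "card I = card (I - A) + card A"
      using card_Un_disjoint[OF rf(3) assms(3)] by (metis Diff_disjoint Int_commute)
    then show ?thesis using rf by auto
  qed
  then show ?thesis using rank_funD(1)[OF assms(1)] by (auto simp: rank_fun_def)
qed

lemma plucker_vector_coloop:
  assumes P: "plucker_vector F E r P" and "A \<inter> E = {}" "finite A" "finite E"
  shows "plucker_vector F (E \<union> A) (r + card A) (coloop_fun F A P)"
proof -
  note rf = plucker_vectorD(1)[OF P]
  obtain B where B: "P B \<noteq> None" using plucker_vectorD(2)[OF P] by blast
  then have "B \<union> A - A = B" using rank_funD(2)[OF rf B] assms by auto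
  then have "coloop_fun F A P (B \<union> A) \<noteq> None" using B by (simp add: coloop_fun_def)
  then show ?thesis
    using rank_fun_coloop[OF rf assms(2-4)] exch_coloop[OF rf rf assms(2-4)] plucker_vectorD(3)[OF P]
    unfolding plucker_vector_alt by blast
qed

lemma zscale_sg:
  assumes "c \<in> carrier F" "zfun F X"
  shows "zscale F c (\<lambda>i. signed F n (X i)) = zscale F (c \<otimes> neg_one F [^] n) X"
  using assms by (auto simp: zscale_def sg_zmult zmult_assoc[symmetric])

lemma circuits_coloop:
  assumes rf: "rank_fun F E r P" and A: "A \<inter> E = {}" "finite A" and "finite E"
  shows "circuits F (mat_of F (E \<union> A) (r + card A) (coloop_fun F A P)) = circuits F (mat_of F E r P)"
proof -
  note zP = rank_funD(1)[OF rf]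
  show ?thesis
  proof (intro equalityI subsetI)
    fix C assume "C \<in> circuits F (mat_of F (E \<union> A) (r + card A) (coloop_fun F A P))"
    then obtain c \<tau> where *: "C = zscale F c (circuit_vec F (coloop_fun F A P) \<tau>)" "c \<in> carrier F"
      "\<tau> \<subseteq> E \<union> A" "card \<tau> = r + card A + 1" "supp (circuit_vec F (coloop_fun F A P) \<tau>) \<noteq> {}"
      unfolding circuits_mat_of[OF zfun_coloop[OF zP]] by auto
    let ?n = "inv_count (\<tau> - A) A + card A"
    have fin: "finite \<tau>" using * A \<open>finite E\<close> finite_subset[of \<tau> "E \<union> A"] by auto
    have sub: "A \<subseteq> \<tau>"
      using *(5) by (auto simp: circuit_vec_coloop[OF rf A fin] supp_def split: if_splits)
    then have eq: "circuit_vec F (coloop_fun F A P) \<tau> = (\<lambda>i. signed F ?n (circuit_vec F P (\<tau> - A) i))"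
      using circuit_vec_coloop[OF rf A fin] by (intro ext) auto
    have "C = zscale F (c \<otimes> neg_one F [^] ?n) (circuit_vec F P (\<tau> - A))"
      unfolding *(1) eq using zscale_sg *(2) zP by blast
    moreover have "supp (circuit_vec F P (\<tau> - A)) \<noteq> {}" using *(5) by (simp add: eq supp_def)
    moreover have "\<tau> - A \<subseteq> E" "card (\<tau> - A) = r + 1"
      using * sub A by (auto simp: card_Diff_subset)
    ultimately show "C \<in> circuits F (mat_of F E r P)"
      unfolding circuits_mat_of[OF zP] using *(2) by blast
  next
    fix C assume "C \<in> circuits F (mat_of F E r P)"
    then obtain c \<tau> where *: "C = zscale F c (circuit_vec F P \<tau>)" "c \<in> carrier F"
      "\<tau> \<subseteq> E" "card \<tau> = r + 1" "supp (circuit_vec F P \<tau>) \<noteq> {}"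
      unfolding circuits_mat_of[OF zP] by auto
    have fin: "finite (\<tau> \<union> A)" "\<tau> \<inter> A = {}" "\<tau> \<union> A - A = \<tau>" "finite \<tau>"
      using * A \<open>finite E\<close> finite_subset[of \<tau> E] by auto
    let ?n = "inv_count \<tau> A + card A"
    have eq: "circuit_vec F (coloop_fun F A P) (\<tau> \<union> A) = (\<lambda>i. signed F ?n (circuit_vec F P \<tau> i))"
      using circuit_vec_coloop[OF rf A fin(1)] fin(3) by (intro ext) auto
    let ?c = "c \<otimes> inv (neg_one F [^] ?n)"
    have "zscale F ?c (circuit_vec F (coloop_fun F A P) (\<tau> \<union> A)) = C"
      unfolding *(1) eq using zP *(2) by (subst zscale_sg) (auto simp: m_assoc)
    moreover have "supp (circuit_vec F (coloop_fun F A P) (\<tau> \<union> A)) \<noteq> {}" using *(5) by (simp add: eq supp_def)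
    moreover have "\<tau> \<union> A \<subseteq> E \<union> A" "card (\<tau> \<union> A) = r + card A + 1"
      using * fin A by (auto simp: card_Un_disjoint)
    moreover have "?c \<in> carrier F" using *(2) by simp
    ultimately show "C \<in> circuits F (mat_of F (E \<union> A) (r + card A) (coloop_fun F A P))"
      unfolding circuits_mat_of[OF zfun_coloop[OF zP]] by blast
  qed
qed

lemma add_coloops_mat_of:
  assumes P: "plucker_vector F E r P" and "A \<inter> E = {}" "finite A" "finite E"
  shows "add_coloops F (mat_of F E r P) A = mat_of F (E \<union> A) (r + card A) (coloop_fun F A P)"
proof -
  have "matroid F (mat_of F (E \<union> A) (r + card A) (coloop_fun F A P))"
    by (rule matroid_mat_of[OF _ plucker_vector_coloop[OF assms]]) (use assms in simp)
  then show ?thesis unfolding add_coloops_def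
    using circuits_coloop[OF plucker_vectorD(1)[OF P] assms(2-4)]
    by (intro the_equality) (auto intro: circuits_determine_matroid)
qed

section \<open>Quotients in terms of chosen representatives\<close>

lemma exch_sum_zscale:
  assumes "c \<in> carrier F" "d \<in> carrier F" "zfun F P" "zfun F Q"
  shows "exch_sum F (zscale F c P) (zscale F d Q) I J \<in> nullset F \<longleftrightarrow> exch_sum F P Q I J \<in> nullset F"
proof -
  have "zmult F (exch_sign F j I J) (zmult F (zscale F c P (insert j I)) (zscale F d Q (J - {j}))) =
    zmult F (Some (c \<otimes> d)) (zmult F (exch_sign F j I J) (zmult F (P (insert j I)) (Q (J - {j}))))" for j
  proof -
    have "exch_sign F j I J \<in> zcarrier F" by (simp add: exch_sign_def)
    moreover have "Some (c \<otimes> d) = zmult F (Some c) (Some d)" by simp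
    ultimately show ?thesis using assms
      by (simp only: zscale_def zmult_assoc zmult_commute zmult_left_commute zfunD zmult_closed Some_in_zcarrier)
  qed
  then show ?thesis unfolding exch_sum_def null_sum_def[symmetric]
    using assms by (simp add: nulls_scale_iff exch_sign_def)
qed

text \<open>Scaling multiplies all terms of an exchange sum by the same unit, so the existential
  choice of representatives in \<open>is_quotient\<close> can be replaced by any fixed pair.\<close>

lemma is_quotient_mat_of:
  assumes "zfun F P" "zfun F Q"
  shows "is_quotient F (mat_of F E s Q) (mat_of F E r P) \<longleftrightarrow> r \<le> s \<and> exch F E P Q r s"
proof -
  have "(\<exists>P' \<in> plvecs (mat_of F E r P). \<exists>Q' \<in> plvecs (mat_of F E s Q). exch F E P' Q' r s) \<longleftrightarrow> exch F E P Q r s"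
  proof
    assume "\<exists>P' \<in> plvecs (mat_of F E r P). \<exists>Q' \<in> plvecs (mat_of F E s Q). exch F E P' Q' r s"
    then show "exch F E P Q r s" using exch_sum_zscale[OF _ _ assms] by (auto simp: exch_def)
  next
    assume "exch F E P Q r s"
    moreover have "P \<in> plvecs (mat_of F E r P)" "Q \<in> plvecs (mat_of F E s Q)"
      using assms zscale_one by (auto intro!: exI[of _ \<one>])
    ultimately show "\<exists>P' \<in> plvecs (mat_of F E r P). \<exists>Q' \<in> plvecs (mat_of F E s Q). exch F E P' Q' r s"
      by blast
  qed
  then show ?thesis by (simp add: is_quotient_def exch_def)
qed

end

section \<open>Tropical extensions and initial forms\<close>

lemma trop_ext_simps [simp]:
  "carrier (trop_ext F) = carrier F \<times> UNIV"
  "(a, x) \<otimes>\<^bsub>trop_ext F\<^esub> (b, y) = (a \<otimes>\<^bsub>F\<^esub> b, x + y)"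
  "\<one>\<^bsub>trop_ext F\<^esub> = (\<one>\<^bsub>F\<^esub>, 0)"
  "invol (trop_ext F) (a, x) = (invol F a, x)"
  by (simp_all add: trop_ext_def)

definition min_part :: "('a \<times> 'g::linorder) multiset \<Rightarrow> ('a \<times> 'g) multiset" where
  "min_part m = {#p \<in># m. \<forall>q \<in># m. snd p \<le> snd q#}"

lemma nullset_trop_ext: "m \<in> nullset (trop_ext F) \<longleftrightarrow> set_mset m \<subseteq> carrier F \<times> UNIV \<and>
    (m = {#} \<or> image_mset fst (min_part m) \<in> nullset F)"
  by (simp add: trop_ext_def min_part_def)

lemma min_part_image:
  fixes f :: "'a \<times> 'g \<Rightarrow> 'b \<times> 'g::linordered_ab_group_add"
  assumes "\<And>p. snd (f p) = g + snd p"
  shows "min_part (image_mset f m) = image_mset f (min_part m)"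
  unfolding min_part_def filter_mset_image_mset by (simp add: assms)

lemma min_part_eq_filter:
  assumes "\<And>p. p \<in># m \<Longrightarrow> k \<le> snd p" "q \<in># m" "snd q = k"
  shows "min_part m = {#p \<in># m. snd p = k#}"
  unfolding min_part_def by (rule filter_mset_cong) (use assms in \<open>auto intro: antisym\<close>)

text \<open>The threshold \<open>m\<close> is given from outside instead of being computed as a
  minimum. This makes initial forms multiplicative for valuations bounded below by the thresholds;
  in return, everything may vanish if the threshold is not attained.\<close>

definition initial_coeff :: "'g \<Rightarrow> ('a \<times> 'g) option \<Rightarrow> 'a option" where
  "initial_coeff m x = (if val x = Some m then theta x else None)"

lemma init_simps [simp]: "initial_coeff m None = None" "initial_coeff m (Some (a, x)) = (if x = m then Some a else None)"
  by (simp_all add: initial_coeff_def val_def theta_def)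

lemma init_neq_None_iff: "initial_coeff m x \<noteq> None \<longleftrightarrow> (\<exists>a. x = Some (a, m))"
  by (cases x) (auto split: if_splits)

definition val_ge :: "'g::linorder \<Rightarrow> ('a \<times> 'g) option \<Rightarrow> bool" where
  "val_ge m x \<longleftrightarrow> (\<forall>p. x = Some p \<longrightarrow> m \<le> snd p)"

lemma val_ge_simps [simp]: "val_ge m None" "val_ge m (Some (a, x)) \<longleftrightarrow> m \<le> x"
  by (simp_all add: val_ge_def)

lemma formal_sum_init:
  fixes f :: "'i \<Rightarrow> ('a \<times> 'g) option"
  assumes "finite S"
  shows "formal_sum (\<lambda>i. initial_coeff m (f i)) S = image_mset fst {#p \<in># formal_sum f S. snd p = m#}"
proof -
  have "initial_coeff m y \<noteq> None \<longleftrightarrow> y \<noteq> None \<and> snd (the y) = m" for y :: "('a \<times> 'g) option"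
    by (cases y) (auto split: if_splits)
  then have *: "{i \<in> S. initial_coeff m (f i) \<noteq> None} = {i \<in> {i \<in> S. f i \<noteq> None}. snd (the (f i)) = m}"
    by auto
  have "image_mset fst {#p \<in># formal_sum f S. snd p = m#} =
      image_mset (\<lambda>i. fst (the (f i))) (mset_set {i \<in> {i \<in> S. f i \<noteq> None}. snd (the (f i)) = m})"
    unfolding formal_sum_def filter_mset_image_mset using assms
    by (simp add: filter_mset_mset_set multiset.map_comp comp_def)
  also have "\<dots> = formal_sum (\<lambda>i. initial_coeff m (f i)) S"
    unfolding formal_sum_def * by (rule image_mset_set_cong) (auto simp: not_None_eq)
  finally show ?thesis ..
qed

lemma zcarrier_trop_cases:
  assumes "x \<in> zcarrier (trop_ext F)"
  obtains "x = None" | a g where "x = Some (a, g)" "a \<in> carrier F"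
  using assms by (auto simp: zcarrier_def)

lemma init_zcarrier [simp, intro]: "x \<in> zcarrier (trop_ext F) \<Longrightarrow> initial_coeff m x \<in> zcarrier F"
  by (erule zcarrier_trop_cases) auto

text \<open>When \<open>m\<close> is the least value of the valuation of \<open>P I\<close> minus
  \<open>sum u I\<close>, this is \<open>initial_plucker\<close>; see
  \<open>initial_plucker_eq\<close>.\<close>

definition initial_fun :: "('e \<Rightarrow> 'g::linordered_ab_group_add) \<Rightarrow> 'g \<Rightarrow> ('e set \<Rightarrow> ('a \<times> 'g) option) \<Rightarrow>
    'e set \<Rightarrow> 'a option" where
  "initial_fun u m P I = initial_coeff (m + sum u I) (P I)"

definition tilt_ge :: "('e \<Rightarrow> 'g::linordered_ab_group_add) \<Rightarrow> 'g \<Rightarrow> ('e set \<Rightarrow> ('a \<times> 'g) option) \<Rightarrow> bool" where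
  "tilt_ge u m P \<longleftrightarrow> (\<forall>I. val_ge (m + sum u I) (P I))"

lemma mem_formal_sum: "finite S \<Longrightarrow> p \<in># formal_sum f S \<longleftrightarrow> (\<exists>i \<in> S. f i = Some p)"
  by (force simp: formal_sum_def not_None_eq)

section \<open>The tropical extension as a tract, and initial forms of null sums\<close>

context tract
begin

lemma tract_trop_ext: "tract (trop_ext F :: ('a \<times> 'g::linordered_ab_group_add) tract)"
proof -
  let ?T = "trop_ext F :: ('a \<times> 'g) tract"
  have "comm_group ?T"
  proof (rule comm_groupI)
    fix x assume "x \<in> carrier ?T"
    then obtain a g where x: "x = (a, g)" "a \<in> carrier F" by auto
    then have "(inv a, - g) \<otimes>\<^bsub>?T\<^esub> x = \<one>\<^bsub>?T\<^esub>" by simp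
    then show "\<exists>y\<in>carrier ?T. y \<otimes>\<^bsub>?T\<^esub> x = \<one>\<^bsub>?T\<^esub>" using x by (intro bexI[of _ "(inv a, - g)"]) auto
  qed (auto simp: m_ac add_ac)
  then interpret T: comm_group ?T .
  have single: "min_part {#p#} = {#p#}" for p :: "'a \<times> 'g" by (simp add: min_part_def)
  have neg: "{#\<one>\<^bsub>?T\<^esub>, e#} \<in> nullset ?T \<longleftrightarrow> e = (neg_one F, 0)" if e_in: "e \<in> carrier ?T" for e
  proof -
    obtain a g where e: "e = (a, g)" "a \<in> carrier F" using e_in by auto
    \<comment> \<open>For nonzero \<open>g\<close> the two valuations differ, so the minimal part is
      a single unit and cannot be null.\<close>
    consider "g = 0" | "g < 0" | "g > 0" by fastforce
    then show ?thesis
      by cases (use e two_null_iff[of \<one> a] single_not_null[of a] null_one in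
        \<open>auto simp: nullset_trop_ext min_part_def\<close>)
  qed
  \<comment> \<open>This serves both scaling and the involution: each shifts all valuations by a
    common amount and hence commutes with \<open>min_part\<close>.\<close>
  have image_null: "image_mset f m \<in> nullset ?T"
    if "m \<in> nullset ?T" "\<And>p. snd (f p) = g + snd p" "\<And>p. fst (f p) = h (fst p)"
      "\<And>k. k \<in> nullset F \<Longrightarrow> image_mset h k \<in> nullset F" "\<And>a. a \<in> carrier F \<Longrightarrow> h a \<in> carrier F" for f g h m
  proof -
    have "image_mset fst (min_part (image_mset f m)) = image_mset h (image_mset fst (min_part m))"
      using min_part_image[of f g m] that(2,3) by (simp add: multiset.map_comp comp_def)
    moreover have "set_mset (image_mset f m) \<subseteq> carrier F \<times> UNIV"
    proof
      fix q assume "q \<in># image_mset f m"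
      then obtain p where p: "p \<in># m" "q = f p" by auto
      then have "fst p \<in> carrier F"
        using \<open>m \<in> nullset ?T\<close> by (auto simp: nullset_trop_ext mem_Times_iff)
      then have "fst q \<in> carrier F" using p that(3,5) by simp
      then show "q \<in> carrier F \<times> UNIV" by (simp add: mem_Times_iff)
    qed
    ultimately show ?thesis using that(1,4) by (auto simp: nullset_trop_ext)
  qed
  show ?thesis
  proof (rule tract.intro[OF T.comm_group_axioms], unfold_locales)
    fix m c assume m: "m \<in> nullset ?T" "c \<in> carrier ?T"
    then obtain a g where c: "c = (a, g)" "a \<in> carrier F" by auto
    have mult: "c \<otimes>\<^bsub>?T\<^esub> p = (a \<otimes> fst p, g + snd p)" for p
      using c by (cases p) simp
    show "image_mset (\<lambda>x. c \<otimes>\<^bsub>?T\<^esub> x) m \<in> nullset ?T"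
      by (rule image_null[of m _ g "\<lambda>x. a \<otimes> x"]) (use m c null_scale in \<open>auto simp: mult\<close>)
  next
    have inv: "invol ?T p = (invol F (fst p), snd p)" for p :: "'a \<times> 'g" by (cases p) simp
    have "invol F \<in> hom F F" "\<And>m. m \<in> nullset F \<Longrightarrow> image_mset (invol F) m \<in> nullset F"
      using invol_hom by (auto simp: tract_hom_def)
    then show "invol ?T \<in> tract_hom ?T ?T"
      by (auto simp: tract_hom_def inv hom_def intro!: image_null[of _ _ 0 "invol F"])
  next
    show "\<exists>!e. e \<in> carrier ?T \<and> {#\<one>\<^bsub>?T\<^esub>, e#} \<in> nullset ?T"
      using neg by (intro ex1I[of _ "(neg_one F, 0)"]) auto
  qed (use null_one invol_invol single in \<open>auto simp: nullset_trop_ext\<close>)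
qed

lemma neg_one_trop_ext: "neg_one (trop_ext F :: ('a \<times> 'g::linordered_ab_group_add) tract) = (neg_one F, 0)"
proof -
  interpret T: tract "trop_ext F :: ('a \<times> 'g) tract" by (rule tract_trop_ext)
  have "{#\<one>\<^bsub>trop_ext F\<^esub>, (neg_one F, 0 :: 'g)#} \<in> nullset (trop_ext F)"
    using neg_one_null by (auto simp: nullset_trop_ext min_part_def)
  then show ?thesis using T.neg_one_unique by fastforce
qed

lemma zsign_trop_ext: "zsign (trop_ext F :: ('a \<times> 'g::linordered_ab_group_add) tract) n = Some (neg_one F [^] n, 0)"
proof -
  interpret T: tract "trop_ext F :: ('a \<times> 'g) tract" by (rule tract_trop_ext)
  have "(neg_one F, 0 :: 'g) [^]\<^bsub>trop_ext F\<^esub> n = (neg_one F [^] n, 0)"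
    by (induction n) auto
  then show ?thesis by (simp add: zsign_def neg_one_trop_ext)
qed

text \<open>Given the lower bounds, a sum of two valuations equals \<open>p + q\<close> only if both
  bounds are attained.\<close>

lemma init_zmult:
  fixes x y :: "('a \<times> 'g::linordered_ab_group_add) option"
  assumes "val_ge p x" "val_ge q y"
  shows "initial_coeff (p + q) (zmult (trop_ext F) x y) = zmult F (initial_coeff p x) (initial_coeff q y)"
    and "val_ge (p + q) (zmult (trop_ext F) x y)"
proof -
  have *: "a + b = p + q \<longleftrightarrow> a = p \<and> b = q" if "p \<le> a" "q \<le> b" for a b
    using that by (metis add_less_le_mono add_le_less_mono less_irrefl order_le_less)
  show "initial_coeff (p + q) (zmult (trop_ext F) x y) = zmult F (initial_coeff p x) (initial_coeff q y)"
    using assms * by (cases x; cases y) auto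
  show "val_ge (p + q) (zmult (trop_ext F) x y)"
    using assms by (cases x; cases y) (auto intro: add_mono)
qed

lemma init_zsign:
  fixes x :: "('a \<times> 'g::linordered_ab_group_add) option"
  assumes "val_ge p x"
  shows "initial_coeff p (zmult (trop_ext F) (zsign (trop_ext F) n) x) = zmult F (zsign F n) (initial_coeff p x)"
    and "val_ge p (zmult (trop_ext F) (zsign (trop_ext F) n) x)"
  using init_zmult[of 0 "zsign (trop_ext F) n" p x] assms
  by (simp_all add: zsign_trop_ext zsign_def[of F])

text \<open>If some term attains the lower bound \<open>m\<close>, the part at \<open>m\<close> is
  the minimal part of the sum; if none does, the initial sum is empty.\<close>

lemma nulls_init:
  fixes f :: "'i \<Rightarrow> ('a \<times> 'g::linordered_ab_group_add) option"
  assumes "null_sum (trop_ext F) f S" "finite S" "\<And>i. i \<in> S \<Longrightarrow> val_ge m (f i)"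
  shows "null_sum F (\<lambda>i. initial_coeff m (f i)) S"
proof (cases "\<exists>i \<in> S. initial_coeff m (f i) \<noteq> None")
  case True
  then obtain i a where i: "i \<in> S" "f i = Some (a, m)"
    by (force simp: initial_coeff_def val_def split: if_splits)
  have "min_part (formal_sum f S) = {#p \<in># formal_sum f S. snd p = m#}"
    by (rule min_part_eq_filter[of _ _ "(a, m)"])
      (use assms(2,3) i in \<open>auto simp: mem_formal_sum val_ge_def\<close>)
  moreover have "(a, m) \<in># formal_sum f S" using i assms(2) by (auto simp: mem_formal_sum)
  ultimately show ?thesis using assms(1,2)
    by (auto simp: null_sum_def formal_sum_init nullset_trop_ext)
qed (auto intro: nulls_empty)

text \<open>The surviving term \<open>i\<close> is essential: it shows that \<open>m\<close> is the
  minimal valuation. An empty initial sum is null whatever the original sum is.\<close>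

lemma nulls_of_init:
  fixes f :: "'i \<Rightarrow> ('a \<times> 'g::linordered_ab_group_add) option"
  assumes "null_sum F (\<lambda>i. initial_coeff m (f i)) S" "finite S" "\<And>i. i \<in> S \<Longrightarrow> val_ge m (f i)"
    and "\<And>i. i \<in> S \<Longrightarrow> f i \<in> zcarrier (trop_ext F)" "i \<in> S" "initial_coeff m (f i) \<noteq> None"
  shows "null_sum (trop_ext F) f S"
proof -
  obtain a where i: "f i = Some (a, m)"
    using assms(6) by (force simp: initial_coeff_def val_def split: if_splits)
  have "min_part (formal_sum f S) = {#p \<in># formal_sum f S. snd p = m#}"
    by (rule min_part_eq_filter[of _ _ "(a, m)"])
      (use assms(2,3,5) i in \<open>auto simp: mem_formal_sum val_ge_def\<close>)
  moreover have "set_mset (formal_sum f S) \<subseteq> carrier F \<times> UNIV"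
    using assms(2,4) by (fastforce simp: mem_formal_sum)
  ultimately show ?thesis using assms(1,2)
    by (auto simp: null_sum_def formal_sum_init nullset_trop_ext)
qed

text \<open>Moving \<open>j\<close> from \<open>J\<close> to \<open>I\<close> does not change
  \<open>sum u I + sum u J\<close>, so all terms of an exchange sum share one threshold and taking
  initial forms commutes with the sum.\<close>

lemma exch_term_init:
  fixes P Q :: "'e::linorder set \<Rightarrow> ('a \<times> 'g::linordered_ab_group_add) option"
  assumes "tilt_ge u p P" "tilt_ge u q Q" "j \<in> J - I" "finite I" "finite J"
  defines "t \<equiv> zmult (trop_ext F) (exch_sign (trop_ext F) j I J)
      (zmult (trop_ext F) (P (insert j I)) (Q (J - {j})))"
  shows "zmult F (exch_sign F j I J) (zmult F (initial_fun u p P (insert j I)) (initial_fun u q Q (J - {j}))) =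
      initial_coeff (p + q + sum u I + sum u J) t"
    and "val_ge (p + q + sum u I + sum u J) t"
proof -
  have eq: "(p + sum u (insert j I)) + (q + sum u (J - {j})) = p + q + sum u I + sum u J"
    using assms(3-5) by (simp add: sum_diff1 algebra_simps)
  have ge: "val_ge (p + sum u (insert j I)) (P (insert j I))" "val_ge (q + sum u (J - {j})) (Q (J - {j}))"
    using assms(1,2) by (simp_all add: tilt_ge_def)
  note z = init_zmult[OF ge, unfolded eq]
  show "zmult F (exch_sign F j I J) (zmult F (initial_fun u p P (insert j I)) (initial_fun u q Q (J - {j}))) =
      initial_coeff (p + q + sum u I + sum u J) t" "val_ge (p + q + sum u I + sum u J) t"
    using init_zsign[OF z(2)] z(1) unfolding t_def exch_sign_def initial_fun_def by simp_all
qed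

lemma exch_initial_fun:
  fixes P Q :: "'e::linorder set \<Rightarrow> ('a \<times> 'g::linordered_ab_group_add) option"
  assumes "exch (trop_ext F) E P Q r s" "finite E" "tilt_ge u p P" "tilt_ge u q Q"
  shows "exch F E (initial_fun u p P) (initial_fun u q Q) r s"
  unfolding exch_def
proof (intro allI impI, elim conjE)
  fix I J assume IJ: "I \<subseteq> E" "card I + 1 = r" "J \<subseteq> E" "card J = s + 1"
  then have fin: "finite I" "finite J" using assms(2) finite_subset by auto
  let ?f = "\<lambda>j. zmult (trop_ext F) (exch_sign (trop_ext F) j I J)
      (zmult (trop_ext F) (P (insert j I)) (Q (J - {j})))"
  let ?m = "p + q + sum u I + sum u J"
  note terms = exch_term_init[OF assms(3,4) _ fin]
  have "null_sum (trop_ext F) ?f (J - I)"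
    using assms(1) IJ unfolding exch_def exch_sum_def null_sum_def by blast
  then have "null_sum F (\<lambda>j. initial_coeff ?m (?f j)) (J - I)"
    using fin terms(2) by (intro nulls_init) auto
  also have "null_sum F (\<lambda>j. initial_coeff ?m (?f j)) (J - I) \<longleftrightarrow>
    exch_sum F (initial_fun u p P) (initial_fun u q Q) I J \<in> nullset F"
    unfolding exch_sum_def null_sum_def[symmetric]
    by (rule nulls_cong) (use terms(1) in auto)
  finally show "exch_sum F (initial_fun u p P) (initial_fun u q Q) I J \<in> nullset F" .
qed

section \<open>Initial forms of Pluecker vectors and initial matroids\<close>

lemma rank_fun_initial_fun:
  "rank_fun (trop_ext F) E r P \<Longrightarrow> rank_fun F E r (initial_fun u m P)"
proof -
  assume rf: "rank_fun (trop_ext F) E r P"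
  have "P I \<noteq> None" if "initial_fun u m P I \<noteq> None" for I
    using that by (auto simp: initial_fun_def init_neq_None_iff)
  then show "rank_fun F E r (initial_fun u m P)"
    using rf by (auto simp: rank_fun_def zfun_def) (auto simp: initial_fun_def)
qed

lemma plucker_vector_initial_fun:
  assumes "plucker_vector (trop_ext F) E r P" "finite E" "tilt_ge u m P" "initial_fun u m P I \<noteq> None"
  shows "plucker_vector F E r (initial_fun u m P)"
  using assms(4) rank_fun_initial_fun[OF plucker_vectorD(1)[OF assms(1)]]
    exch_initial_fun[OF plucker_vectorD(3)[OF assms(1)] assms(2,3,3)]
  unfolding plucker_vector_alt by blast

lemma exists_tilt:
  fixes P :: "'e set \<Rightarrow> ('a \<times> 'g::linordered_ab_group_add) option"
  assumes "rank_fun (trop_ext F) E r P" "P K \<noteq> None" "finite E"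
  obtains m I where "tilt_ge u m P" "initial_fun u m P I \<noteq> None"
proof -
  let ?S = "{I. P I \<noteq> None}" and ?v = "\<lambda>I. snd (the (P I)) - sum u I"
  have "?S \<subseteq> Pow E" using assms(1) by (auto simp: rank_fun_def)
  then have fin: "finite ?S" using assms(3) by (metis finite_Pow_iff finite_subset)
  define m where "m = Min (?v ` ?S)"
  have ge: "m \<le> ?v I" if "P I \<noteq> None" for I using fin that by (auto simp: m_def)
  have "m \<in> ?v ` ?S" using fin assms(2) unfolding m_def by (intro Min_in) auto
  then obtain I where I: "P I \<noteq> None" "m = ?v I" by auto
  have "tilt_ge u m P"
    unfolding tilt_ge_def val_ge_def using ge by (metis diff_add_cancel add_right_mono option.distinct(1) option.sel)
  moreover have "initial_fun u m P I \<noteq> None"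
    using I by (auto simp: initial_fun_def not_None_eq)
  ultimately show ?thesis using that by blast
qed

text \<open>Since the bound \<open>m\<close> is attained at \<open>K\<close>, it is the minimum of
  the tilted valuations; the comparison with all \<open>J\<close> becomes an equation for the
  valuation of \<open>P I\<close>.\<close>

lemma initial_plucker_eq:
  fixes P :: "'e set \<Rightarrow> ('a \<times> 'g::linordered_ab_group_add) option"
  assumes rf: "rank_fun (trop_ext F) E r P" and ge: "tilt_ge u m P" and att: "initial_fun u m P K \<noteq> None"
  shows "initial_plucker E r u P = initial_fun u m P"
proof
  fix I
  obtain b where K: "P K = Some (b, m + sum u K)"
    using att by (force simp: initial_fun_def initial_coeff_def val_def split: if_splits)
  have K': "K \<subseteq> E" "card K = r" using rank_funD[OF rf] K by auto
  show "initial_plucker E r u P I = initial_fun u m P I"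
  proof (cases "P I")
    case None
    then show ?thesis by (simp add: initial_plucker_def initial_fun_def theta_def)
  next
    case (Some p)
    obtain a g where p: "p = (a, g)" by force
    have I: "I \<subseteq> E" "card I = r" using rank_funD[OF rf] Some by auto
    have "(\<forall>J. J \<subseteq> E \<and> card J = r \<longrightarrow> inf_le (inf_minus (val (P I)) (sum u I)) (inf_minus (val (P J)) (sum u J)))
      \<longleftrightarrow> g = m + sum u I"
    proof
      assume *: "\<forall>J. J \<subseteq> E \<and> card J = r \<longrightarrow> inf_le (inf_minus (val (P I)) (sum u I)) (inf_minus (val (P J)) (sum u J))"
      then have "inf_le (inf_minus (val (P I)) (sum u I)) (inf_minus (val (P K)) (sum u K))" using K' by blast
      then have "g \<le> m + sum u I" by (simp add: Some p K val_def inf_minus_def diff_le_eq)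
      moreover have "m + sum u I \<le> g" using ge by (auto simp: tilt_ge_def val_ge_def Some p)
      ultimately show "g = m + sum u I" by simp
    next
      assume g: "g = m + sum u I"
      have "inf_le (Some m) (inf_minus (val (P J)) (sum u J))" for J
        using ge by (cases "P J") (auto simp: tilt_ge_def val_ge_def val_def inf_minus_def le_diff_eq)
      then show "\<forall>J. J \<subseteq> E \<and> card J = r \<longrightarrow> inf_le (inf_minus (val (P I)) (sum u I)) (inf_minus (val (P J)) (sum u J))"
        by (simp add: Some p g val_def inf_minus_def)
    qed
    then show ?thesis using I by (simp add: initial_plucker_def initial_fun_def Some p theta_def)
  qed
qed

lemma initial_fun_zscale:
  fixes P :: "'e set \<Rightarrow> ('a \<times> 'g::linordered_ab_group_add) option"
  shows "initial_fun u (m + g) (zscale (trop_ext F) (a, g) P) = zscale F a (initial_fun u m P)"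
proof
  fix I show "initial_fun u (m + g) (zscale (trop_ext F) (a, g) P) I = zscale F a (initial_fun u m P) I"
    by (cases "P I") (auto simp: initial_fun_def zscale_def algebra_simps)
qed

lemma tilt_ge_zscale:
  fixes P :: "'e set \<Rightarrow> ('a \<times> 'g::linordered_ab_group_add) option"
  assumes "tilt_ge u m P"
  shows "tilt_ge u (m + g) (zscale (trop_ext F) (a, g) P)"
  unfolding tilt_ge_def
proof
  fix I
  have "val_ge (m + sum u I) (P I)" using assms by (simp add: tilt_ge_def)
  then show "val_ge (m + g + sum u I) (zscale (trop_ext F) (a, g) P I)"
    by (cases "P I") (auto simp: zscale_def algebra_simps)
qed

lemma initial_finite_mat_of:
  fixes P :: "'e::linorder set \<Rightarrow> ('a \<times> 'g::linordered_ab_group_add) option"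
  assumes rf: "rank_fun (trop_ext F) E r P" and ge: "tilt_ge u m P" and att: "initial_fun u m P K \<noteq> None"
  shows "initial_finite u (mat_of (trop_ext F) E r P) = mat_of F E r (initial_fun u m P)"
proof -
  interpret T: tract "trop_ext F :: ('a \<times> 'g) tract" by (rule tract_trop_ext)
  have eq: "initial_plucker E r u (zscale (trop_ext F) (a, g) P) = zscale F a (initial_fun u m P)"
    if "a \<in> carrier F" for a g
  proof -
    have "rank_fun (trop_ext F) E r (zscale (trop_ext F) (a, g) P)"
      using rf that T.zfun_zscale[of "(a, g)" P] by (auto simp: rank_fun_def zscale_def[of _ _ P])
    moreover have "initial_fun u (m + g) (zscale (trop_ext F) (a, g) P) K \<noteq> None"
      using att by (simp add: initial_fun_zscale) (simp add: zscale_def)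
    ultimately show ?thesis
      using initial_plucker_eq[OF _ tilt_ge_zscale[OF ge]] initial_fun_zscale by simp
  qed
  have "initial_plucker E r u ` {zscale (trop_ext F) c P | c. c \<in> carrier (trop_ext F)} =
    {zscale F a (initial_fun u m P) | a. a \<in> carrier F}"
  proof (intro equalityI subsetI)
    fix Q assume "Q \<in> {zscale F a (initial_fun u m P) | a. a \<in> carrier F}"
    then obtain a where a: "Q = zscale F a (initial_fun u m P)" "a \<in> carrier F" by auto
    then show "Q \<in> initial_plucker E r u ` {zscale (trop_ext F) c P | c. c \<in> carrier (trop_ext F)}"
      using eq[of a 0] by (intro image_eqI[of _ _ "zscale (trop_ext F) (a, 0) P"]) auto
  qed (use eq in auto)
  then show ?thesis by (simp add: initial_finite_def mat_of_def)
qed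

text \<open>Contraction, finite initial form and coloops are resolved at once by one explicit
  Pluecker vector. The basis \<open>B\<close> of \<open>Z\<close> is a choice, and the threshold
  \<open>m\<close> is tied to it.\<close>

lemma initial_matroid_mat_of:
  fixes P :: "'e::linorder set \<Rightarrow> ('a \<times> 'g::linordered_ab_group_add) option"
  assumes P: "plucker_vector (trop_ext F) E r P" and "finite E" and Z: "Z = infinite_coords E u"
  obtains B m where "basis_of P Z B" "tilt_ge (\<lambda>i. the (u i)) m (contract_fun (trop_ext F) Z B P)"
    "plucker_vector F (E - Z) (r - card B) (initial_fun (\<lambda>i. the (u i)) m (contract_fun (trop_ext F) Z B P))"
    "initial_matroid F u (mat_of (trop_ext F) E r P) =
      mat_of F E (r - card B + card Z) (coloop_fun F Z (initial_fun (\<lambda>i. the (u i)) m (contract_fun (trop_ext F) Z B P)))"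
proof -
  interpret T: tract "trop_ext F :: ('a \<times> 'g) tract" by (rule tract_trop_ext)
  have ZE: "Z \<subseteq> E" "finite Z" "finite (E - Z)" "Z \<inter> (E - Z) = {}" "E - Z \<union> Z = E"
    using assms by (auto simp: infinite_coords_def)
  let ?u = "\<lambda>i. the (u i)"
  note rf = plucker_vectorD(1)[OF P]
  obtain K where K: "P K \<noteq> None" using plucker_vectorD(2)[OF P] by blast
  obtain B where B: "basis_of P Z B" using exists_basis_of[OF rf K ZE(2)] by blast
  let ?R = "contract_fun (trop_ext F) Z B P"
  have R: "plucker_vector (trop_ext F) (E - Z) (r - card B) ?R"
    using T.plucker_vector_contr[OF P \<open>finite E\<close> ZE(1) B] .
  obtain K' where K': "?R K' \<noteq> None" using plucker_vectorD(2)[OF R] by blast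
  obtain m I where m: "tilt_ge ?u m ?R" "initial_fun ?u m ?R I \<noteq> None"
    using exists_tilt[OF plucker_vectorD(1)[OF R] K' ZE(3)] by blast
  have pl: "plucker_vector F (E - Z) (r - card B) (initial_fun ?u m ?R)"
    using plucker_vector_initial_fun[OF R ZE(3) m] .
  have "initial_matroid F u (mat_of (trop_ext F) E r P) =
    add_coloops F (mat_of F (E - Z) (r - card B) (initial_fun ?u m ?R)) Z"
    unfolding initial_matroid_def Let_def mat_of_simps Z[symmetric]
      T.contract_mat_of[OF P \<open>finite E\<close> ZE(1) B]
      initial_finite_mat_of[OF plucker_vectorD(1)[OF R] m] ..
  also have "\<dots> = mat_of F E (r - card B + card Z) (coloop_fun F Z (initial_fun ?u m ?R))"
    using add_coloops_mat_of[OF pl ZE(4,2,3)] ZE(5) by simp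
  finally show ?thesis using that B m(1) pl by blast
qed

end

section \<open>Duality and perfect tracts\<close>

lemma sorted_list_of_set_nth_card:
  fixes E :: "'e::linorder set"
  assumes "finite E" "x \<in> E"
  shows "sorted_list_of_set E ! card {y \<in> E. y < x} = x"
proof -
  let ?xs = "sorted_list_of_set E"
  obtain k where k: "k < length ?xs" "?xs ! k = x"
    using assms by (metis in_set_conv_nth set_sorted_list_of_set)
  have less: "?xs ! i < ?xs ! j \<longleftrightarrow> i < j" if "i < length ?xs" "j < length ?xs" for i j
    using that strict_sorted_list_of_set[of E] sorted_wrt_nth_less[of "(<)" ?xs]
    by (metis linorder_neqE_nat order_less_asym order_less_irrefl)
  have "{y \<in> E. y < x} = (!) ?xs ` {..<k}"
  proof (intro equalityI subsetI)
    fix y assume "y \<in> {y \<in> E. y < x}"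
    then have "y \<in> set ?xs" "y < x" using assms(1) by auto
    then obtain i where "i < length ?xs" "?xs ! i = y" "y < x"
      by (metis in_set_conv_nth)
    then show "y \<in> (!) ?xs ` {..<k}" using less[of i k] k by auto
  next
    fix y assume "y \<in> (!) ?xs ` {..<k}"
    then obtain i where i: "y = ?xs ! i" "i < k" by auto
    then have "y \<in> set ?xs" "y < x" using k less[of i k] by auto
    then show "y \<in> {y \<in> E. y < x}" using assms by simp
  qed
  moreover have "inj_on ((!) ?xs) {..<k}"
    using k by (intro inj_onI) (auto simp: nth_eq_iff_index_eq)
  ultimately show ?thesis using k by (simp add: card_image)
qed

lemma sorted_list_of_set_strict_mono_image:
  fixes T :: "'e::linorder \<Rightarrow> 'f::linorder"
  assumes "finite A" "\<And>x y. x \<in> A \<Longrightarrow> y \<in> A \<Longrightarrow> x < y \<Longrightarrow> T x < T y"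
  shows "sorted_list_of_set (T ` A) = map T (sorted_list_of_set A)"
proof -
  have "inj_on T A" using assms(2) by (metis inj_onI linorder_neqE order_less_irrefl)
  moreover have "sorted_wrt (<) (map T (sorted_list_of_set A))"
    unfolding sorted_wrt_map
    by (rule sorted_wrt_mono_rel[OF _ strict_sorted_list_of_set]) (use assms in auto)
  ultimately show ?thesis
    using assms(1) by (subst sorted_list_of_set_unique[symmetric]) (auto simp: card_image)
qed

text \<open>Induction on the number of inversions. Transposing an inverted pair that is adjacent in
  \<open>E\<close> replaces \<open>A\<close> by a set with exactly one inversion fewer and composes
  the listing permutation with one transposition. Without inversions the list is already sorted and
  the permutation is the identity.\<close>

lemma permutes_sign_listing_perm:
  fixes E :: "'e::linorder set"
  assumes "finite E" "A \<subseteq> E"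
  shows "listing_perm E A permutes E \<and>
    sign (listing_perm E A) = (if even (inv_count (E - A) A) then 1 else - 1)"
  using assms(2)
proof (induction "inv_count (E - A) A" arbitrary: A)
  case 0
  have fin: "finite A" "finite (E - A)" using 0 assms(1) finite_subset by auto
  have none: "\<not> x < y" if "x \<in> E - A" "y \<in> A" for x y
    using 0(1) that finite_inv_count[OF fin(2,1)] by (auto simp: inv_count_def)
  then have "x < y" if "x \<in> A" "y \<in> E - A" for x y
    using that by (metis Diff_iff linorder_neqE)
  then have "sorted_list_of_set E = sorted_list_of_set A @ sorted_list_of_set (E - A)"
    using fin assms(1) 0(2)
    by (subst sorted_list_of_set_unique[symmetric])
      (auto simp: sorted_wrt_append card_Diff_subset card_mono)
  then have "listing_perm E A = id"
    using sorted_list_of_set_nth_card[OF assms(1)] by (auto simp: listing_perm_def fun_eq_iff)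
  then show ?case using 0 permutes_id[of E] by (simp add: id_def)
next
  case (Suc n)
  have fin: "finite A" "finite (E - A)" using Suc assms(1) finite_subset by auto
  have "card {(x, y). x \<in> E - A \<and> y \<in> A \<and> x < y} \<noteq> 0"
    using Suc(2) unfolding inv_count_def by linarith
  then have "{(x, y). x \<in> E - A \<and> y \<in> A \<and> x < y} \<noteq> {}" by (metis card.empty)
  then have "\<exists>p. case p of (x, y) \<Rightarrow> x \<in> E - A \<and> y \<in> A \<and> x < y" by auto
  \<comment> \<open>Among the inverted pairs, one with fewest elements of \<open>E\<close> in
    between. It is adjacent: an element \<open>z\<close> strictly between \<open>a\<close> and
    \<open>b\<close> would give the closer inverted pair \<open>(a, z)\<close> or
    \<open>(z, b)\<close>, according to whether \<open>z\<close> lies in \<open>A\<close>.\<close>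
  then obtain p where p: "case p of (x, y) \<Rightarrow> x \<in> E - A \<and> y \<in> A \<and> x < y"
    "\<forall>q. (case q of (x, y) \<Rightarrow> x \<in> E - A \<and> y \<in> A \<and> x < y) \<longrightarrow>
      card {z \<in> E. fst p < z \<and> z < snd p} \<le> card {z \<in> E. fst q < z \<and> z < snd q}"
    using ex_has_least_nat[of "\<lambda>p. case p of (x, y) \<Rightarrow> x \<in> E - A \<and> y \<in> A \<and> x < y" _
        "\<lambda>p. card {z \<in> E. fst p < z \<and> z < snd p}"] by meson
  obtain a b where ab: "p = (a, b)" by force
  have a: "a \<in> E" "a \<notin> A" and b: "b \<in> A" "b \<in> E" and "a < b" using p(1) ab Suc(3) by auto
  have gap: "\<not> (a < z \<and> z < b)" if "z \<in> E" for z
  proof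
    assume z: "a < z \<and> z < b"
    have less: "card {w \<in> E. x < w \<and> w < y} < card {w \<in> E. a < w \<and> w < b}"
      if "a \<le> x" "y \<le> b" "z = x \<or> z = y" for x y
      using z that \<open>z \<in> E\<close> assms(1) by (intro psubset_card_mono) (auto simp: psubset_eq)
    have "a \<le> z" "z \<le> b" using z by auto
    then show False
      using p(2)[rule_format, of "(z, b)"] p(2)[rule_format, of "(a, z)"]
        less[of z b] less[of a z] z a b \<open>z \<in> E\<close> ab by (cases "z \<in> A") auto
  qed
  define T where "T = transpose a b"
  have T: "T a = b" "T b = a" "\<And>x. x \<noteq> a \<Longrightarrow> x \<noteq> b \<Longrightarrow> T x = x" "T permutes E"
    using a b by (auto simp: T_def permutes_swap_id)
  have TT: "T \<circ> T = id" by (simp add: T_def)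
  have lt: "x < a \<longleftrightarrow> x < b" "a < x \<longleftrightarrow> b < x" if "x \<in> E" "x \<noteq> a" "x \<noteq> b" for x
    using gap[OF that(1)] that \<open>a < b\<close> by auto
  \<comment> \<open>Because no element of \<open>E\<close> lies between \<open>a\<close> and
    \<open>b\<close>, their transposition changes the order of this pair only.\<close>
  have mono: "T x < T y \<longleftrightarrow> x < y" if "x \<in> E" "y \<in> E" "(x, y) \<noteq> (a, b)" "(x, y) \<noteq> (b, a)" for x y
  proof -
    have "z = a \<and> T z = b \<or> z = b \<and> T z = a \<or> z \<noteq> a \<and> z \<noteq> b \<and> T z = z" for z
      using T(1-3) by metis
    from this[of x] this[of y] show ?thesis
      using lt[OF that(1)] lt[OF that(2)] that(3,4) \<open>a < b\<close> by (elim disjE conjE) simp_all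
  qed
  have monoA: "T x < T y" if "x \<in> A" "y \<in> A" "x < y" for x y
    using mono[of x y] that a Suc(3) by auto
  have monoB: "T x < T y" if "x \<in> E - A" "y \<in> E - A" "x < y" for x y
    using mono[of x y] that b by auto
  have TE: "T ` E = E" using T(4) by (rule permutes_image)
  have TA: "T ` A \<subseteq> E" using TE Suc(3) by blast
  have TD: "E - T ` A = T ` (E - A)"
    using TE permutes_inj[OF T(4)] by (metis image_set_diff)
  let ?S = "{(x, y). x \<in> E - A \<and> y \<in> A \<and> x < y}"
  \<comment> \<open>Hence the inversions of the image of \<open>A\<close> correspond to those of
    \<open>A\<close>, with \<open>(a, b)\<close> left out.\<close>
  have "{(x, y). x \<in> T ` (E - A) \<and> y \<in> T ` A \<and> x < y} = map_prod T T ` (?S - {(a, b)})"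
  proof (intro equalityI subsetI)
    fix q assume "q \<in> {(x, y). x \<in> T ` (E - A) \<and> y \<in> T ` A \<and> x < y}"
    then obtain x y where q: "q = (T x, T y)" "x \<in> E - A" "y \<in> A" "T x < T y" by auto
    then have "(x, y) \<noteq> (a, b)" "(x, y) \<noteq> (b, a)" using T(1,2) \<open>a < b\<close> b by auto
    then have "x < y" using mono[of x y] q Suc(3) by blast
    then show "q \<in> map_prod T T ` (?S - {(a, b)})"
      using q \<open>(x, y) \<noteq> (a, b)\<close> by (intro image_eqI[of _ _ "(x, y)"]) auto
  next
    fix q assume "q \<in> map_prod T T ` (?S - {(a, b)})"
    then obtain x y where q: "q = (T x, T y)" "x \<in> E - A" "y \<in> A" "x < y" "(x, y) \<noteq> (a, b)" by auto
    then have "(x, y) \<noteq> (b, a)" using b by auto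
    then have "T x < T y" using mono[of x y] q Suc(3) by blast
    then show "q \<in> {(x, y). x \<in> T ` (E - A) \<and> y \<in> T ` A \<and> x < y}" using q by auto
  qed
  moreover have "inj (map_prod T T)" using permutes_inj[OF T(4)] by (simp add: prod.inj_map)
  moreover have "(a, b) \<in> ?S" using a b \<open>a < b\<close> by auto
  ultimately have "inv_count (E - T ` A) (T ` A) + 1 = inv_count (E - A) A"
    using card_Diff_plus1[OF finite_inv_count[OF fin(2,1)], of "(a, b)"]
    unfolding inv_count_def TD by (simp add: card_image inj_on_subset)
  then have n: "n = inv_count (E - T ` A) (T ` A)" using Suc(2) by simp
  note IH = Suc(1)[OF n TA]
  have "listing_perm E (T ` A) = T \<circ> listing_perm E A"
  proof
    fix x
    have "length (sorted_list_of_set A @ sorted_list_of_set (E - A)) = card E"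
      using fin assms(1) Suc(3) by (simp add: card_Diff_subset card_mono)
    moreover have "card {y \<in> E. y < x} < card E" if "x \<in> E"
      using that assms(1) by (intro psubset_card_mono) auto
    moreover have "T x = x" if "x \<notin> E" using T(4) that by (simp add: permutes_not_in)
    ultimately show "listing_perm E (T ` A) x = (T \<circ> listing_perm E A) x"
      unfolding listing_perm_def TD using sorted_list_of_set_strict_mono_image[OF fin(1) monoA]
        sorted_list_of_set_strict_mono_image[OF fin(2) monoB]
      by (simp flip: map_append)
  qed
  then have eq: "listing_perm E A = T \<circ> listing_perm E (T ` A)" using TT by (metis comp_assoc id_comp)
  have "sign (listing_perm E A) = - sign (listing_perm E (T ` A))"
    unfolding eq using IH T(4) assms(1) \<open>a < b\<close>
    by (subst sign_compose) (auto simp: T_def sign_swap_id permutes_imp_permutation permutation_swap_id)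
  then show ?case
    using IH T(4) Suc(2) n eq permutes_compose by (auto simp flip: Suc(2))
qed

lemma inv_count_insert_right:
  assumes "finite A" "finite B" "x \<notin> B"
  shows "inv_count A (insert x B) = inv_count A B + card {a \<in> A. a < x}"
proof -
  have "{(a, b). a \<in> A \<and> b \<in> insert x B \<and> a < b} =
    {(a, b). a \<in> A \<and> b \<in> B \<and> a < b} \<union> (\<lambda>a. (a, x)) ` {a \<in> A. a < x}" by auto
  moreover have "{(a, b). a \<in> A \<and> b \<in> B \<and> a < b} \<inter> (\<lambda>a. (a, x)) ` {a \<in> A. a < x} = {}"
    using assms by auto
  ultimately show ?thesis unfolding inv_count_def
    using assms finite_inv_count[of A B] by (simp add: card_Un_disjoint card_image inj_on_def)
qed

definition conj_vec :: "('a, 'm) tract_scheme \<Rightarrow> ('i \<Rightarrow> 'a option) \<Rightarrow> 'i \<Rightarrow> 'a option" where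
  "conj_vec F X i = map_option (invol F) (X i)"

lemma formal_sum_reindex:
  assumes "inj_on f S"
  shows "formal_sum h (f ` S) = formal_sum (\<lambda>i. h (f i)) S"
proof -
  have *: "{i \<in> f ` S. h i \<noteq> None} = f ` {i \<in> S. h (f i) \<noteq> None}" by auto
  have "inj_on f {i \<in> S. h (f i) \<noteq> None}" using assms by (rule inj_on_subset) auto
  then show ?thesis
    unfolding formal_sum_def * by (simp flip: image_mset_mset_set add: multiset.map_comp comp_def)
qed

section \<open>The involution and dual Pluecker vectors\<close>

context tract
begin

lemma invol_closed [simp, intro]: "a \<in> carrier F \<Longrightarrow> invol F a \<in> carrier F"
  and invol_mult: "a \<in> carrier F \<Longrightarrow> b \<in> carrier F \<Longrightarrow> invol F (a \<otimes> b) = invol F a \<otimes> invol F b"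
  and invol_null: "m \<in> nullset F \<Longrightarrow> image_mset (invol F) m \<in> nullset F"
  using invol_hom by (auto simp: tract_hom_def hom_def)

lemma invol_one: "invol F \<one> = \<one>"
  using invol_hom hom_one[OF _ is_group is_group] by (simp add: tract_hom_def)

lemma invol_neg_one: "invol F (neg_one F) = neg_one F"
  using invol_null[OF neg_one_null] by (intro neg_one_unique) (simp_all add: invol_one)

lemma invol_neg_one_pow: "invol F (neg_one F [^] (n::nat)) = neg_one F [^] n"
  by (induction n) (simp_all add: invol_one invol_mult invol_neg_one)

lemma conj_closed [simp, intro]: "x \<in> zcarrier F \<Longrightarrow> map_option (invol F) x \<in> zcarrier F"
  by (cases x) auto

lemma zfun_conj_vec [simp, intro]: "zfun F X \<Longrightarrow> zfun F (conj_vec F X)"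
  by (simp add: zfun_def conj_vec_def)

lemma conj_zmult: "x \<in> zcarrier F \<Longrightarrow> y \<in> zcarrier F \<Longrightarrow>
    map_option (invol F) (zmult F x y) = zmult F (map_option (invol F) x) (map_option (invol F) y)"
  by (cases x; cases y) (auto simp: invol_mult)

lemma conj_sg: "x \<in> zcarrier F \<Longrightarrow> map_option (invol F) (signed F n x) = signed F n (map_option (invol F) x)"
  by (simp add: signed_def conj_zmult) (simp add: zsign_def invol_neg_one_pow)

lemma conj_conj [simp]: "x \<in> zcarrier F \<Longrightarrow> map_option (invol F) (map_option (invol F) x) = x"
  by (cases x) (auto simp: invol_invol)

lemma pair_conj:
  assumes "pairs_null F E X Y" "zfun F X" "zfun F Y"
  shows "pairs_null F E (conj_vec F X) (conj_vec F Y)"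
proof -
  have "formal_sum (\<lambda>i. map_option (invol F) (zmult F (X i) (Y i))) E =
      image_mset (invol F) (formal_sum (\<lambda>i. zmult F (X i) (Y i)) E)"
    unfolding formal_sum_def
    by (simp add: multiset.map_comp comp_def) (rule image_mset_set_cong, auto simp: not_None_eq)
  then show ?thesis
    using assms invol_null by (simp add: pairs_null_def null_sum_def conj_vec_def conj_zmult)
qed

lemma orthogonal_iff_pair: "orthogonal F E X Y \<longleftrightarrow> pairs_null F E X (conj_vec F Y)"
  by (simp add: orthogonal_def pairs_null_def null_sum_def conj_vec_def)

lemma dual_plucker_sg:
  assumes "finite E" "I \<subseteq> E" "zfun F P"
  shows "dual_plucker F E P I = signed F (inv_count (E - I) I) (map_option (invol F) (P (E - I)))"
proof -
  have "zsign F n = Some (if even n then \<one> else neg_one F)" for n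
    using zsign_parity[of n 0] zsign_parity[of n 1] by (auto simp: zsign_def)
  then show ?thesis
    using permutes_sign_listing_perm[OF assms(1,2)] assms(2) by (simp add: dual_plucker_def signed_def)
qed

lemma zfun_dual_plucker: "zfun F P \<Longrightarrow> zfun F (dual_plucker F E P)"
  unfolding zfun_def dual_plucker_def by simp

text \<open>Both exponents depend on \<open>i\<close> only through how the elements of
  \<open>I\<close> and of \<open>E - I\<close> lie around it. Inside each of the two sets, the
  elements below and above \<open>i\<close> together have a fixed number, so the difference is a
  constant parity.\<close>

lemma circuit_vec_dual:
  assumes "finite E" "I \<subseteq> E" "zfun F P"
  shows "circuit_vec F (dual_plucker F E P) (E - I) i =
    (if i \<in> E then signed F (card E + 1 + inv_count I (E - I)) (conj_vec F (cocircuit_vec F P I) i) else None)"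
proof (cases "i \<in> E - I")
  case True
  let ?t = "E - I"
  have fin: "finite I" "finite ?t" using assms finite_subset by auto
  have eq: "E - (?t - {i}) = insert i I" "insert i (?t - {i}) = ?t" using True assms by auto
  have 1: "card {j \<in> ?t. j < i} + card {j \<in> ?t. i < j} + 1 = card ?t"
    using card_less_greater_mem[OF fin(2) True] .
  have 2: "card {j \<in> I. j < i} + card {j \<in> I. i < j} = card I"
    using card_less_greater[OF fin(1)] True by blast
  have 3: "card ?t + card I = card E"
    using assms fin by (simp add: card_Diff_subset card_mono)
  have 4: "inv_count (insert i I) (?t - {i}) = inv_count I (?t - {i}) + card {b \<in> ?t - {i}. i < b}"
    using inv_count_insert_left fin True by blast
  have 5: "inv_count I ?t = inv_count I (?t - {i}) + card {a \<in> I. a < i}"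
    using inv_count_insert_right[of I "?t - {i}" i] fin eq by simp
  have 6: "{b \<in> ?t - {i}. i < b} = {b \<in> ?t. i < b}" by auto
  have "circuit_vec F (dual_plucker F E P) ?t i =
    signed F (card {j \<in> ?t. j < i} + inv_count (insert i I) (?t - {i})) (map_option (invol F) (P (insert i I)))"
    using True dual_plucker_sg[OF assms(1) _ assms(3), of "?t - {i}"] assms eq
    by (simp add: circuit_vec_sg Diff_subset[THEN subset_trans])
  also have "\<dots> = signed F (card E + 1 + inv_count I ?t + card {j \<in> I. i < j}) (map_option (invol F) (P (insert i I)))"
    by (rule sg_cong) (use 1 2 3 4 5 6 in presburger, rule refl)
  finally show ?thesis
    using True assms(3) by (simp add: conj_vec_def cocircuit_vec_def conj_sg)
next
  case False
  then show ?thesis by (auto simp: circuit_vec_def conj_vec_def cocircuit_vec_def)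
qed

section \<open>Transitivity of the exchange relation over a perfect tract\<close>

lemma cocircuit_vec_zscale: "c \<in> carrier F \<Longrightarrow> zfun F P \<Longrightarrow>
    cocircuit_vec F (zscale F c P) I = zscale F c (cocircuit_vec F P I)"
  by (auto simp: cocircuit_vec_def zscale_def)

text \<open>The only direct use of perfection. The hypotheses make the conjugate of \<open>Y\<close>
  a covector and, since circuits of the dual are conjugated cocircuits up to sign, \<open>X\<close>
  a vector; perfection makes the two orthogonal.\<close>

lemma perfect_pair:
  fixes E :: "nat set"
  assumes "perfect F" "finite E" and P: "plucker_vector F E r P" and X: "zfun F X" and Y: "zfun F Y"
    and cov: "\<And>\<tau>. \<tau> \<subseteq> E \<Longrightarrow> card \<tau> = r + 1 \<Longrightarrow> pairs_null F E (circuit_vec F P \<tau>) Y"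
    and vec: "\<And>I. I \<subseteq> E \<Longrightarrow> card I + 1 = r \<Longrightarrow> pairs_null F E (cocircuit_vec F P I) X"
  shows "pairs_null F E X Y"
proof -
  note rf = plucker_vectorD(1)[OF P]
  note zP = rank_funD(1)[OF rf]
  let ?M = "mat_of F E r P"
  \<comment> \<open>Tuples vanish outside \<open>E\<close>, hence the truncation. The conjugation
    cancels the one contained in \<open>orthogonal\<close>.\<close>
  define Y' where "Y' = (\<lambda>i. if i \<in> E then conj_vec F Y i else None)"
  define X' where "X' = (\<lambda>i. if i \<in> E then X i else None)"
  have z: "zfun F X'" "zfun F Y'" using X Y zfun_conj_vec[OF Y] by (auto simp: zfun_def X'_def Y'_def)
  have tup: "X' \<in> tuples F E" "Y' \<in> tuples F E" using z by (auto simp: tuples_def zfun_def X'_def Y'_def)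
  have conjY: "pairs_null F E W (conj_vec F Y') \<longleftrightarrow> pairs_null F E W Y" for W
    using Y by (intro pair_cong) (auto simp: Y'_def conj_vec_def)
  obtain B where B: "P B \<noteq> None" using plucker_vectorD(2)[OF P] by blast
  have rle: "r \<le> card E" using rank_fun_finite[OF rf assms(2) B] assms(2) card_mono by metis
  have "Y' \<in> covectors F ?M"
  proof -
    have "orthogonal F E C Y'" if C: "C \<in> circuits F ?M" for C
    proof -
      obtain c \<tau> where "C = zscale F c (circuit_vec F P \<tau>)" "c \<in> carrier F" "\<tau> \<subseteq> E" "card \<tau> = r + 1"
        using C unfolding circuits_mat_of[OF zP] by auto
      then show ?thesis unfolding orthogonal_iff_pair conjY using cov zP Y by simp
    qed
    then show ?thesis using tup by (simp add: covectors_def perp_def)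
  qed
  moreover have "X' \<in> vectors F ?M"
  proof -
    have "orthogonal F E D X'" if D_in: "D \<in> circuits F (dual F ?M)" for D
    proof -
      obtain c d \<tau> where D: "D = zscale F c (circuit_vec F (dual_plucker F E (zscale F d P)) \<tau>)"
        "c \<in> carrier F" "d \<in> carrier F" "\<tau> \<subseteq> E" "card \<tau> = card E - r + 1"
        using D_in unfolding circuits_def by (auto simp: dual_def)
      let ?I = "E - \<tau>" and ?P = "zscale F d P"
      have zP': "zfun F ?P" using zP D(3) by blast
      \<comment> \<open>For \<open>r = 0\<close> there is no such \<open>\<tau>\<close>, as it would
        have \<open>card E + 1\<close> elements. This and \<open>rle\<close> make the truncated
        subtractions exact.\<close>
      have "card \<tau> \<le> card E" "card ?I = card E - card \<tau>"
        using D(4) assms(2) by (auto simp: card_mono card_Diff_subset finite_subset)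
      then have I: "?I \<subseteq> E" "card ?I + 1 = r" "E - ?I = \<tau>" using D(4,5) rle by auto
      have eq: "circuit_vec F (dual_plucker F E ?P) \<tau> i =
        signed F (card E + 1 + inv_count ?I \<tau>) (conj_vec F (cocircuit_vec F ?P ?I) i)" if "i \<in> E" for i
        using circuit_vec_dual[OF assms(2) I(1) zP', of i] I(3) that by simp
      have zd: "zfun F (dual_plucker F E ?P)"
        using zP' by (rule zfun_dual_plucker)
      have "pairs_null F E (cocircuit_vec F P ?I) X'"
        using vec[OF I(1,2)] pair_cong[of E _ _ X X' F] by (simp add: X'_def)
      then have "pairs_null F E (cocircuit_vec F ?P ?I) X'"
        using zP D(3) z by (simp add: cocircuit_vec_zscale)
      then have "pairs_null F E (conj_vec F (cocircuit_vec F ?P ?I)) (conj_vec F X')"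
        using pair_conj zP' z by blast
      then have "pairs_null F E (circuit_vec F (dual_plucker F E ?P) \<tau>) (conj_vec F X')"
        using pair_sg_left[of "conj_vec F (cocircuit_vec F ?P ?I)" "conj_vec F X'" E, OF _ _ eq] zP' z
        by simp
      then show ?thesis
        unfolding orthogonal_iff_pair D(1) using D(2) zd z by simp
    qed
    then show ?thesis using tup by (simp add: vectors_def perp_def dual_def)
  qed
  moreover have "perp F E (vectors F ?M) = covectors F ?M"
    using assms(1) matroid_mat_of[OF assms(2) P] by (auto simp: perfect_def)
  ultimately have "pairs_null F E X' (conj_vec F Y')"
    unfolding orthogonal_iff_pair[symmetric] perp_def by blast
  then show ?thesis unfolding conjY using pair_cong[of E X' X Y Y F] by (simp add: X'_def)
qed

text \<open>The first relation says that cocircuits of \<open>R\<close> are orthogonal to the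
  circuits of \<open>P\<close>, the second that circuits of \<open>Q\<close> are vectors of
  \<open>P\<close>.\<close>

lemma exch_trans_nat:
  fixes E :: "nat set"
  assumes "perfect F" "finite E" and P: "plucker_vector F E r P" and "zfun F R" "zfun F Q"
    and "exch F E R P t r" "exch F E P Q r s"
  shows "exch F E R Q t s"
proof -
  have zP: "zfun F P" using rank_funD(1)[OF plucker_vectorD(1)[OF P]] .
  have "pairs_null F E (cocircuit_vec F R I) (circuit_vec F Q J)"
    if "I \<subseteq> E" "card I + 1 = t" "J \<subseteq> E" "card J = s + 1" for I J
  proof -
    have "pairs_null F E (circuit_vec F Q J) (cocircuit_vec F R I)"
    proof (rule perfect_pair[OF assms(1,2) P])
      fix \<tau> assume "\<tau> \<subseteq> E" "card \<tau> = r + 1"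
      then have "pairs_null F E (cocircuit_vec F R I) (circuit_vec F P \<tau>)"
        using assms(6) exch_iff_pair[OF assms(2,4) zP, of t r] that by blast
      then show "pairs_null F E (circuit_vec F P \<tau>) (cocircuit_vec F R I)"
        using pair_commute zP assms(4) by blast
    next
      fix I' assume "I' \<subseteq> E" "card I' + 1 = r"
      then show "pairs_null F E (cocircuit_vec F P I') (circuit_vec F Q J)"
        using assms(7) exch_iff_pair[OF assms(2) zP assms(5), of r s] that by blast
    qed (use assms in auto)
    then show ?thesis using pair_commute assms(4,5) by blast
  qed
  then show ?thesis using exch_iff_pair[OF assms(2,4,5)] by blast
qed

text \<open>Perfection is only assumed for ground sets in \<^typ>\<open>nat\<close>, so we relabel.\<close>

lemma exch_trans:
  fixes E :: "'e::linorder set"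
  assumes "perfect F" "finite E" and P: "plucker_vector F E r P" and "zfun F R" "zfun F Q"
    and "exch F E R P t r" "exch F E P Q r s"
  shows "exch F E R Q t s"
proof -
  \<comment> \<open>The position in \<open>E\<close>. Being increasing, it preserves the counts that
    form \<open>exch_sign\<close>.\<close>
  define f where "f x = card {y \<in> E. y < x}" for x
  define g where "g = inv_into E f"
  define relabel :: "('e set \<Rightarrow> 'a option) \<Rightarrow> nat set \<Rightarrow> 'a option"
    where "relabel P I = (if I \<subseteq> f ` E then P (g ` I) else None)" for P I
  have mono: "f x < f y \<longleftrightarrow> x < y" if "x \<in> E" "y \<in> E" for x y
  proof -
    have *: "f x < f y" if "x < y" "x \<in> E" for x y
      unfolding f_def using that assms(2) by (intro psubset_card_mono) auto
    show ?thesis using that *[of x y] *[of y x] by (metis linorder_neqE order_less_asym order_less_irrefl)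
  qed
  have inj: "inj_on f E" using mono by (metis inj_onI linorder_neqE order_less_irrefl)
  have gf: "g ` f ` I = I" if "I \<subseteq> E" for I
    unfolding g_def using inj that by (rule inv_into_image_cancel)
  have rel: "relabel P (f ` I) = P I" if "I \<subseteq> E" for P I
    using gf that by (auto simp: relabel_def)
  have cardf: "card (f ` I) = card I" if "I \<subseteq> E" for I
    using inj that by (meson card_image inj_on_subset)
  have cnt: "card {j' \<in> f ` J. f j < j'} = card {j' \<in> J. j < j'}" if "J \<subseteq> E" "j \<in> E" for J j
  proof -
    have "{j' \<in> f ` J. f j < j'} = f ` {j' \<in> J. j < j'}" using mono that by auto
    then show ?thesis using cardf[of "{j' \<in> J. j < j'}"] that by auto
  qed
  have sum_eq: "exch_sum F (relabel P) (relabel Q) (f ` I) (f ` J) = exch_sum F P Q I J"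
    if "I \<subseteq> E" "J \<subseteq> E" for P Q I J
  proof -
    have *: "f ` J - f ` I = f ` (J - I)" using inj that by (metis inj_on_image_set_diff Diff_subset subset_trans)
    have "zmult F (exch_sign F (f j) (f ` I) (f ` J)) (zmult F (relabel P (insert (f j) (f ` I))) (relabel Q (f ` J - {f j}))) =
       zmult F (exch_sign F j I J) (zmult F (P (insert j I)) (Q (J - {j})))" if j: "j \<in> J - I" for j
    proof -
      have "insert (f j) (f ` I) = f ` insert j I" by simp
      moreover have "f ` J - {f j} = f ` (J - {j})"
        using inj_on_image_set_diff[OF inj, of J "{j}"] j \<open>J \<subseteq> E\<close> by auto
      moreover have "j \<in> E" "J - {j} \<subseteq> E" using j \<open>J \<subseteq> E\<close> by auto
      ultimately show ?thesis
        using rel[of "insert j I" P] rel[of "J - {j}" Q] cnt[of J j] cnt[of I j] \<open>I \<subseteq> E\<close> \<open>J \<subseteq> E\<close>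
        by (simp add: exch_sign_def)
    qed
    moreover have "inj_on f (J - I)" using inj that(2) by (meson inj_on_subset Diff_subset subset_trans)
    ultimately show ?thesis
      unfolding exch_sum_def * by (subst formal_sum_reindex) (auto intro!: formal_sum_cong)
  qed
  have exch_eq: "exch F (f ` E) (relabel P) (relabel Q) r s \<longleftrightarrow> exch F E P Q r s" for P Q r s
  proof
    assume *: "exch F (f ` E) (relabel P) (relabel Q) r s"
    show "exch F E P Q r s"
      unfolding exch_def
    proof (intro allI impI, elim conjE)
      fix I J assume IJ: "I \<subseteq> E" "card I + 1 = r" "J \<subseteq> E" "card J = s + 1"
      then have "f ` I \<subseteq> f ` E" "card (f ` I) + 1 = r" "f ` J \<subseteq> f ` E" "card (f ` J) = s + 1"
        using cardf by auto
      then have "exch_sum F (relabel P) (relabel Q) (f ` I) (f ` J) \<in> nullset F"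
        using * unfolding exch_def by blast
      then show "exch_sum F P Q I J \<in> nullset F" using sum_eq IJ by simp
    qed
  next
    assume *: "exch F E P Q r s"
    show "exch F (f ` E) (relabel P) (relabel Q) r s"
      unfolding exch_def
    proof (intro allI impI, elim conjE)
      fix I' J' assume IJ': "I' \<subseteq> f ` E" "card I' + 1 = r" "J' \<subseteq> f ` E" "card J' = s + 1"
      then obtain I J where IJ: "I \<subseteq> E" "I' = f ` I" "J \<subseteq> E" "J' = f ` J" by (meson subset_imageE)
      then have "exch_sum F P Q I J \<in> nullset F" using * IJ' cardf unfolding exch_def by auto
      then show "exch_sum F (relabel P) (relabel Q) I' J' \<in> nullset F" using sum_eq IJ by simp
    qed
  qed
  have zrel: "zfun F (relabel P)" if "zfun F P" for P using that by (simp add: zfun_def relabel_def)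
  note rf = plucker_vectorD(1)[OF P]
  have "plucker_vector F (f ` E) r (relabel P)"
    unfolding plucker_vector_alt
  proof (intro conjI)
    show "rank_fun F (f ` E) r (relabel P)"
      unfolding rank_fun_def
    proof (intro conjI allI impI)
      fix I' assume I': "relabel P I' \<noteq> None"
      then show "I' \<subseteq> f ` E" by (auto simp: relabel_def split: if_splits)
      then obtain I where "I \<subseteq> E" "I' = f ` I" by (meson subset_imageE)
      then show "card I' = r" using I' rel cardf rank_funD(3)[OF rf] by simp
    qed (use zrel rank_funD(1)[OF rf] in auto)
    obtain B where B: "P B \<noteq> None" using plucker_vectorD(2)[OF P] by blast
    then have "relabel P (f ` B) \<noteq> None" using rel rank_funD(2)[OF rf B] by simp
    then show "\<exists>I. relabel P I \<noteq> None" by blast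
    show "exch F (f ` E) (relabel P) (relabel P) r r" using exch_eq plucker_vectorD(3)[OF P] by simp
  qed
  then have "exch F (f ` E) (relabel R) (relabel Q) t s"
    using exch_trans_nat[of "f ` E" r "relabel P" "relabel R" "relabel Q" t s] assms zrel exch_eq by simp
  then show ?thesis using exch_eq by simp
qed

end

section \<open>The exchange relation and initial matroids\<close>

text \<open>A tuple as a function of rank 1, whose cocircuit at the empty set is the tuple itself.
  In this form contraction, initial forms and transitivity apply to it directly.\<close>

definition cov_fun :: "('e \<Rightarrow> 'a option) \<Rightarrow> 'e set \<Rightarrow> 'a option" where
  "cov_fun Y S = (if card S = 1 then Y (the_elem S) else None)"

text \<open>A tuple as a function of rank \<open>card E - 1\<close>; the sign cancels the one in
  \<open>circuit_vec\<close>, so that the circuit at \<open>E\<close> is the tuple itself.\<close>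

definition vec_fun :: "('a, 'm) tract_scheme \<Rightarrow> 'e::linorder set \<Rightarrow> ('e \<Rightarrow> 'a option) \<Rightarrow> 'e set \<Rightarrow> 'a option" where
  "vec_fun F E X S = (if S \<subseteq> E \<and> card (E - S) = 1
    then let i = the_elem (E - S) in signed F (card {j \<in> E. j < i}) (X i) else None)"

lemma cov_fun_singleton [simp]: "cov_fun Y {i} = Y i"
  by (simp add: cov_fun_def)

lemma cov_funE:
  assumes "cov_fun Y S \<noteq> None"
  obtains i where "S = {i}" "Y i \<noteq> None"
proof -
  have "card S = 1" using assms by (auto simp: cov_fun_def split: if_splits)
  then obtain i where "S = {i}" by (rule card_1_singletonE)
  then show ?thesis using assms that by simp
qed

lemma vec_fun_Diff: "i \<in> E \<Longrightarrow> vec_fun F E X (E - {i}) = signed F (card {j \<in> E. j < i}) (X i)"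
proof -
  assume "i \<in> E"
  then have "E - (E - {i}) = {i}" by auto
  then show ?thesis by (simp add: vec_fun_def Let_def)
qed

lemma vec_funE:
  assumes "vec_fun F E X S \<noteq> None"
  obtains i where "i \<in> E" "S = E - {i}" "X i \<noteq> None"
proof -
  have S: "card (E - S) = 1" "S \<subseteq> E" using assms by (auto simp: vec_fun_def split: if_splits)
  then obtain i where i: "E - S = {i}" using card_1_singletonE by blast
  then have "i \<in> E" "S = E - {i}" using S by auto
  then show ?thesis using assms that vec_fun_Diff[of i E F X] by auto
qed

context tract
begin

lemma zfun_cov_fun [simp, intro]: "zfun F Y \<Longrightarrow> zfun F (cov_fun Y)"
  by (simp add: zfun_def cov_fun_def)

lemma zfun_vec_fun [simp, intro]: "zfun F X \<Longrightarrow> zfun F (vec_fun F E X)"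
  by (simp add: zfun_def vec_fun_def Let_def)

lemma cocircuit_vec_cov_fun: "zfun F Y \<Longrightarrow> cocircuit_vec F (cov_fun Y) {} = Y"
  by (auto simp: cocircuit_vec_def sg_even)

lemma circuit_vec_vec_fun:
  "zfun F X \<Longrightarrow> circuit_vec F (vec_fun F E X) E i = (if i \<in> E then X i else None)"
  by (simp add: circuit_vec_sg vec_fun_Diff sg_even)

lemma exch_cov_fun:
  assumes "finite E" "zfun F Y" "zfun F Q"
    and "\<And>J. J \<subseteq> E \<Longrightarrow> card J = s + 1 \<Longrightarrow> pairs_null F E Y (circuit_vec F Q J)"
  shows "exch F E (cov_fun Y) Q 1 s"
proof -
  have "I = {}" if "I \<subseteq> E" "card I + 1 = 1" for I
    using that assms(1) finite_subset[of I E] by auto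
  then show ?thesis
    unfolding exch_iff_pair[OF assms(1) zfun_cov_fun[OF assms(2)] assms(3)]
    using assms(4) cocircuit_vec_cov_fun[OF assms(2)] by metis
qed

lemma exch_vec_fun:
  assumes "finite E" "zfun F X" "zfun F P" "E \<noteq> {}"
    and "\<And>I. I \<subseteq> E \<Longrightarrow> card I + 1 = r \<Longrightarrow> pairs_null F E (cocircuit_vec F P I) X"
  shows "exch F E P (vec_fun F E X) r (card E - 1)"
proof -
  have "card E > 0" using assms by (simp add: card_gt_0_iff)
  then have J: "J = E" if "J \<subseteq> E" "card J = card E - 1 + 1" for J
    using that assms(1) card_subset_eq[of E J] by simp
  have "pairs_null F E W (circuit_vec F (vec_fun F E X) E) \<longleftrightarrow> pairs_null F E W X" for W
    by (rule pair_cong) (simp_all add: circuit_vec_vec_fun assms(2))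
  then show ?thesis
    unfolding exch_iff_pair[OF assms(1,3) zfun_vec_fun[OF assms(2)]]
    using assms(5) J by metis
qed

text \<open>Fix \<open>J0\<close> completing \<open>B'\<close> to a basis of \<open>Q\<close>, and
  among the sets completing \<open>B\<close> to a basis of \<open>P\<close> choose \<open>I0\<close>
  meeting \<open>J0\<close> most. An element of \<open>I0\<close> outside \<open>J0\<close> could be
  exchanged for some \<open>b\<close>; maximality of \<open>B\<close> forces \<open>b\<close> into
  \<open>J0\<close>, which enlarges the intersection. So \<open>I0\<close> is contained in
  \<open>J0\<close>.\<close>

lemma contr_rank_le:
  assumes ex: "exch F E P Q r s" and P: "rank_fun F E r P" and Q: "rank_fun F E s Q"
    and E: "finite E" "Z \<subseteq> E" and B: "basis_of P Z B" and B': "basis_of Q Z B'"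
  shows "r - card B \<le> s - card B'"
proof -
  have finZ: "finite Z" using E finite_subset by blast
  obtain J0 where J0: "J0 \<inter> Z = {}" "Q (J0 \<union> B') \<noteq> None" "card J0 + card B' = s" "J0 \<subseteq> E - Z"
    using basis_of_rank[OF Q E B'] by blast
  have finJ: "finite J0" using J0(4) E(1) finite_subset by blast
  have bnd: "\<forall>I. I \<inter> Z = {} \<and> P (I \<union> B) \<noteq> None \<longrightarrow> card (I \<inter> J0) < card J0 + 1"
    using finJ by (auto intro!: le_imp_less_Suc card_mono)
  obtain I1 where I1: "I1 \<inter> Z = {} \<and> P (I1 \<union> B) \<noteq> None" using B by (auto simp: basis_of_def)
  obtain I0 where I0: "I0 \<inter> Z = {}" "P (I0 \<union> B) \<noteq> None" and
    max: "\<And>I. I \<inter> Z = {} \<Longrightarrow> P (I \<union> B) \<noteq> None \<Longrightarrow> card (I \<inter> J0) \<le> card (I0 \<inter> J0)"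
    using ex_has_greatest_nat[of "\<lambda>I. I \<inter> Z = {} \<and> P (I \<union> B) \<noteq> None" I1 "\<lambda>I. card (I \<inter> J0)", OF I1 bnd]
    by (elim exE conjE) simp
  have BZ: "B \<subseteq> Z" "B' \<subseteq> Z" using B B' by (auto simp: basis_of_def)
  have "I0 \<subseteq> J0"
  proof
    fix i assume i: "i \<in> I0"
    show "i \<in> J0"
    proof (rule ccontr)
      assume "i \<notin> J0"
      then have "i \<in> (I0 \<union> B) - (J0 \<union> B')" using i I0(1) BZ by auto
      then obtain b where b: "b \<in> (J0 \<union> B') - (I0 \<union> B)" "P (insert b (I0 \<union> B - {i})) \<noteq> None"
        using exch_exchange[OF ex P Q E(1) I0(2) J0(2)] by blast
      have eq: "insert b (I0 \<union> B - {i}) = insert b ((I0 - {i}) \<union> B)" using i I0(1) BZ by auto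
      then have "b \<notin> Z - B" using basis_of_maximal[OF B finZ, of b "I0 - {i}"] b(2) by auto
      then have bJ: "b \<in> J0" "b \<notin> I0" "b \<notin> Z" using b(1) BZ J0(1) by auto
      have "card (insert b (I0 - {i}) \<inter> J0) \<le> card (I0 \<inter> J0)"
        using b(2) eq I0(1) bJ by (intro max) auto
      moreover have "insert b (I0 - {i}) \<inter> J0 = insert b (I0 \<inter> J0)" using bJ \<open>i \<notin> J0\<close> by auto
      ultimately show False using bJ finJ by simp
    qed
  qed
  then have "card I0 \<le> card J0" using finJ card_mono by blast
  moreover have "card I0 + card B = r"
  proof -
    note rank_fun_finite[OF P E(1) I0(2)]
    moreover have "I0 \<inter> B = {}" using I0(1) BZ by auto
    ultimately show ?thesis by (auto simp: card_Un_disjoint)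
  qed
  ultimately show ?thesis using J0(3) by simp
qed

section \<open>Quotients over the extension against quotients of initial matroids\<close>

lemma is_quotient_initial_matroid:
  fixes P Q :: "'e::linorder set \<Rightarrow> ('a \<times> 'g::linordered_ab_group_add) option"
  assumes P: "plucker_vector (trop_ext F) E r P" and Q: "plucker_vector (trop_ext F) E s Q"
    and "finite E" and quot: "exch (trop_ext F) E P Q r s"
  shows "is_quotient F (initial_matroid F u (mat_of (trop_ext F) E s Q))
    (initial_matroid F u (mat_of (trop_ext F) E r P))"
proof -
  interpret T: tract "trop_ext F :: ('a \<times> 'g) tract" by (rule tract_trop_ext)
  define Z where "Z = infinite_coords E u"
  let ?u = "\<lambda>i. the (u i)"
  note rP = plucker_vectorD(1)[OF P] and rQ = plucker_vectorD(1)[OF Q]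
  obtain B m where B: "basis_of P Z B" "tilt_ge ?u m (contract_fun (trop_ext F) Z B P)"
    "plucker_vector F (E - Z) (r - card B) (initial_fun ?u m (contract_fun (trop_ext F) Z B P))"
    "initial_matroid F u (mat_of (trop_ext F) E r P) =
      mat_of F E (r - card B + card Z) (coloop_fun F Z (initial_fun ?u m (contract_fun (trop_ext F) Z B P)))"
    using initial_matroid_mat_of[OF P \<open>finite E\<close> Z_def] by blast
  obtain B' k where B': "basis_of Q Z B'" "tilt_ge ?u k (contract_fun (trop_ext F) Z B' Q)"
    "plucker_vector F (E - Z) (s - card B') (initial_fun ?u k (contract_fun (trop_ext F) Z B' Q))"
    "initial_matroid F u (mat_of (trop_ext F) E s Q) =
      mat_of F E (s - card B' + card Z) (coloop_fun F Z (initial_fun ?u k (contract_fun (trop_ext F) Z B' Q)))"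
    using initial_matroid_mat_of[OF Q \<open>finite E\<close> Z_def] by blast
  have Z: "Z \<subseteq> E" "finite Z" "finite (E - Z)" "Z \<inter> (E - Z) = {}" "E - Z \<union> Z = E"
    using \<open>finite E\<close> by (auto simp: Z_def infinite_coords_def)
  have BZ: "B \<subseteq> Z" "B' \<subseteq> Z" using B B' by (auto simp: basis_of_def)
  have ranks: "r - card B + card B = r" "s - card B' + card B' = s"
    using T.basis_of_rank[OF rP \<open>finite E\<close> Z(1) B(1)] T.basis_of_rank[OF rQ \<open>finite E\<close> Z(1) B'(1)]
    by (metis le_add2 le_add_diff_inverse2)+
  have "exch (trop_ext F) (E - Z) (contract_fun (trop_ext F) Z B P) (contract_fun (trop_ext F) Z B' Q) (r - card B) (s - card B')"
    by (rule T.exch_contr[OF quot \<open>finite E\<close> rank_funD(1)[OF rP] rank_funD(1)[OF rQ] Z(1) BZ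
          basis_of_maximal[OF B(1) Z(2)] ranks])
  then have "exch F (E - Z) (initial_fun ?u m (contract_fun (trop_ext F) Z B P))
      (initial_fun ?u k (contract_fun (trop_ext F) Z B' Q)) (r - card B) (s - card B')"
    using exch_initial_fun Z(3) B(2) B'(2) by blast
  moreover note rP' = plucker_vectorD(1)[OF B(3)] and rQ' = plucker_vectorD(1)[OF B'(3)]
  ultimately have "exch F E (coloop_fun F Z (initial_fun ?u m (contract_fun (trop_ext F) Z B P)))
      (coloop_fun F Z (initial_fun ?u k (contract_fun (trop_ext F) Z B' Q))) (r - card B + card Z) (s - card B' + card Z)"
    using exch_coloop[OF rP' rQ' Z(4,2,3)] Z(5) by simp
  \<comment> \<open>Contraction may lower the two ranks by different amounts, so the rank condition
    needs an argument of its own.\<close>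
  moreover have "r - card B \<le> s - card B'"
    using T.contr_rank_le[OF quot rP rQ \<open>finite E\<close> Z(1) B(1) B'(1)] .
  ultimately show ?thesis
    unfolding B(4) B'(4) using rank_funD(1)[OF rP'] rank_funD(1)[OF rQ'] by (simp add: is_quotient_mat_of)
qed

text \<open>Lifts an exchange sum from initial forms: the term of \<open>i\<close> survives on both
  factors, so the common threshold is attained and \<open>nulls_of_init\<close> applies.\<close>

lemma exch_sum_of_initial_fun:
  fixes P Q :: "'e::linorder set \<Rightarrow> ('a \<times> 'g::linordered_ab_group_add) option"
  assumes "exch_sum F (initial_fun u p P) (initial_fun u q Q) I J \<in> nullset F"
    and fin: "finite I" "finite J" and ge: "tilt_ge u p P" "tilt_ge u q Q"
    and z: "zfun (trop_ext F) P" "zfun (trop_ext F) Q"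
    and att: "i \<in> J - I" "initial_fun u p P (insert i I) \<noteq> None" "initial_fun u q Q (J - {i}) \<noteq> None"
  shows "exch_sum (trop_ext F) P Q I J \<in> nullset (trop_ext F)"
proof -
  interpret T: tract "trop_ext F :: ('a \<times> 'g) tract" by (rule tract_trop_ext)
  let ?f = "\<lambda>j. zmult (trop_ext F) (exch_sign (trop_ext F) j I J)
      (zmult (trop_ext F) (P (insert j I)) (Q (J - {j})))"
  let ?m = "p + q + sum u I + sum u J"
  note terms = exch_term_init[OF ge _ fin]
  have "null_sum F (\<lambda>j. initial_coeff ?m (?f j)) (J - I) \<longleftrightarrow>
    exch_sum F (initial_fun u p P) (initial_fun u q Q) I J \<in> nullset F"
    unfolding exch_sum_def null_sum_def[symmetric]
    by (rule nulls_cong) (use terms in auto)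
  then have null: "null_sum F (\<lambda>j. initial_coeff ?m (?f j)) (J - I)" using assms(1) by simp
  have "initial_coeff ?m (?f i) \<noteq> None"
    using terms(1)[OF att(1), symmetric] att(2,3) by (simp add: exch_sign_def zsign_def)
  then show ?thesis
    unfolding exch_sum_def null_sum_def[symmetric]
    by (intro nulls_of_init[OF null _ terms(2) _ att(1)])
      (use fin z in \<open>auto simp: exch_sign_def\<close>)
qed

text \<open>
  To test the exchange relation at \<open>I, J\<close>, take \<open>u\<close> to be the valuation of the cocircuit \<open>Y\<close> of \<open>P\<close>
  at \<open>I\<close>. Then every nonzero entry of \<open>Y\<close> survives in the initial form, and the initial form of the sum
  pairing \<open>Y\<close> with the circuit \<open>X\<close> of \<open>Q\<close> at \<open>J\<close> pairs the initial forms of \<open>Y\<close> and \<open>X\<close>. Viewing \<open>Y\<close> and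
  \<open>X\<close> as functions on sets of size \<open>1\<close> and \<open>card E - 1\<close>, this is an exchange relation, obtained by
  transitivity along \<open>Y, P, Q, X\<close>.
\<close>

lemma exch_of_initial_matroids:
  fixes P Q :: "'e::linorder set \<Rightarrow> ('a \<times> 'g::linordered_ab_group_add) option"
  assumes "perfect F" and P: "plucker_vector (trop_ext F) E r P" and Q: "plucker_vector (trop_ext F) E s Q"
    and "finite E"
    and quot: "\<And>u :: 'e \<Rightarrow> 'g option. is_quotient F (initial_matroid F u (mat_of (trop_ext F) E s Q))
      (initial_matroid F u (mat_of (trop_ext F) E r P))"
  shows "exch (trop_ext F) E P Q r s"
proof -
  let ?T = "trop_ext F :: ('a \<times> 'g) tract"
  interpret T: tract ?T by (rule tract_trop_ext)
  note rP = plucker_vectorD(1)[OF P] and rQ = plucker_vectorD(1)[OF Q]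
  note zP = rank_funD(1)[OF rP] and zQ = rank_funD(1)[OF rQ]
  have "pairs_null ?T E (cocircuit_vec ?T P I) (circuit_vec ?T Q J)"
    if IJ: "I \<subseteq> E" "card I + 1 = r" "J \<subseteq> E" "card J = s + 1" for I J
  proof -
    define X where "X = circuit_vec ?T Q J"
    define Y where "Y = cocircuit_vec ?T P I"
    have zX: "zfun ?T X" and zY: "zfun ?T Y" using zP zQ by (auto simp: X_def Y_def)
    have Y_E: "Y i = None" if "i \<notin> E" for i
      using that rank_funD(2)[OF rP, of "insert i I"] by (auto simp: Y_def cocircuit_vec_def)
    define u where "u i = val (Y i)" for i
    define Z where "Z = infinite_coords E u"
    have Z_iff: "i \<in> Z \<longleftrightarrow> i \<in> E \<and> Y i = None" for i
      by (auto simp: Z_def infinite_coords_def u_def val_def)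
    let ?u = "\<lambda>i. the (u i)"
    have "Z \<subseteq> E" by (auto simp: Z_iff)
    then have Z: "Z \<subseteq> E" "finite Z" "finite (E - Z)" "Z \<inter> (E - Z) = {}" "E - Z \<union> Z = E"
      using \<open>finite E\<close> finite_subset by auto
    show "pairs_null ?T E Y X"
    \<comment> \<open>\<open>E - Z\<close> is the support of \<open>Y\<close>. If \<open>X\<close>
      vanishes there, all products are zero; otherwise \<open>E - Z\<close> is nonempty and the
      function \<open>x\<close> below is not identically zero.\<close>
    proof (cases "\<exists>i \<in> E - Z. X i \<noteq> None")
      case False
      then show ?thesis unfolding pairs_null_def
        by (intro T.nulls_empty) (auto simp: Z_iff)
    next
      case True
      then obtain i where i: "i \<in> E - Z" "X i \<noteq> None" by blast
      have E_ne: "E \<noteq> {}" "E - Z \<noteq> {}" using i by auto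
      have card_EZ: "card E - 1 - card Z = card (E - Z) - 1" "card E - 1 - card Z + card Z = card E - 1"
      proof -
        have "card (E - Z) + card Z = card E"
          using Z \<open>finite E\<close> by (metis card_Diff_subset card_mono le_add_diff_inverse2)
        moreover have "card (E - Z) > 0" using E_ne Z by (simp add: card_gt_0_iff)
        ultimately show "card E - 1 - card Z = card (E - Z) - 1" "card E - 1 - card Z + card Z = card E - 1"
          by linarith+
      qed
      obtain B m where B: "basis_of P Z B" "tilt_ge ?u m (contract_fun ?T Z B P)"
        "plucker_vector F (E - Z) (r - card B) (initial_fun ?u m (contract_fun ?T Z B P))"
        "initial_matroid F u (mat_of ?T E r P) =
          mat_of F E (r - card B + card Z) (coloop_fun F Z (initial_fun ?u m (contract_fun ?T Z B P)))"
        using initial_matroid_mat_of[OF P \<open>finite E\<close> Z_def] by blast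
      obtain B' k where B': "basis_of Q Z B'" "tilt_ge ?u k (contract_fun ?T Z B' Q)"
        "plucker_vector F (E - Z) (s - card B') (initial_fun ?u k (contract_fun ?T Z B' Q))"
        "initial_matroid F u (mat_of ?T E s Q) =
          mat_of F E (s - card B' + card Z) (coloop_fun F Z (initial_fun ?u k (contract_fun ?T Z B' Q)))"
        using initial_matroid_mat_of[OF Q \<open>finite E\<close> Z_def] by blast
      have BZ: "B \<subseteq> Z" "B' \<subseteq> Z" using B B' by (auto simp: basis_of_def)
      have ranks: "r - card B + card B = r" "s - card B' + card B' = s"
        using T.basis_of_rank[OF rP \<open>finite E\<close> Z(1) B(1)] T.basis_of_rank[OF rQ \<open>finite E\<close> Z(1) B'(1)]
        by (metis le_add2 le_add_diff_inverse2)+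
      let ?P = "initial_fun ?u m (contract_fun ?T Z B P)" and ?Q = "initial_fun ?u k (contract_fun ?T Z B' Q)"
      note rP' = plucker_vectorD(1)[OF B(3)] and rQ' = plucker_vectorD(1)[OF B'(3)]
      note zP' = rank_funD(1)[OF rP'] and zQ' = rank_funD(1)[OF rQ']
      have "exch F E (coloop_fun F Z ?P) (coloop_fun F Z ?Q) (r - card B + card Z) (s - card B' + card Z)"
        using quot[of u] zP' zQ' unfolding B(4) B'(4) by (simp add: is_quotient_mat_of)
      then have PQ: "exch F (E - Z) ?P ?Q (r - card B) (s - card B')"
        using exch_coloop[OF rP' rQ' Z(4,2,3)] Z(5) by simp

      \<comment> \<open>\<open>Y\<close> vanishes on \<open>Z\<close>, so the empty set is large
        enough to serve as the basis of \<open>Z\<close> for \<open>cov_fun Y\<close>.\<close>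
      define y where "y = contract_fun ?T Z {} (cov_fun Y)"
      have y_max: "cov_fun Y (insert j (S \<union> {})) = None" if "j \<in> Z - {}" for S j
      proof (rule ccontr)
        assume "cov_fun Y (insert j (S \<union> {})) \<noteq> None"
        then obtain i where "insert j (S \<union> {}) = {i}" "Y i \<noteq> None" by (rule cov_funE)
        then show False using that by (auto simp: Z_iff)
      qed
      have "exch ?T E (cov_fun Y) P 1 r"
        using T.exch_iff_pair[OF \<open>finite E\<close> zP zP, of r r] plucker_vectorD(3)[OF P] IJ(1,2)
        by (intro T.exch_cov_fun[OF \<open>finite E\<close> zY zP]) (auto simp: Y_def)
      then have "exch ?T (E - Z) y (contract_fun ?T Z B P) 1 (r - card B)"
        unfolding y_def
        by (rule T.exch_contr[OF _ \<open>finite E\<close> T.zfun_cov_fun[OF zY] zP Z(1) _ BZ(1) y_max _ ranks(1)]) auto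
      \<comment> \<open>As \<open>u\<close> is the valuation of \<open>Y\<close>, every nonzero
        entry of \<open>y\<close> has tilted valuation exactly 0.\<close>
      moreover have y_ge: "tilt_ge ?u 0 y"
        unfolding tilt_ge_def
      proof
        fix S
        show "val_ge (0 + sum ?u S) (y S)"
        proof (cases "y S = None")
          case False
          then have "cov_fun Y S \<noteq> None" by (auto simp: y_def contract_fun_def split: if_splits)
          then obtain i where i: "S = {i}" "Y i \<noteq> None" by (rule cov_funE)
          then have "y S = signed ?T (inv_count S {}) (Y i)" using False by (auto simp: y_def contract_fun_def split: if_splits)
          moreover have "inv_count S {} = 0" by (simp add: inv_count_def)
          ultimately have "y S = Y i" using zY by (simp add: T.sg_even)
          then show ?thesis using i by (auto simp: u_def val_def val_ge_def)
        qed simp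
      qed
      ultimately have yP: "exch F (E - Z) (initial_fun ?u 0 y) ?P 1 (r - card B)"
        using exch_initial_fun Z(3) B(2) by blast

      \<comment> \<open>The sets \<open>E - {i}\<close> with \<open>i\<close> outside
        \<open>Z\<close> all contain \<open>Z\<close>, so here \<open>Z\<close> itself takes the
        place of the basis.\<close>
      define x where "x = contract_fun ?T Z Z (vec_fun ?T E X)"
      have "exch ?T E Q (vec_fun ?T E X) s (card E - 1)"
        using T.exch_iff_pair[OF \<open>finite E\<close> zQ zQ, of s s] plucker_vectorD(3)[OF Q] IJ(3,4)
        by (intro T.exch_vec_fun[OF \<open>finite E\<close> zX zQ E_ne(1)]) (auto simp: X_def)
      then have "exch ?T (E - Z) (contract_fun ?T Z B' Q) x (s - card B') (card E - 1 - card Z)"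
        unfolding x_def
        by (rule T.exch_contr[OF _ \<open>finite E\<close> zQ T.zfun_vec_fun[OF zX] Z(1) BZ(2) subset_refl
            basis_of_maximal[OF B'(1) Z(2)] ranks(2) card_EZ(2)])
      then have Qx: "exch ?T (E - Z) (contract_fun ?T Z B' Q) x (s - card B') (card (E - Z) - 1)"
        by (simp only: card_EZ(1))
      have x_i: "x (E - Z - {i}) \<noteq> None" if "i \<in> E - Z" "X i \<noteq> None" for i
      proof -
        have "E - Z - {i} \<union> Z = E - {i}" "(E - Z - {i}) \<inter> Z = {}" using that Z by auto
        then show ?thesis using that by (simp add: x_def contract_fun_def vec_fun_Diff)
      qed
      have x_E: "\<exists>i \<in> E - Z. S = E - Z - {i}" if "x S \<noteq> None" for S
      proof -
        have "S \<inter> Z = {}" "vec_fun ?T E X (S \<union> Z) \<noteq> None"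
          using that by (auto simp: x_def contract_fun_def split: if_splits)
        then show ?thesis by (elim vec_funE) auto
      qed
      have "rank_fun ?T (E - Z) (card (E - Z) - 1) x"
        using zX Z(3) x_E by (auto simp: rank_fun_def x_def) (use x_E in \<open>fastforce simp: x_def\<close>)+
      then obtain l S where l: "tilt_ge ?u l x" "initial_fun ?u l x S \<noteq> None"
        using exists_tilt[where P = x, OF _ x_i[OF i] Z(3)] by blast
      have Qx': "exch F (E - Z) ?Q (initial_fun ?u l x) (s - card B') (card (E - Z) - 1)"
        using exch_initial_fun[OF Qx Z(3) B'(2) l(1)] .
      have zy: "zfun ?T y" and zx: "zfun ?T x" using zX zY by (auto simp: x_def y_def)
      have zy': "zfun F (initial_fun ?u 0 y)" and zx': "zfun F (initial_fun ?u l x)"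
        using zx zy by (auto simp: zfun_def initial_fun_def)
      \<comment> \<open>Here \<open>y\<close> is carried across the initial form of
        \<open>P\<close>, in the next step across that of \<open>Q\<close>.\<close>
      have "exch F (E - Z) (initial_fun ?u 0 y) ?Q 1 (s - card B')"
        by (rule exch_trans[OF assms(1) Z(3) B(3) zy' zQ' yP PQ])
      then have "exch F (E - Z) (initial_fun ?u 0 y) (initial_fun ?u l x) 1 (card (E - Z) - 1)"
        by (rule exch_trans[OF assms(1) Z(3) B'(3) zy' zx' _ Qx'])
      moreover have "card (E - Z) = card (E - Z) - 1 + 1" using E_ne Z(3) by (simp add: card_gt_0_iff)
      ultimately have null: "exch_sum F (initial_fun ?u 0 y) (initial_fun ?u l x) {} (E - Z) \<in> nullset F"
        unfolding exch_def by simp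
      have "x S \<noteq> None" using l(2) by (auto simp: initial_fun_def)
      then obtain j where j: "j \<in> E - Z" "S = E - Z - {j}" using x_E by blast
      \<comment> \<open>The term of \<open>j\<close> survives: \<open>j\<close> is chosen so that
        the entry of \<open>x\<close> attains the threshold \<open>l\<close>, and for
        \<open>y\<close> all entries on \<open>E - Z\<close> attain theirs.\<close>
      have "initial_fun ?u 0 y {j} \<noteq> None"
      proof -
        have "inv_count {j} {} = 0" by (simp add: inv_count_def)
        then have "y {j} = Y j" using j(1) zY by (simp add: y_def contract_fun_def T.sg_even)
        then show ?thesis using j(1) by (auto simp: Z_iff initial_fun_def u_def val_def not_None_eq)
      qed
      then have "exch_sum ?T y x {} (E - Z) \<in> nullset ?T"
        using exch_sum_of_initial_fun[OF null _ Z(3) y_ge l(1) zy zx, of j] j l(2) by simp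
      then have "pairs_null ?T (E - Z) (cocircuit_vec ?T y {}) (circuit_vec ?T x (E - Z))"
        using T.exch_sum_null_iff[OF Z(3) _ zy zx] by blast
      then have "pairs_null ?T E (cocircuit_vec ?T (cov_fun Y) ({} \<union> {})) (circuit_vec ?T (vec_fun ?T E X) (E - Z \<union> Z))"
        unfolding x_def y_def
        using T.pair_contr[OF \<open>finite E\<close> T.zfun_cov_fun[OF zY] T.zfun_vec_fun[OF zX] Z(1) _ _ _ _ y_max] by simp
      then have "pairs_null ?T E Y (circuit_vec ?T (vec_fun ?T E X) E)"
        using Z(5) zY by (simp add: T.cocircuit_vec_cov_fun)
      then show ?thesis
        using pair_cong[of E Y Y "circuit_vec ?T (vec_fun ?T E X) E" X ?T] zX
        by (simp add: T.circuit_vec_vec_fun)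
    qed
  qed
  then show ?thesis using T.exch_iff_pair[OF \<open>finite E\<close> zP zQ] by blast
qed

text \<open>For \<open>u = 0\<close> there are no infinite coordinates, so nothing is contracted and
  the initial matroids keep the ranks \<open>r\<close> and \<open>s\<close>.\<close>

lemma rank_le_of_initial_matroids:
  fixes P Q :: "'e::linorder set \<Rightarrow> ('a \<times> 'g::linordered_ab_group_add) option"
  assumes P: "plucker_vector (trop_ext F) E r P" and Q: "plucker_vector (trop_ext F) E s Q"
    and "finite E"
    and quot: "is_quotient F (initial_matroid F (\<lambda>_. Some (0 :: 'g)) (mat_of (trop_ext F) E s Q))
      (initial_matroid F (\<lambda>_. Some 0) (mat_of (trop_ext F) E r P))"
  shows "r \<le> s"
proof -
  have rank: "mrank (initial_matroid F (\<lambda>_. Some (0 :: 'g)) (mat_of (trop_ext F) E t R)) = t"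
    if R: "plucker_vector (trop_ext F) E t R" for t and R :: "'e set \<Rightarrow> ('a \<times> 'g) option"
  proof -
    have Z: "{} = infinite_coords E (\<lambda>_. Some (0 :: 'g))" by (simp add: infinite_coords_def)
    show ?thesis
    proof (rule initial_matroid_mat_of[OF R \<open>finite E\<close> Z])
      fix B m
      assume "basis_of R {} B"
        "initial_matroid F (\<lambda>_. Some (0 :: 'g)) (mat_of (trop_ext F) E t R) =
          mat_of F E (t - card B + card {}) (coloop_fun F {} (initial_fun (\<lambda>i. the (Some 0)) m (contract_fun (trop_ext F) {} B R)))"
      then show ?thesis by (simp add: basis_of_def)
    qed
  qed
  show ?thesis using quot rank[OF P] rank[OF Q] by (simp add: is_quotient_def)
qed

lemma matroid_initial_matroid:
  fixes P :: "'e::linorder set \<Rightarrow> ('a \<times> 'g::linordered_ab_group_add) option"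
  assumes P: "plucker_vector (trop_ext F) E r P" and "finite E"
  shows "matroid F (initial_matroid F u (mat_of (trop_ext F) E r P))"
    and "ground (initial_matroid F u (mat_of (trop_ext F) E r P)) = E"
proof -
  define Z where "Z = infinite_coords E u"
  let ?u = "\<lambda>i. the (u i)"
  obtain B m where B: "plucker_vector F (E - Z) (r - card B) (initial_fun ?u m (contract_fun (trop_ext F) Z B P))"
    "initial_matroid F u (mat_of (trop_ext F) E r P) =
      mat_of F E (r - card B + card Z) (coloop_fun F Z (initial_fun ?u m (contract_fun (trop_ext F) Z B P)))"
    using initial_matroid_mat_of[OF P \<open>finite E\<close> Z_def] by blast
  have Z: "finite Z" "finite (E - Z)" "Z \<inter> (E - Z) = {}" "E - Z \<union> Z = E"
    using \<open>finite E\<close> by (auto simp: Z_def infinite_coords_def)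
  show "matroid F (initial_matroid F u (mat_of (trop_ext F) E r P))"
    unfolding B(2) using matroid_mat_of[OF \<open>finite E\<close>] plucker_vector_coloop[OF B(1) Z(3,1,2)] Z(4) by simp
  show "ground (initial_matroid F u (mat_of (trop_ext F) E r P)) = E" by (simp add: B(2))
qed

end

theorem theorem2:
  fixes F :: "'a tract"
    and E :: "'e::linorder set"
    and Ms :: "('e, 'a \<times> 'g::linordered_ab_group_add) fmatroid list"
  assumes "tract F" and "perfect F"
    and "finite E"
    and "\<forall>M \<in> set Ms. matroid (trop_ext F) M \<and> ground M = E"
  shows "flag_matroid (trop_ext F) E Ms \<longleftrightarrow>
    (\<forall>u :: 'e \<Rightarrow> 'g option. flag_matroid F E (map (initial_matroid F u) Ms))"
proof -
  interpret tract F by fact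
  interpret T: tract "trop_ext F :: ('a \<times> 'g) tract" by (rule tract_trop_ext)
  have rep: "\<exists>r P. plucker_vector (trop_ext F) E r P \<and> M = mat_of (trop_ext F) E r P"
    if M: "M \<in> set Ms" for M
  proof -
    obtain E' r P where "plucker_vector (trop_ext F) E' r P" "M = mat_of (trop_ext F) E' r P"
      using assms(4) M matroid_iff_mat_of by blast
    moreover have "E' = E" using assms(4) M calculation by auto
    ultimately show ?thesis by blast
  qed
  \<comment> \<open>Being a flag is a condition on pairs, and the quantifier over \<open>u\<close>
    commutes with the one over pairs, so a single pair may be treated.\<close>
  have quot: "is_quotient (trop_ext F) N M \<longleftrightarrow>
      (\<forall>u :: 'e \<Rightarrow> 'g option. is_quotient F (initial_matroid F u N) (initial_matroid F u M))"
    if MN: "M \<in> set Ms" "N \<in> set Ms" for M N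
  proof -
    obtain r P s Q where P: "plucker_vector (trop_ext F) E r P" "M = mat_of (trop_ext F) E r P"
      and Q: "plucker_vector (trop_ext F) E s Q" "N = mat_of (trop_ext F) E s Q"
      using rep MN by meson
    note z = rank_funD(1)[OF plucker_vectorD(1)[OF P(1)]] rank_funD(1)[OF plucker_vectorD(1)[OF Q(1)]]
    show ?thesis
      unfolding P(2) Q(2) T.is_quotient_mat_of[OF z]
      using is_quotient_initial_matroid[OF P(1) Q(1) assms(3)]
        exch_of_initial_matroids[OF assms(2) P(1) Q(1) assms(3)]
        rank_le_of_initial_matroids[OF P(1) Q(1) assms(3)] by blast
  qed
  have mat: "matroid F (initial_matroid F u M) \<and> ground (initial_matroid F u M) = E" if M: "M \<in> set Ms" for M u
    using rep[OF M] matroid_initial_matroid assms(3) by blast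
  have "flag_matroid F E (map (initial_matroid F u) Ms) \<longleftrightarrow>
    (\<forall>i j. i < j \<and> j < length Ms \<longrightarrow>
      is_quotient F (initial_matroid F u (Ms ! j)) (initial_matroid F u (Ms ! i)))" for u :: "'e \<Rightarrow> 'g option"
    using mat by (auto simp: flag_matroid_def)
  moreover have "flag_matroid (trop_ext F) E Ms \<longleftrightarrow>
    (\<forall>i j. i < j \<and> j < length Ms \<longrightarrow> is_quotient (trop_ext F) (Ms ! j) (Ms ! i))"
    using assms(4) by (simp add: flag_matroid_def)
  moreover have "is_quotient (trop_ext F) (Ms ! j) (Ms ! i) \<longleftrightarrow>
      (\<forall>u :: 'e \<Rightarrow> 'g option. is_quotient F (initial_matroid F u (Ms ! j)) (initial_matroid F u (Ms ! i)))"
    if "i < j" "j < length Ms" for i j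
    using quot that by simp
  ultimately show ?thesis by (simp cong: conj_cong) blast
qed

end
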